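(* Let $W$ be any vector space over $\mathbb{C}$, let $\Gamma$ be a subgroup of $\mathbb{C}^\times$ and let $U$ be a $\mathcal{Y}_\Gamma$-closed quasi local subspace of $\mathcal{E}(W)$ containing $1_W$. Then $(W,Y_W)$ carries the structure of a quasi module for the vertex algebra $(U,\mathcal{Y}_1,1_W)$, where $$Y_W(a(x),x_0)=a(x_0)\quad\text{for } a(x)\in U.$$ Furthermore, for any quasi local subset $S$ of $\mathcal{E}(W)$, $(W,Y_W)$ (with $Y_W$ defined by the same formula) carries the structure of a quasi module for the vertex algebra $\langle S\rangle_\Gamma$.
   Context: All vector spaces are over $\mathbb{C}$; $x,x_0,x_1,x_2$ are commuting formal variables; $U((x))$ is the space of lower truncated Laurent series, $U((x_1))((x_2))=(U((x_1)))((x_2))$, $U((x_1,x_2))=U[[x_1,x_2]][x_1^{-1},x_2^{-1}]$. $\delta(z)=\sum_{n\in\mathbb{Z}}z^n$; integer powers of a binomial are expanded in nonnegative powers of the second-written term. For a vector space $W$, $\mathcal{E}(W)=\operatorname{Hom}(W,W((x)))$, and $1_W\in\mathcal{E}(W)$ is the identity operator viewed as a constant series. Compatibility: an ordered pair $(a(x),b(x))$ in $\mathcal{E}(W)$ is compatible if there is a nonzero polynomial $f(x_1,x_2)\in\mathbb{C}[x_1,x_2]$ with $f(x_1,x_2)a(x_1)b(x_2)\in \operatorname{Hom}(W,W((x_1,x_2)))$. A subspace is pairwise compatible if every ordered pair in it is compatible. Partial operations: for a compatible pair $(a(x),b(x))$, such an $f$, and $\alpha\in\mathbb{C}^\times$,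 define $a(x)_{(\alpha,n)}b(x)$ ($n\in\mathbb{Z}$) by $$\mathcal{Y}_\alpha(a(x),x_0)b(x)=\sum_{n\in\mathbb{Z}}\bigl(a(x)_{(\alpha,n)}b(x)\bigr)x_0^{-n-1}=\iota_{x,x_0}\bigl(f(x_0+\alpha x,x)^{-1}\bigr)\,\bigl(f(x_1,x)a(x_1)b(x)\bigr)\big|_{x_1=\alpha x+x_0},$$ where $\iota_{x,x_0}(f(x_0+\alpha x,x)^{-1})$ is the inverse of the nonzero polynomial $f(x_0+\alpha x,x)$ in the field $\mathbb{C}((x))((x_0))$ and in the substitution powers of $\alpha x+x_0$ are expanded in nonnegative powers of $x_0$. This is independent of the choice of $f$, and $a(x)_{(\alpha,n)}b(x)\in\mathcal{E}(W)$. Quasi locality: $a(x),b(x)\in\mathcal{E}(W)$ are mutually quasi local if there is a nonzero polynomial $f(x_1,x_2)$ with $f(x_1,x_2)a(x_1)b(x_2)=f(x_1,x_2)b(x_2)a(x_1)$. A subset (subspace) of $\mathcal{E}(W)$ is quasi local if any two of its elements (possibly equal) are mutually quasi local. Any quasi local subspace is pairwise compatible. For a subgroup $\Gamma$ of $\mathbb{C}^\times$, a pairwise compatible subspace $U$ of $\mathcal{E}(W)$ is $\mathcal{Y}_\Gamma$-closed if $a(x)_{(\alpha,n)}b(x)\in U$ for all $a(x),b(x)\in U$, $\alpha\in\Gamma$, $n\in\mathbb{Z}$. For a quasi local subset $S$, $\langle S\rangle_\Gamma$ denotes the smallest $\mathcal{Y}_\Gamma$-closed quasi local subspace of $\mathcal{E}(W)$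 containing $S$ and $1_W$ (it exists). It is known that for every $\mathcal{Y}_\Gamma$-closed quasi local subspace $U$ containing $1_W$ (in particular for $\langle S\rangle_\Gamma$), $(U,\mathcal{Y}_1,1_W)$ is a vertex algebra. Quasi module: for a vertex algebra $(V,Y,\mathbf 1)$, a quasi $V$-module is a vector space $W$ with a linear map $Y_W:V\to\operatorname{Hom}(W,W((x)))$ such that $Y_W(\mathbf 1,x)=1_W$ and for any $u,v\in V$ there is a nonzero polynomial $f(x_1,x_2)$ with $$x_0^{-1}\delta\left(\tfrac{x_1-x_2}{x_0}\right)f(x_1,x_2)Y_W(u,x_1)Y_W(v,x_2)-x_0^{-1}\delta\left(\tfrac{x_2-x_1}{-x_0}\right)f(x_1,x_2)Y_W(v,x_2)Y_W(u,x_1)=x_2^{-1}\delta\left(\tfrac{x_1-x_0}{x_2}\right)f(x_1,x_2)Y_W(Y(u,x_0)v,x_2).$$ *)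

theory Defs
  imports
    "HOL-Algebra.Group"
    "HOL-Computational_Algebra.Formal_Laurent_Series"
    "HOL-Library.Function_Algebras"
    "HOL-Library.Product_Plus"
    "HOL-Library.Groups_Big_Fun"
begin

section \<open>Formal series in several variables\<close>

text \<open>
  A doubly infinite formal series with coefficients in \<open>W\<close> is the function sending an
  exponent vector to a coefficient: exponents range over \<open>int \<times> int\<close> for two variables and
  over \<open>int \<times> int \<times> int\<close>, always in the order \<open>(x\<^sub>0, x\<^sub>1, x\<^sub>2)\<close>, for three.
  Infinite sums are taken with \<^const>\<open>Sum_any\<close>, which adds up the nonzero terms
  and is meaningful when only finitely many terms are nonzero; every product and
  substitution formed below has this property.
\<close>

definition series_mult ::
    "(complex \<Rightarrow> 'w \<Rightarrow> 'w) \<Rightarrow> ('e::ab_group_add \<Rightarrow> complex) \<Rightarrow> ('e \<Rightarrow> 'w::ab_group_add) \<Rightarrow> 'e \<Rightarrow> 'w"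
  where "series_mult scale c A e = Sum_any (\<lambda>d. scale (c d) (A (e - d)))"

text \<open>
  The coefficient of \<open>s\<^sup>i t\<^sup>j\<close> in \<open>(c s + d t)\<^sup>k\<close>, expanded in nonnegative powers of \<open>t\<close>.
\<close>

definition binomial_coeff :: "complex \<Rightarrow> complex \<Rightarrow> int \<Rightarrow> int \<Rightarrow> int \<Rightarrow> complex"
  where "binomial_coeff c d k i j =
    (if j \<ge> 0 \<and> i + j = k then c powi i * d ^ nat j * (of_int k gchoose nat j) else 0)"

text \<open>
  A polynomial \<open>f(x\<^sub>1, x\<^sub>2)\<close> is an element of \<^typ>\<open>complex poly poly\<close>; the outer
  polynomial variable is \<open>x\<^sub>1\<close>, the inner one is \<open>x\<^sub>2\<close>.
\<close>

definition poly_series :: "complex poly poly \<Rightarrow> int \<times> int \<Rightarrow> complex"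
  where "poly_series f = (\<lambda>(m, n). if m \<ge> 0 \<and> n \<ge> 0 then coeff (coeff f (nat m)) (nat n) else 0)"

text \<open>\<open>a(x\<^sub>1) b(x\<^sub>2) w\<close>, with exponents in the order \<open>(x\<^sub>1, x\<^sub>2)\<close>.\<close>

definition op_prod :: "('w::zero \<Rightarrow> 'w fls) \<Rightarrow> ('w \<Rightarrow> 'w fls) \<Rightarrow> 'w \<Rightarrow> int \<times> int \<Rightarrow> 'w"
  where "op_prod a b w = (\<lambda>(m, n). fls_nth (a (fls_nth (b w) n)) m)"

text \<open>\<open>b(x\<^sub>2) a(x\<^sub>1) w\<close>, again with exponents in the order \<open>(x\<^sub>1, x\<^sub>2)\<close>.\<close>

definition op_prod_rev :: "('w::zero \<Rightarrow> 'w fls) \<Rightarrow> ('w \<Rightarrow> 'w fls) \<Rightarrow> 'w \<Rightarrow> int \<times> int \<Rightarrow> 'w"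
  where "op_prod_rev a b w = (\<lambda>(m, n). fls_nth (b (fls_nth (a w) m)) n)"

text \<open>\<open>W((x\<^sub>1, x\<^sub>2)) = W[[x\<^sub>1, x\<^sub>2]][x\<^sub>1\<^sup>-\<^sup>1, x\<^sub>2\<^sup>-\<^sup>1]\<close>\<close>

definition laurent2 :: "(int \<times> int \<Rightarrow> 'w::zero) set"
  where "laurent2 = {A. \<exists>N. \<forall>m n. m < N \<or> n < N \<longrightarrow> A (m, n) = 0}"


section \<open>The space \<open>\<E>(W) = Hom(W, W((x)))\<close>\<close>

definition fls_scale :: "(complex \<Rightarrow> 'w \<Rightarrow> 'w) \<Rightarrow> complex \<Rightarrow> 'w::zero fls \<Rightarrow> 'w fls"
  where "fls_scale scale c F = Abs_fls (\<lambda>n. scale c (fls_nth F n))"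

definition E_space :: "(complex \<Rightarrow> 'w \<Rightarrow> 'w) \<Rightarrow> ('w::ab_group_add \<Rightarrow> 'w fls) set"
  where "E_space scale = {a. Vector_Spaces.linear scale (fls_scale scale) a}"

text \<open>Addition on \<open>\<E>(W)\<close> is the pointwise addition of functions.\<close>

definition E_scale ::
    "(complex \<Rightarrow> 'w \<Rightarrow> 'w) \<Rightarrow> complex \<Rightarrow> ('w::ab_group_add \<Rightarrow> 'w fls) \<Rightarrow> 'w \<Rightarrow> 'w fls"
  where "E_scale scale c a = (\<lambda>w. fls_scale scale c (a w))"

text \<open>The identity operator \<open>1\<^sub>W\<close>, as a constant series.\<close>

abbreviation (input) E_one :: "'w::ab_group_add \<Rightarrow> 'w fls"
  where "E_one \<equiv> fls_const"


section \<open>Compatibility and quasi locality\<close>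

text \<open>
  Linearity in \<open>w\<close> of \<open>f(x\<^sub>1,x\<^sub>2) a(x\<^sub>1) b(x\<^sub>2)\<close> is automatic for \<open>a, b \<in> \<E>(W)\<close>, so that membership in
  \<open>Hom(W, W((x\<^sub>1,x\<^sub>2)))\<close> is a condition on its values.
\<close>

definition compat_poly ::
    "(complex \<Rightarrow> 'w \<Rightarrow> 'w) \<Rightarrow> ('w::ab_group_add \<Rightarrow> 'w fls) \<Rightarrow> ('w \<Rightarrow> 'w fls) \<Rightarrow> complex poly poly \<Rightarrow> bool"
  where "compat_poly scale a b f \<longleftrightarrow>
    f \<noteq> 0 \<and> (\<forall>w. series_mult scale (poly_series f) (op_prod a b w) \<in> laurent2)"

definition pairwise_compatible ::
    "(complex \<Rightarrow> 'w \<Rightarrow> 'w) \<Rightarrow> ('w::ab_group_add \<Rightarrow> 'w fls) set \<Rightarrow> bool"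
  where "pairwise_compatible scale U \<longleftrightarrow> (\<forall>a\<in>U. \<forall>b\<in>U. \<exists>f. compat_poly scale a b f)"

definition mutually_quasi_local ::
    "(complex \<Rightarrow> 'w \<Rightarrow> 'w) \<Rightarrow> ('w::ab_group_add \<Rightarrow> 'w fls) \<Rightarrow> ('w \<Rightarrow> 'w fls) \<Rightarrow> bool"
  where "mutually_quasi_local scale a b \<longleftrightarrow>
    (\<exists>f. f \<noteq> 0 \<and> (\<forall>w. series_mult scale (poly_series f) (op_prod a b w)
                     = series_mult scale (poly_series f) (op_prod_rev a b w)))"

definition quasi_local ::
    "(complex \<Rightarrow> 'w \<Rightarrow> 'w) \<Rightarrow> ('w::ab_group_add \<Rightarrow> 'w fls) set \<Rightarrow> bool"
  where "quasi_local scale S \<longleftrightarrow>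
    S \<subseteq> E_space scale \<and> (\<forall>a\<in>S. \<forall>b\<in>S. mutually_quasi_local scale a b)"


section \<open>The partial operations \<open>a(x)\<^sub>(\<^sub>\<alpha>\<^sub>,\<^sub>n\<^sub>) b(x)\<close>\<close>

text \<open>
  The field \<open>\<complex>((x))((x\<^sub>0))\<close> is \<^typ>\<open>complex fls fls\<close>: the outer series variable is \<open>x\<^sub>0\<close>, the
  inner one is \<open>x\<close>.  The next constant is \<open>f(x\<^sub>0 + \<alpha> x, x)\<close>.
\<close>

definition poly_shift :: "complex \<Rightarrow> complex poly poly \<Rightarrow> complex fls fls"
  where "poly_shift \<alpha> f =
    poly (map_poly (\<lambda>p. fls_const (fps_to_fls (fps_of_poly p))) f)
         (fls_X + fls_const (fls_const \<alpha> * fls_X))"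

text \<open>
  \<open>A(x\<^sub>1, x)|\<^bsub>x\<^sub>1 = \<alpha>x + x\<^sub>0\<^esub>\<close> for \<open>A \<in> W((x\<^sub>1, x))\<close>: the term \<open>A\<^sub>m\<^sub>n x\<^sub>1\<^sup>m x\<^sup>n\<close> becomes
  \<open>A\<^sub>m\<^sub>n (\<alpha>x + x\<^sub>0)\<^sup>m x\<^sup>n\<close>.  The exponents \<open>(p, q)\<close> of the result are those of \<open>(x\<^sub>0, x)\<close>.
\<close>

definition subst_shift ::
    "(complex \<Rightarrow> 'w \<Rightarrow> 'w) \<Rightarrow> complex \<Rightarrow> (int \<times> int \<Rightarrow> 'w::ab_group_add) \<Rightarrow> int \<times> int \<Rightarrow> 'w"
  where "subst_shift scale \<alpha> A = (\<lambda>(p, q).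
    Sum_any (\<lambda>(m, n). scale (binomial_coeff \<alpha> 1 m (q - n) p) (A (m, n))))"

text \<open>\<open>\<Y>\<^sub>\<alpha>(a(x), x\<^sub>0) b(x) w\<close> computed with the polynomial \<open>f\<close>, exponents in the order \<open>(x\<^sub>0, x)\<close>.\<close>

definition Y_alpha_series ::
    "(complex \<Rightarrow> 'w \<Rightarrow> 'w) \<Rightarrow> complex \<Rightarrow> complex poly poly \<Rightarrow> ('w::ab_group_add \<Rightarrow> 'w fls) \<Rightarrow>
     ('w \<Rightarrow> 'w fls) \<Rightarrow> 'w \<Rightarrow> int \<times> int \<Rightarrow> 'w"
  where "Y_alpha_series scale \<alpha> f a b w =
    series_mult scale (\<lambda>(p, q). fls_nth (fls_nth (inverse (poly_shift \<alpha> f)) p) q)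
      (subst_shift scale \<alpha> (series_mult scale (poly_series f) (op_prod a b w)))"

text \<open>
  The coefficient of \<open>x\<^sub>0\<^sup>-\<^sup>n\<^sup>-\<^sup>1\<close> does not depend on the polynomial, so an arbitrary one
  is chosen.
\<close>

definition nth_prod ::
    "(complex \<Rightarrow> 'w \<Rightarrow> 'w) \<Rightarrow> complex \<Rightarrow> int \<Rightarrow> ('w::ab_group_add \<Rightarrow> 'w fls) \<Rightarrow> ('w \<Rightarrow> 'w fls) \<Rightarrow> 'w \<Rightarrow> 'w fls"
  where "nth_prod scale \<alpha> n a b =
    (\<lambda>w. Abs_fls (\<lambda>q. Y_alpha_series scale \<alpha> (SOME f. compat_poly scale a b f) a b w (- n - 1, q)))"

text \<open>\<open>\<Y>\<^sub>\<alpha>(a(x), x\<^sub>0) b(x) = \<Sum>\<^sub>n (a(x)\<^sub>(\<^sub>\<alpha>\<^sub>,\<^sub>n\<^sub>) b(x)) x\<^sub>0\<^sup>-\<^sup>n\<^sup>-\<^sup>1\<close> as an element of \<open>\<E>(W)((x\<^sub>0))\<close>.\<close>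

definition Y_alpha ::
    "(complex \<Rightarrow> 'w \<Rightarrow> 'w) \<Rightarrow> complex \<Rightarrow> ('w::ab_group_add \<Rightarrow> 'w fls) \<Rightarrow> ('w \<Rightarrow> 'w fls) \<Rightarrow> ('w \<Rightarrow> 'w fls) fls"
  where "Y_alpha scale \<alpha> a b = Abs_fls (\<lambda>p. nth_prod scale \<alpha> (- p - 1) a b)"


section \<open>Closed quasi local subspaces\<close>

definition complex_units :: "complex monoid"
  where "complex_units = \<lparr>carrier = UNIV - {0}, monoid.mult = (*), one = 1\<rparr>"

definition Y_closed ::
    "(complex \<Rightarrow> 'w \<Rightarrow> 'w) \<Rightarrow> complex set \<Rightarrow> ('w::ab_group_add \<Rightarrow> 'w fls) set \<Rightarrow> bool"
  where "Y_closed scale \<Gamma> U \<longleftrightarrow>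
    U \<subseteq> E_space scale \<and> module.subspace (E_scale scale) U \<and> pairwise_compatible scale U \<and>
    (\<forall>a\<in>U. \<forall>b\<in>U. \<forall>\<alpha>\<in>\<Gamma>. \<forall>n. nth_prod scale \<alpha> n a b \<in> U)"

text \<open>\<open>\<langle>S\<rangle>\<^sub>\<Gamma>\<close>; the order on sets is inclusion.\<close>

definition generated ::
    "(complex \<Rightarrow> 'w \<Rightarrow> 'w) \<Rightarrow> complex set \<Rightarrow> ('w::ab_group_add \<Rightarrow> 'w fls) set \<Rightarrow> ('w \<Rightarrow> 'w fls) set"
  where "generated scale \<Gamma> S =
    (LEAST U. Y_closed scale \<Gamma> U \<and> quasi_local scale U \<and> S \<subseteq> U \<and> E_one \<in> U)"


section \<open>Vertex algebras and quasi modules\<close>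

text \<open>
  Coefficients of \<open>x\<^sub>0\<^sup>p x\<^sub>1\<^sup>m x\<^sub>2\<^sup>n\<close> in the three delta functions
  \<^item> \<open>x\<^sub>0\<^sup>-\<^sup>1 \<delta>((x\<^sub>1 - x\<^sub>2) / x\<^sub>0) = \<Sum>\<^sub>k x\<^sub>0\<^sup>-\<^sup>k\<^sup>-\<^sup>1 (x\<^sub>1 - x\<^sub>2)\<^sup>k\<close>,
  \<^item> \<open>x\<^sub>0\<^sup>-\<^sup>1 \<delta>((x\<^sub>2 - x\<^sub>1) / -x\<^sub>0) = \<Sum>\<^sub>k (-1)\<^sup>k x\<^sub>0\<^sup>-\<^sup>k\<^sup>-\<^sup>1 (x\<^sub>2 - x\<^sub>1)\<^sup>k\<close>,
  \<^item> \<open>x\<^sub>2\<^sup>-\<^sup>1 \<delta>((x\<^sub>1 - x\<^sub>0) / x\<^sub>2) = \<Sum>\<^sub>k x\<^sub>2\<^sup>-\<^sup>k\<^sup>-\<^sup>1 (x\<^sub>1 - x\<^sub>0)\<^sup>k\<close>.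
\<close>

definition delta_12 :: "int \<times> int \<times> int \<Rightarrow> complex"
  where "delta_12 = (\<lambda>(p, m, n). binomial_coeff 1 (-1) (- p - 1) m n)"

definition delta_21 :: "int \<times> int \<times> int \<Rightarrow> complex"
  where "delta_21 = (\<lambda>(p, m, n). (-1) powi (- p - 1) * binomial_coeff 1 (-1) (- p - 1) n m)"

definition delta_10 :: "int \<times> int \<times> int \<Rightarrow> complex"
  where "delta_10 = (\<lambda>(p, m, n). binomial_coeff 1 (-1) (- n - 1) m p)"

text \<open>A series in \<open>x\<^sub>1, x\<^sub>2\<close>, respectively in \<open>x\<^sub>0, x\<^sub>2\<close>, as a series in \<open>x\<^sub>0, x\<^sub>1, x\<^sub>2\<close>.\<close>

definition series_in_12 :: "(int \<times> int \<Rightarrow> 'w::zero) \<Rightarrow> int \<times> int \<times> int \<Rightarrow> 'w"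
  where "series_in_12 A = (\<lambda>(p, m, n). if p = 0 then A (m, n) else 0)"

definition series_in_02 :: "(int \<times> int \<Rightarrow> 'w::zero) \<Rightarrow> int \<times> int \<times> int \<Rightarrow> 'w"
  where "series_in_02 A = (\<lambda>(p, m, n). if m = 0 then A (p, n) else 0)"

text \<open>
  The Jacobi identity for \<open>u, v\<close> multiplied by \<open>f(x\<^sub>1, x\<^sub>2)\<close> and applied to \<open>w\<close>; \<open>Y u v\<close>
  is \<open>Y(u, x\<^sub>0) v\<close>.
\<close>

definition jacobi_times ::
    "(complex \<Rightarrow> 'w \<Rightarrow> 'w) \<Rightarrow> ('v \<Rightarrow> 'v \<Rightarrow> 'v::zero fls) \<Rightarrow> ('v \<Rightarrow> 'w::ab_group_add \<Rightarrow> 'w fls) \<Rightarrow>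
     complex poly poly \<Rightarrow> 'v \<Rightarrow> 'v \<Rightarrow> 'w \<Rightarrow> bool"
  where "jacobi_times scale Y Y\<^sub>W f u v w \<longleftrightarrow>
    (\<forall>e. series_mult scale delta_12
           (series_in_12 (series_mult scale (poly_series f) (op_prod (Y\<^sub>W u) (Y\<^sub>W v) w))) e
       - series_mult scale delta_21
           (series_in_12 (series_mult scale (poly_series f) (op_prod_rev (Y\<^sub>W u) (Y\<^sub>W v) w))) e
       = series_mult scale delta_10
           (series_mult scale (series_in_12 (poly_series f))
             (series_in_02 (\<lambda>(p, n). fls_nth (Y\<^sub>W (fls_nth (Y u v) p) w) n))) e)"

text \<open>
  The underlying space of a vertex algebra is a subspace \<open>V\<close> of an ambient vector space.
\<close>

locale vertex_algebra = vector_space scale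
  for scale :: "complex \<Rightarrow> 'v::ab_group_add \<Rightarrow> 'v" +
  fixes V :: "'v set" and Y :: "'v \<Rightarrow> 'v \<Rightarrow> 'v fls" and vac :: 'v
  assumes subspace_V: "subspace V"
    and vac_in_V: "vac \<in> V"
    and Y_in_V: "\<lbrakk>u \<in> V; v \<in> V\<rbrakk> \<Longrightarrow> fls_nth (Y u v) n \<in> V"
    and Y_add_left: "\<lbrakk>u \<in> V; u' \<in> V; v \<in> V\<rbrakk> \<Longrightarrow> Y (u + u') v = Y u v + Y u' v"
    and Y_scale_left: "\<lbrakk>u \<in> V; v \<in> V\<rbrakk> \<Longrightarrow> Y (scale c u) v = fls_scale scale c (Y u v)"
    and Y_add_right: "\<lbrakk>u \<in> V; v \<in> V; v' \<in> V\<rbrakk> \<Longrightarrow> Y u (v + v') = Y u v + Y u v'"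
    and Y_scale_right: "\<lbrakk>u \<in> V; v \<in> V\<rbrakk> \<Longrightarrow> Y u (scale c v) = fls_scale scale c (Y u v)"
    and vacuum: "v \<in> V \<Longrightarrow> Y vac v = fls_const v"
    and creation_regular: "\<lbrakk>v \<in> V; n < 0\<rbrakk> \<Longrightarrow> fls_nth (Y v vac) n = 0"
    and creation: "v \<in> V \<Longrightarrow> fls_nth (Y v vac) 0 = v"
    and jacobi: "\<lbrakk>u \<in> V; v \<in> V; w \<in> V\<rbrakk> \<Longrightarrow> jacobi_times scale Y Y 1 u v w"

locale quasi_module = vertex_algebra scale\<^sub>V V Y vac + W: vector_space scale\<^sub>W
  for scale\<^sub>V :: "complex \<Rightarrow> 'v::ab_group_add \<Rightarrow> 'v" and V Y vac
    and scale\<^sub>W :: "complex \<Rightarrow> 'w::ab_group_add \<Rightarrow> 'w" +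
  fixes Y\<^sub>W :: "'v \<Rightarrow> 'w \<Rightarrow> 'w fls"
  assumes Y\<^sub>W_in_E: "v \<in> V \<Longrightarrow> Y\<^sub>W v \<in> E_space scale\<^sub>W"
    and Y\<^sub>W_add: "\<lbrakk>u \<in> V; v \<in> V\<rbrakk> \<Longrightarrow> Y\<^sub>W (u + v) = Y\<^sub>W u + Y\<^sub>W v"
    and Y\<^sub>W_scale: "v \<in> V \<Longrightarrow> Y\<^sub>W (scale\<^sub>V c v) = E_scale scale\<^sub>W c (Y\<^sub>W v)"
    and Y\<^sub>W_vac: "Y\<^sub>W vac = E_one"
    and quasi_jacobi:
      "\<lbrakk>u \<in> V; v \<in> V\<rbrakk> \<Longrightarrow> \<exists>f. f \<noteq> 0 \<and> (\<forall>w. jacobi_times scale\<^sub>W Y Y\<^sub>W f u v w)"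

end

theory Submission
  imports Defs "HOL-Library.Poly_Mapping"
begin

text \<open>
  Nearly every identity below is first proved after multiplication by a nonzero polynomial, which
  is then cancelled.  Cancellation is legitimate in spaces of iterated Laurent series such as
  \<open>W((x))((x\<^sub>0))\<close>: the support of a nonzero element has a least exponent for the lexicographic
  order, and so a nonzero Laurent polynomial does not annihilate it (\<open>cancel_iter_laurent2\<close>,
  \<open>cancel_iter_laurent3\<close>).  Laurent polynomials act on formal series of arbitrary support, and a
  linear map on series that carries multiplication by the variables to multiplication by \<open>s, t\<close>
  carries multiplication by \<open>f(x\<^sub>1, x\<^sub>2)\<close> to multiplication by \<open>f(s, t)\<close> (\<open>rel_eval2\<close>).  In
  particular \<open>\<Y>\<^sub>\<alpha>(a(x), x\<^sub>0) b(x) w\<close> is the unique element \<open>G\<close> of \<open>W((x))((x\<^sub>0))\<close> such that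
  \<open>f(\<alpha>x + x\<^sub>0, x) G\<close> is the result of substituting \<open>x\<^sub>1 = \<alpha>x + x\<^sub>0\<close> in \<open>f(x\<^sub>1, x) a(x\<^sub>1) b(x) w\<close>
  (\<open>yprod_eqI\<close>, \<open>yprod_char\<close>), from which linearity and the vacuum properties follow.

  \<^bold>\<open>The quasi module.\<close>  If \<open>f\<close> expresses the quasi locality of \<open>u, v\<close>, then
  \<open>F = f(x\<^sub>1, x\<^sub>2) u(x\<^sub>1) v(x\<^sub>2) w = f(x\<^sub>1, x\<^sub>2) v(x\<^sub>2) u(x\<^sub>1) w\<close> lies in \<open>W((x\<^sub>1, x\<^sub>2))\<close>, and
  \<open>f(x\<^sub>2 + x\<^sub>0, x\<^sub>2) \<Y>(u, x\<^sub>0) v w = F(x\<^sub>2 + x\<^sub>0, x\<^sub>2)\<close> holds by definition.  The quasi Jacobi identity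
  is therefore the three-term delta function identity multiplied by \<open>F\<close> (\<open>delta_identity\<close>,
  \<open>quasi_jacobi_of_expansions\<close>).

  \<^bold>\<open>The vertex algebra.\<close>  For \<open>u, v, c\<close> with polynomials \<open>f, f', f''\<close> expressing the quasi locality
  of \<open>(u, v), (u, c), (v, c)\<close>, the series
  \<open>H = f(y\<^sub>1, y\<^sub>2) f'(y\<^sub>1, x) f''(y\<^sub>2, x) u(y\<^sub>1) v(y\<^sub>2) c(x) w\<close> has poles of finite order in every
  variable, since the three factors can be reordered (\<open>H_laurent3\<close>).  After the substitution
  \<open>y\<^sub>1 = x + x\<^sub>1\<close>, \<open>y\<^sub>2 = x + x\<^sub>2\<close> it becomes the common product of \<open>\<Y>(u, x\<^sub>1) \<Y>(v, x\<^sub>2) c\<close> and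
  \<open>\<Y>(v, x\<^sub>2) \<Y>(u, x\<^sub>1) c\<close> with \<open>f(x + x\<^sub>1, x + x\<^sub>2) f'(x + x\<^sub>1, x) f''(x + x\<^sub>2, x)\<close>, while
  \<open>\<Y>(\<Y>(u, x\<^sub>0) v, x\<^sub>2) c\<close> is related in the same way to the further substitution \<open>x\<^sub>1 = x\<^sub>2 + x\<^sub>0\<close>
  (\<open>P1_eq\<close>, \<open>P2_eq\<close>, \<open>P3_eq\<close>).  The polynomial defining \<open>\<Y>(u, x\<^sub>1)\<close> on a coefficient of
  \<open>\<Y>(v, x\<^sub>2) c\<close> depends on the coefficient; \<open>family_yprod\<close> deals with this.  The first factor is
  \<open>(x\<^sub>1 - x\<^sub>2)\<^sup>k\<close> times a polynomial whose value at \<open>x\<^sub>1 = x\<^sub>2 = 0\<close> is a nonzero polynomial in \<open>x\<close>, and the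
  other two are such polynomials times a power of \<open>x\<^sub>1\<close> and of \<open>x\<^sub>2\<close>.  Dividing by polynomials of this kind creates no
  poles in \<open>x\<^sub>1, x\<^sub>2\<close> (\<open>division_no_poles\<close>), so that multiplication by \<open>(x\<^sub>1 - x\<^sub>2)\<^sup>k\<close> makes both
  products equal and gives them poles of bounded order in \<open>x\<^sub>1\<close> and \<open>x\<^sub>2\<close> (\<open>common_expansion\<close>).  In
  the Jacobi identity \<open>(x\<^sub>1 - x\<^sub>2)\<^sup>k\<close> becomes \<open>x\<^sub>0\<^sup>k\<close>, which is invertible
  (\<open>jacobi_of_expansions\<close>, \<open>jacobi_on_E\<close>).

  \<^bold>\<open>The generated subspace.\<close>  A maximal quasi local set containing \<open>S\<close> and \<open>1\<^sub>W\<close> exists by Zorn's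
  lemma, and it is a closed subspace because quasi locality passes to products as in Dong's lemma
  (\<open>ql_poly_nth_prod\<close>, \<open>exists_closed_quasi_local\<close>).  Hence the intersection of all closed quasi
  local subspaces containing \<open>S\<close> and \<open>1\<^sub>W\<close> is one of them, and it is \<open>\<langle>S\<rangle>\<^sub>\<Gamma>\<close> (\<open>generated_props\<close>).
\<close>

section \<open>Finite sums over an index type\<close>

lemma Sum_any_reindex:
  fixes g :: "'b \<Rightarrow> 'c::comm_monoid_add"
  assumes "inj \<phi>" and "\<And>x. x \<notin> range \<phi> \<Longrightarrow> g x = 0"
  shows "Sum_any g = Sum_any (\<lambda>j. g (\<phi> j))"
proof -
  have "{x. g x \<noteq> 0} = \<phi> ` {j. g (\<phi> j) \<noteq> 0}"
    using assms(2) by (force simp: image_iff)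
  then show ?thesis
    unfolding Sum_any.expand_set using assms(1)
    by (simp add: sum.reindex inj_on_subset)
qed

lemma Sum_any_int_shift: "Sum_any g = Sum_any (\<lambda>k. g (k - a))" for a :: int
proof (rule Sum_any_reindex)
  show "x \<notin> range (\<lambda>k. k - a) \<Longrightarrow> g x = 0" for x
    using rangeI[of "\<lambda>k. k - a" "x + a"] by simp
qed (simp add: inj_def)

lemma Sum_any_int_reflect: "Sum_any g = Sum_any (\<lambda>k. g (a - k))" for a :: int
proof (rule Sum_any_reindex)
  show "x \<notin> range (\<lambda>k. a - k) \<Longrightarrow> g x = 0" for x
    using rangeI[of "\<lambda>k. a - k" "a - x"] by simp
qed (simp add: inj_def)

lemma finite_support_int:
  fixes g :: "int \<Rightarrow> 'c::zero"
  assumes "\<And>j. j < a \<Longrightarrow> g j = 0" and "\<And>j. j > b \<Longrightarrow> g j = 0"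
  shows "finite {j. g j \<noteq> 0}"
  by (rule finite_subset[of _ "{a..b}"]) (use assms in \<open>auto simp: not_less[symmetric]\<close>)

lemma Sum_any_additive:
  fixes L :: "'b::comm_monoid_add \<Rightarrow> 'c::comm_monoid_add"
  assumes "L 0 = 0" and "\<And>x y. L (x + y) = L x + L y" and "finite {j. g j \<noteq> 0}"
  shows "L (Sum_any g) = Sum_any (\<lambda>j. L (g j))"
proof -
  have "L (sum g I) = sum (\<lambda>j. L (g j)) I" if "finite I" for I
    using that by (induction I rule: finite_induct) (use assms in auto)
  moreover have "Sum_any (\<lambda>j. L (g j)) = sum (\<lambda>j. L (g j)) {j. g j \<noteq> 0}"
    by (rule Sum_any.expand_superset) (use assms in auto)
  ultimately show ?thesis
    unfolding Sum_any.expand_set[of g] using assms(3) by simp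
qed


section \<open>Binomial coefficients with integer arguments\<close>

text \<open>The binomial coefficient of two integers, zero for a negative lower argument.\<close>

definition zchoose :: "int \<Rightarrow> int \<Rightarrow> complex"
  where "zchoose a k = (if k < 0 then 0 else of_int a gchoose nat k)"

lemma zchoose_neg [simp]: "k < 0 \<Longrightarrow> zchoose a k = 0"
  by (simp add: zchoose_def)

lemma zchoose_zero [simp]: "zchoose a 0 = 1"
  by (simp add: zchoose_def)

lemma zchoose_pascal: "zchoose (a + 1) k = zchoose a k + zchoose a (k - 1)"
proof (cases "k \<le> 0")
  case True
  then show ?thesis by (auto simp: zchoose_def)
next
  case False
  then obtain n where k: "k = int (Suc n)"
    by (metis gr0_implies_Suc not_le of_nat_0_less_iff zero_less_imp_eq_int)
  have "nat (int (Suc n) - 1) = n" by simp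
  then show ?thesis
    by (simp add: zchoose_def k gbinomial_Suc_Suc del: of_nat_Suc)
qed

lemma zchoose_nat: "zchoose (int n) (int k) = of_nat (n choose k)"
  by (simp add: zchoose_def binomial_gbinomial)

lemma zchoose_eq_0: "0 \<le> a \<Longrightarrow> a < k \<Longrightarrow> zchoose a k = 0"
  by (metis binomial_eq_0 le_less_trans less_imp_le of_nat_0 of_nat_less_iff zchoose_nat zero_le_imp_eq_int)

lemma zchoose_symmetric:
  assumes "0 \<le> a" shows "zchoose a k = zchoose a (a - k)"
proof -
  consider "k < 0" | "k > a" | "0 \<le> k" "k \<le> a" by linarith
  then show ?thesis
  proof cases
    case 1 then show ?thesis using zchoose_eq_0[of a "a - k"] assms by simp
  next
    case 2 then show ?thesis using zchoose_eq_0[of a k] assms by simp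
  next
    case 3
    obtain n m where nm: "a = int n" "k = int m" using 3 by (metis assms zero_le_imp_eq_int)
    moreover from this have "a - k = int (n - m)" using 3 by simp
    ultimately show ?thesis using 3 binomial_symmetric[of m n] by (metis of_nat_le_iff zchoose_nat)
  qed
qed

lemma zchoose_negate: "0 \<le> k \<Longrightarrow> zchoose a k = (-1) powi k * zchoose (k - a - 1) k"
  using gbinomial_negated_upper[of "of_int a :: complex" "nat k"]
  by (simp add: zchoose_def power_int_def)

text \<open>\<open>(-1)\<^sup>j\<close> times the coefficient of \<open>t\<^sup>j\<close> in \<open>(1 + t)\<^sup>m\<^sup>+\<^sup>j\<close>, with a fixed upper argument.\<close>

lemma zchoose_sign: "(-1) powi j * zchoose (m + j) j = zchoose (- m - 1) j"
  by (cases "j < 0") (use zchoose_negate[of j "- m - 1"] in \<open>simp_all add: add.commute\<close>)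

lemma zchoose_vandermonde:
  "(\<Sum>i=0..k. zchoose a i * zchoose b (k - i)) = zchoose (a + b) k"
proof (cases "k < 0")
  case False
  have "(\<Sum>i=0..k. zchoose a i * zchoose b (k - i)) =
      (\<Sum>i=0..nat k. zchoose a (int i) * zchoose b (k - int i))"
    by (rule sum.reindex_bij_witness[of _ int nat]) (use False in auto)
  also have "\<dots> = (\<Sum>i=0..nat k. (of_int a gchoose i) * (of_int b gchoose (nat k - i)))"
    by (rule sum.cong) (use False in \<open>auto simp: zchoose_def nat_diff_distrib\<close>)
  also have "\<dots> = zchoose (a + b) k"
    using False by (simp add: gbinomial_Vandermonde zchoose_def)
  finally show ?thesis .
qed (simp add: zchoose_def)

lemma zchoose_trinomial:
  assumes "0 \<le> p" "0 \<le> t"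
  shows "zchoose (p + t) p * zchoose a (p + t) = zchoose a p * zchoose (a - p) t"
proof -
  obtain m n where p: "p = int m" and t: "t = int n" by (metis assms zero_le_imp_eq_int)
  have e: "nat (int m + int n) = m + n" by simp
  have "((of_int a :: complex) gchoose (m + n)) * (of_nat (m + n) gchoose m) =
     (of_int a gchoose m) * (of_int a - of_nat m gchoose n)"
    using gbinomial_trinomial_revision[of m "m + n" "of_int a :: complex"] by simp
  then show ?thesis
    by (simp add: p t zchoose_def e mult.commute)
qed


section \<open>Evaluating polynomials in two variables\<close>

text \<open>
  The value \<open>f(s, t)\<close> in a ring receiving the coefficients through \<open>\<iota>\<close>; the outer variable is
  replaced by \<open>s\<close>, the inner one by \<open>t\<close>.
\<close>

definition eval2 :: "(complex \<Rightarrow> 'r::comm_ring_1) \<Rightarrow> complex poly poly \<Rightarrow> 'r \<Rightarrow> 'r \<Rightarrow> 'r"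
  where "eval2 \<iota> f s t = poly (map_poly (\<lambda>p. poly (map_poly \<iota> p) t) f) s"

lemma eval2_pCons:
  assumes "\<iota> 0 = 0"
  shows "eval2 \<iota> (pCons p f) s t = poly (map_poly \<iota> p) t + s * eval2 \<iota> f s t"
  by (simp add: eval2_def map_poly_pCons)

lemma poly_map_poly_hom:
  fixes \<phi> :: "'a::comm_ring_1 \<Rightarrow> 'r::comm_ring_1"
  assumes "\<phi> 0 = 0" "\<And>a b. \<phi> (a + b) = \<phi> a + \<phi> b" "\<And>a b. \<phi> (a * b) = \<phi> a * \<phi> b"
  shows poly_map_poly_hom_add:
      "poly (map_poly \<phi> (p + q)) x = poly (map_poly \<phi> p) x + poly (map_poly \<phi> q) x"
    and poly_map_poly_hom_mult:
      "poly (map_poly \<phi> (p * q)) x = poly (map_poly \<phi> p) x * poly (map_poly \<phi> q) x"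
proof -
  show add: "poly (map_poly \<phi> (p + q)) x = poly (map_poly \<phi> p) x + poly (map_poly \<phi> q) x" for p q
    by (induction p q rule: poly_induct2) (simp_all add: map_poly_pCons assms algebra_simps)
  have smult: "poly (map_poly \<phi> (smult a q)) x = \<phi> a * poly (map_poly \<phi> q) x" for a q
    by (induction q) (simp_all add: map_poly_pCons assms algebra_simps)
  show "poly (map_poly \<phi> (p * q)) x = poly (map_poly \<phi> p) x * poly (map_poly \<phi> q) x"
    by (induction p) (simp_all add: map_poly_pCons assms add smult algebra_simps)
qed

lemma eval2_hom:
  assumes "\<iota> 0 = 0" "\<And>a b. \<iota> (a + b) = \<iota> a + \<iota> b" "\<And>a b. \<iota> (a * b) = \<iota> a * \<iota> b"
  shows eval2_add: "eval2 \<iota> (f + g) s t = eval2 \<iota> f s t + eval2 \<iota> g s t"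
    and eval2_mult: "eval2 \<iota> (f * g) s t = eval2 \<iota> f s t * eval2 \<iota> g s t"
  unfolding eval2_def
  by (rule poly_map_poly_hom; simp add: poly_map_poly_hom_add poly_map_poly_hom_mult assms)+

lemma eval2_0 [simp]: "eval2 \<iota> 0 s t = 0"
  by (simp add: eval2_def)

text \<open>
  A map \<open>L\<close> defined on \<open>D\<close>, between two modules over possibly different rings; the pairs of
  scalars \<open>(r, q)\<close> with \<open>L (r x) = q (L x)\<close> are closed under sums and products, so that
  such a relation for the variables extends to all polynomials in them.
\<close>

locale intertwiner = M1: module a1 + M2: module a2
  for a1 :: "'r::comm_ring_1 \<Rightarrow> 'm::ab_group_add \<Rightarrow> 'm"
    and a2 :: "'q::comm_ring_1 \<Rightarrow> 'n::ab_group_add \<Rightarrow> 'n" +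
  fixes D :: "'m set" and L :: "'m \<Rightarrow> 'n"
  assumes D_add: "x \<in> D \<Longrightarrow> y \<in> D \<Longrightarrow> x + y \<in> D"
    and L_add: "x \<in> D \<Longrightarrow> y \<in> D \<Longrightarrow> L (x + y) = L x + L y"
begin

text \<open>\<open>L\<close> intertwines multiplication by \<open>r\<close>, which preserves \<open>D\<close>, with multiplication by \<open>q\<close>.\<close>

definition rel :: "'r \<Rightarrow> 'q \<Rightarrow> bool"
  where "rel r q \<longleftrightarrow> (\<forall>x\<in>D. a1 r x \<in> D \<and> L (a1 r x) = a2 q (L x))"

lemma relD: "rel r q \<Longrightarrow> x \<in> D \<Longrightarrow> L (a1 r x) = a2 q (L x)"
  and rel_closed: "rel r q \<Longrightarrow> x \<in> D \<Longrightarrow> a1 r x \<in> D"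
  by (auto simp: rel_def)

lemma rel_add: "rel r q \<Longrightarrow> rel r' q' \<Longrightarrow> rel (r + r') (q + q')"
  by (auto simp: rel_def M1.scale_left_distrib M2.scale_left_distrib D_add L_add)

lemma rel_mult: "rel r q \<Longrightarrow> rel r' q' \<Longrightarrow> rel (r * r') (q * q')"
  by (auto simp: rel_def simp flip: M1.scale_scale M2.scale_scale)

lemma rel_one: "rel 1 1"
  by (auto simp: rel_def)

lemma rel_power: "rel r q \<Longrightarrow> rel (r ^ n) (q ^ n)"
  by (induction n) (auto simp: rel_one rel_mult)

lemma rel_cong: "rel r q \<Longrightarrow> (\<And>x. x \<in> D \<Longrightarrow> a2 q (L x) = a2 q' (L x)) \<Longrightarrow> rel r q'"
  by (simp add: rel_def)

lemma rel_eval2: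
  assumes "\<iota>1 0 = 0" "\<iota>2 0 = 0" and c: "\<And>c. rel (\<iota>1 c) (\<iota>2 c)" and "rel s1 s2" "rel t1 t2"
  shows "rel (eval2 \<iota>1 f s1 t1) (eval2 \<iota>2 f s2 t2)"
proof -
  have 0: "rel 0 0" using c[of 0] assms(1,2) by simp
  have 1: "rel (poly (map_poly \<iota>1 p) t1) (poly (map_poly \<iota>2 p) t2)" for p
    by (induction p) (auto simp: map_poly_pCons assms 0 intro!: rel_add rel_mult c)
  show ?thesis
    by (induction f) (auto simp: eval2_pCons assms 0 1 intro!: rel_add rel_mult)
qed

end


section \<open>Laurent polynomials acting on formal series\<close>

text \<open>
  Finitely supported functions on the exponents are Laurent polynomials; they act on all formal
  series with coefficients in a vector space, whatever the support of the series.
\<close>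

text \<open>The monomial with exponent \<open>d\<close>, and the constants.\<close>

abbreviation mon :: "'e \<Rightarrow> 'e \<Rightarrow>\<^sub>0 complex"
  where "mon d \<equiv> Poly_Mapping.single d 1"

abbreviation cnst :: "complex \<Rightarrow> 'e::zero \<Rightarrow>\<^sub>0 complex"
  where "cnst c \<equiv> Poly_Mapping.single 0 c"

text \<open>The Laurent polynomial \<open>f(s, t)\<close>.\<close>

abbreviation ev :: "complex poly poly \<Rightarrow> ('e::ab_group_add \<Rightarrow>\<^sub>0 complex) \<Rightarrow> ('e \<Rightarrow>\<^sub>0 complex) \<Rightarrow> 'e \<Rightarrow>\<^sub>0 complex"
  where "ev \<equiv> eval2 cnst"

lemma ev_add: "ev (f + g) s t = ev f s t + ev g s t"
  by (rule eval2_add) (simp_all add: single_add mult_single)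

lemma ev_mult: "ev (f * g) s t = ev f s t * ev g s t"
  by (rule eval2_mult) (simp_all add: single_add mult_single)

lemma ev_pCons: "ev (pCons p f) s t = poly (map_poly cnst p) t + s * ev f s t"
  by (simp add: eval2_pCons)

lemma ev_one [simp]: "ev 1 s t = 1"
  by (simp add: eval2_def)

lemma ev_power: "ev (f ^ n) s t = ev f s t ^ n"
  by (induction n) (simp_all add: ev_mult)

text \<open>The product of a Laurent polynomial with a series; every coefficient is a finite sum.\<close>

definition act ::
    "(complex \<Rightarrow> 'w \<Rightarrow> 'w) \<Rightarrow> ('e::ab_group_add \<Rightarrow>\<^sub>0 complex) \<Rightarrow> ('e \<Rightarrow> 'w::ab_group_add) \<Rightarrow> 'e \<Rightarrow> 'w"
  where "act scale p A = series_mult scale (Poly_Mapping.lookup p) A"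

lemma poly_mapping_single_induct [case_names zero single add]:
  assumes "P 0" "\<And>d c. P (Poly_Mapping.single d c)" "\<And>p q. P p \<Longrightarrow> P q \<Longrightarrow> P (p + q)"
  shows "P (p :: 'e \<Rightarrow>\<^sub>0 'c::comm_monoid_add)"
proof (induction p rule: Poly_Mapping.update_induct)
  case const
  then show ?case by (fact assms(1))
next
  case (update f a b)
  have "Poly_Mapping.update a b f = f + Poly_Mapping.single a b"
    by (rule poly_mapping_eqI)
      (use update(1) in \<open>auto simp: lookup_update lookup_add lookup_single in_keys_iff when_def\<close>)
  then show ?case using assms update by simp
qed


text \<open>
  Complex vector spaces; in this context \<open>p \<bullet> A\<close> is the product of a Laurent polynomial \<open>p\<close> with a
  series \<open>A\<close>, and all series with exponents in a fixed group form a module.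
\<close>

locale complex_vector_space = vector_space scale
  for scale :: "complex \<Rightarrow> 'w::ab_group_add \<Rightarrow> 'w"
begin

abbreviation act_scale :: "('e::ab_group_add \<Rightarrow>\<^sub>0 complex) \<Rightarrow> ('e \<Rightarrow> 'w) \<Rightarrow> 'e \<Rightarrow> 'w" (infixr \<open>\<bullet>\<close> 75)
  where "p \<bullet> A \<equiv> act scale p A"

lemma act_eq: "(p \<bullet> A) e = (\<Sum>d\<in>Poly_Mapping.keys p. scale (Poly_Mapping.lookup p d) (A (e - d)))"
  unfolding act_def series_mult_def
  by (rule Sum_any.expand_superset) (auto simp: in_keys_iff)

lemma act_superset:
  "finite I \<Longrightarrow> Poly_Mapping.keys p \<subseteq> I \<Longrightarrow>
    (p \<bullet> A) e = (\<Sum>d\<in>I. scale (Poly_Mapping.lookup p d) (A (e - d)))"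
  unfolding act_def series_mult_def
  by (rule Sum_any.expand_superset) (auto simp: in_keys_iff)

lemma act_single [simp]: "(Poly_Mapping.single d c \<bullet> A) e = scale c (A (e - d))"
  by (subst act_superset[of "{d}"]) auto

lemma act_add_left: "(p + q) \<bullet> A = p \<bullet> A + q \<bullet> A"
proof
  fix e
  let ?I = "Poly_Mapping.keys p \<union> Poly_Mapping.keys q"
  have "Poly_Mapping.keys (p + q) \<subseteq> ?I" by (rule Poly_Mapping.keys_add)
  then show "((p + q) \<bullet> A) e = (p \<bullet> A + q \<bullet> A) e"
    by (simp add: act_superset[of ?I] lookup_add scale_left_distrib sum.distrib)
qed

lemma act_add_right: "p \<bullet> (A + B) = p \<bullet> A + p \<bullet> B"
  by (rule ext) (simp add: act_eq scale_right_distrib sum.distrib)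

lemma act_scale_right: "p \<bullet> (\<lambda>e. scale c (A e)) = (\<lambda>e. scale c ((p \<bullet> A) e))"
  by (rule ext) (simp add: act_eq scale_sum_right mult.commute)

lemma act_zero_left: "0 \<bullet> A = 0"
  by (rule ext) (simp add: act_eq)

lemma act_mult: "(p * q) \<bullet> A = p \<bullet> (q \<bullet> A)"
proof (induction p rule: poly_mapping_single_induct)
  case zero
  then show ?case by (simp add: act_zero_left)
next
  case (add p p')
  then show ?case by (simp add: act_add_left distrib_right)
next
  case (single d c)
  show ?case
  proof (induction q rule: poly_mapping_single_induct)
    case zero
    then show ?case by (rule ext) (simp add: act_zero_left)
  next
    case (add q q')
    then show ?case
      by (simp add: act_add_left act_add_right distrib_left) (simp add: fun_eq_iff scale_right_distrib)
  next
    case (single d' c')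
    show ?case by (rule ext) (simp add: mult_single algebra_simps)
  qed
qed

lemma module_act: "module (act scale :: ('e::ab_group_add \<Rightarrow>\<^sub>0 complex) \<Rightarrow> _)"
proof
  show "(1 :: 'e \<Rightarrow>\<^sub>0 complex) \<bullet> A = A" for A :: "'e \<Rightarrow> 'w"
    by (rule ext) (simp flip: single_one)
qed (simp_all add: act_add_left act_add_right act_mult)

end

sublocale complex_vector_space \<subseteq> act: module "act scale"
  by (rule module_act)

text \<open>
  A linear map between spaces of series.  The relation \<open>rel p p'\<close> says that it carries
  multiplication by \<open>p\<close> to multiplication by \<open>p'\<close>.
\<close>

locale linear_series_map = V1: complex_vector_space s1 + V2: complex_vector_space s2
  for s1 :: "complex \<Rightarrow> 'v::ab_group_add \<Rightarrow> 'v" and s2 :: "complex \<Rightarrow> 'w::ab_group_add \<Rightarrow> 'w" +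
  fixes D :: "('e::ab_group_add \<Rightarrow> 'v) set" and L :: "('e \<Rightarrow> 'v) \<Rightarrow> 'f::ab_group_add \<Rightarrow> 'w"
  assumes add_D: "A \<in> D \<Longrightarrow> B \<in> D \<Longrightarrow> (\<lambda>e. A e + B e) \<in> D"
    and scale_D: "A \<in> D \<Longrightarrow> (\<lambda>e. s1 c (A e)) \<in> D"
    and add_L: "A \<in> D \<Longrightarrow> B \<in> D \<Longrightarrow> L (\<lambda>e. A e + B e) = (\<lambda>e. L A e + L B e)"
    and scale_L: "A \<in> D \<Longrightarrow> L (\<lambda>e. s1 c (A e)) = (\<lambda>e. s2 c (L A e))"

sublocale linear_series_map \<subseteq> intertwiner "act s1" "act s2" D L
  by unfold_locales (simp_all add: plus_fun_def add_D add_L)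

context linear_series_map
begin

lemma rel_cnst: "rel (cnst c) (cnst c)"
proof -
  have "act s1 (cnst c) A = (\<lambda>e. s1 c (A e))" for A :: "'e \<Rightarrow> 'v"
    by (rule ext) simp
  moreover have "act s2 (cnst c) A = (\<lambda>e. s2 c (A e))" for A :: "'f \<Rightarrow> 'w"
    by (rule ext) simp
  ultimately show ?thesis by (simp add: rel_def scale_D scale_L)
qed

lemma rel_ev: "rel s s' \<Longrightarrow> rel t t' \<Longrightarrow> rel (ev f s t) (ev f s' t')"
  by (rule rel_eval2) (simp_all add: rel_cnst)

lemma rel_mon:
  assumes "\<And>A. A \<in> D \<Longrightarrow> (\<lambda>e. A (e - d)) \<in> D"
    and "\<And>A. A \<in> D \<Longrightarrow> L (\<lambda>e. A (e - d)) = (\<lambda>e. L A (e - d'))"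
  shows "rel (mon d) (mon d')"
proof -
  have "act s1 (mon d) A = (\<lambda>e. A (e - d))" for A :: "'e \<Rightarrow> 'v"
    by (rule ext) simp
  moreover have "act s2 (mon d') A = (\<lambda>e. A (e - d'))" for A :: "'f \<Rightarrow> 'w"
    by (rule ext) simp
  ultimately show ?thesis by (simp add: rel_def assms)
qed

end

text \<open>
  For a linear map \<open>L\<close> defined on \<open>D\<close> between spaces of series over the same vector space:
  \<open>carries D L p q\<close> means that \<open>L (p A) = q (L A)\<close> for all \<open>A\<close> in \<open>D\<close>, and that \<open>p A\<close> is again in \<open>D\<close>.
\<close>

abbreviation (in complex_vector_space) carries ::
    "('e \<Rightarrow> 'w) set \<Rightarrow> (('e \<Rightarrow> 'w) \<Rightarrow> 'f \<Rightarrow> 'w) \<Rightarrow> ('e::ab_group_add \<Rightarrow>\<^sub>0 complex) \<Rightarrow> ('f::ab_group_add \<Rightarrow>\<^sub>0 complex) \<Rightarrow> bool"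
  where "carries \<equiv> intertwiner.rel (act scale) (act scale)"

lemma (in complex_vector_space) act_mon [simp]: "mon d \<bullet> A = (\<lambda>e. A (e - d))"
  by (rule ext) simp


section \<open>Nonzero Laurent polynomials\<close>

lemma complex_vector_space_mult: "complex_vector_space ((*) :: complex \<Rightarrow> complex \<Rightarrow> complex)"
  by unfold_locales (simp_all add: algebra_simps)

interpretation complex_field: complex_vector_space "(*) :: complex \<Rightarrow> complex \<Rightarrow> complex"
  by (rule complex_vector_space_mult)

lemma act_lookup: "act (*) p (Poly_Mapping.lookup q) = Poly_Mapping.lookup (p * q)"
proof (induction p rule: poly_mapping_single_induct)
  case zero
  then show ?case by (simp add: complex_field.act_zero_left fun_eq_iff)
next
  case (add p p')
  then show ?case by (simp add: complex_field.act_add_left distrib_right fun_eq_iff lookup_add)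
next
  case (single d c)
  show ?case
  proof (induction q rule: poly_mapping_single_induct)
    case zero
    then show ?case by (simp add: fun_eq_iff)
  next
    case (add q q')
    then show ?case by (simp add: fun_eq_iff lookup_add distrib_left)
  next
    case (single d' c')
    show ?case
      by (rule ext) (auto simp: mult_single lookup_single when_def algebra_simps)
  qed
qed

text \<open>
  A polynomial in Laurent polynomials \<open>s, t\<close> is nonzero as soon as it is nonzero at the
  eigenvalues of \<open>s, t\<close> on some nonzero series.
\<close>

definition eigen :: "('e::ab_group_add \<Rightarrow> complex) \<Rightarrow> ('e \<Rightarrow>\<^sub>0 complex) \<Rightarrow> complex \<Rightarrow> bool"
  where "eigen A p z \<longleftrightarrow> act (*) p A = (\<lambda>e. z * A e)"

lemma eigen_add: "eigen A p z \<Longrightarrow> eigen A q z' \<Longrightarrow> eigen A (p + q) (z + z')"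
  by (simp add: eigen_def complex_field.act_add_left fun_eq_iff algebra_simps)

lemma eigen_mult: "eigen A p z \<Longrightarrow> eigen A q z' \<Longrightarrow> eigen A (p * q) (z * z')"
  unfolding eigen_def complex_field.act_mult
  by (simp only: complex_field.act_scale_right) (simp only: ac_simps)

lemma eigen_cnst: "eigen A (cnst c) c"
  by (simp add: eigen_def fun_eq_iff)

lemma eigen_ev:
  assumes "eigen A s z" "eigen A t z'"
  shows "eigen A (ev f s t) (eval2 id f z z')"
proof -
  have 1: "eigen A (poly (map_poly cnst p) t) (poly (map_poly id p) z')" for p
    by (induction p)
      (auto simp: map_poly_pCons eigen_cnst[of _ 0, simplified] intro!: eigen_add eigen_mult eigen_cnst assms)
  show ?thesis
    by (induction f)
      (use 1 in \<open>auto simp: eval2_pCons eigen_cnst[of _ 0, simplified] intro!: eigen_add eigen_mult assms\<close>)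
qed

lemma eigen_nonzero:
  assumes "eigen A p z" "z \<noteq> 0" "A e \<noteq> 0"
  shows "p \<noteq> 0"
proof
  assume "p = 0"
  then have "(\<lambda>e. z * A e) = 0"
    using assms(1) by (simp add: eigen_def complex_field.act_zero_left)
  then have "z * A e = 0" by (metis zero_fun_apply)
  then show False using assms by simp
qed

lemma exists_poly_nonroot:
  fixes p :: "complex poly"
  assumes "p \<noteq> 0" "finite B"
  obtains t where "t \<notin> B" "poly p t \<noteq> 0"
proof -
  have "infinite (UNIV - ({t. poly p t = 0} \<union> B))"
    using assms poly_roots_finite[of p] infinite_UNIV_char_0 by (meson finite_Diff2 finite_UnI)
  then have "UNIV - ({t. poly p t = 0} \<union> B) \<noteq> {}" by (metis finite.emptyI)
  then show thesis using that by blast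
qed

text \<open>
  A nonzero polynomial in two variables does not vanish at some point avoiding finitely many
  values of \<open>t\<close>, and for each \<open>t\<close> finitely many values of \<open>s\<close>.
\<close>

lemma exists_nonroot:
  assumes "f \<noteq> 0" "finite B" "\<And>t. finite (C t)"
  obtains s t where "t \<notin> B" "s \<notin> C t" "eval2 id f s t \<noteq> 0"
proof -
  let ?l = "lead_coeff f"
  obtain t where t: "t \<notin> B" "poly ?l t \<noteq> 0"
    using exists_poly_nonroot[of ?l B] assms by auto
  let ?g = "map_poly (\<lambda>p. poly (map_poly id p) t) f"
  have "coeff ?g (degree f) \<noteq> 0" using t by (simp add: coeff_map_poly)
  then have "?g \<noteq> 0" by (metis coeff_0)
  then obtain s where "s \<notin> C t" "poly ?g s \<noteq> 0"
    using exists_poly_nonroot[of ?g "C t"] assms by blast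
  then show thesis using that t by (simp add: eval2_def)
qed

text \<open>Exponents of series in two and in three variables.\<close>

type_synonym exp2 = "int \<times> int"
type_synonym exp3 = "int \<times> int \<times> int"

text \<open>
  The series with coefficients \<open>y\<^sup>-\<^sup>p z\<^sup>-\<^sup>q\<close> is an eigenvector for multiplication by either variable,
  with eigenvalues \<open>y\<close> and \<open>z\<close>; likewise in three variables.
\<close>

definition character2 :: "complex \<Rightarrow> complex \<Rightarrow> exp2 \<Rightarrow> complex"
  where "character2 y z = (\<lambda>(p, q). y powi (- p) * z powi (- q))"

definition character3 :: "complex \<Rightarrow> complex \<Rightarrow> complex \<Rightarrow> exp3 \<Rightarrow> complex"
  where "character3 x y z = (\<lambda>(p, q, r). x powi (- p) * y powi (- q) * z powi (- r))"

lemma power_int_shift: "(z::complex) \<noteq> 0 \<Longrightarrow> z powi (1 - n) = z * z powi (- n)"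
  by (metis add_uminus_conv_diff power_int_1_right power_int_add)

lemma eigen_character2:
  assumes "y \<noteq> 0" "z \<noteq> 0"
  shows "eigen (character2 y z) (mon (1, 0)) y" "eigen (character2 y z) (mon (0, 1)) z"
  using assms by (auto simp: eigen_def character2_def fun_eq_iff power_int_shift)

lemma eigen_character3:
  assumes "x \<noteq> 0" "y \<noteq> 0" "z \<noteq> 0"
  shows "eigen (character3 x y z) (mon (1, 0, 0)) x" "eigen (character3 x y z) (mon (0, 1, 0)) y"
    "eigen (character3 x y z) (mon (0, 0, 1)) z"
  using assms by (auto simp: eigen_def character3_def fun_eq_iff power_int_shift)

lemma eigen_character2_nonzero: "eigen (character2 y z) p c \<Longrightarrow> c \<noteq> 0 \<Longrightarrow> p \<noteq> 0"
  by (erule eigen_nonzero[where e = "(0, 0)"]) (simp_all add: character2_def)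

lemma eigen_character3_nonzero: "eigen (character3 x y z) p c \<Longrightarrow> c \<noteq> 0 \<Longrightarrow> p \<noteq> 0"
  by (erule eigen_nonzero[where e = "(0, 0, 0)"]) (simp_all add: character3_def)

text \<open>
  In this and the next lemmas, \<open>f(s, t)\<close> is nonzero because the eigenvalues of \<open>s, t\<close> can be given
  any values outside a few lines, and \<open>f\<close> does not vanish at some such point.
\<close>

lemma ev_shift_nonzero:
  assumes "f \<noteq> 0"
  shows "ev f (mon (1, 0) + cnst \<alpha> * mon (0, 1)) (mon (0, 1) :: exp2 \<Rightarrow>\<^sub>0 complex) \<noteq> 0"
proof -
  obtain s t where st: "t \<notin> {0}" "s \<notin> {\<alpha> * t}" "eval2 id f s t \<noteq> 0"
    by (rule exists_nonroot[OF assms, of "{0}" "\<lambda>t. {\<alpha> * t}"]) auto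
  let ?A = "character2 (s - \<alpha> * t) t"
  have 1: "eigen ?A (mon (1, 0)) (s - \<alpha> * t)" "eigen ?A (mon (0, 1)) t"
    using st by (auto intro!: eigen_character2)
  have "eigen ?A (mon (1, 0) + cnst \<alpha> * mon (0, 1)) (s - \<alpha> * t + \<alpha> * t)"
    by (intro eigen_add eigen_mult eigen_cnst 1)
  from eigen_ev[OF this 1(2), of f] show ?thesis
    using st(3) by (auto dest: eigen_character2_nonzero)
qed

lemma ev_swap_nonzero:
  assumes "f \<noteq> 0"
  shows "ev f (mon (0, 1)) (mon (1, 0) :: exp2 \<Rightarrow>\<^sub>0 complex) \<noteq> 0"
proof -
  obtain s t where st: "t \<notin> {0}" "s \<notin> {0}" "eval2 id f s t \<noteq> 0"
    by (rule exists_nonroot[OF assms, of "{0}" "\<lambda>t. {0}"]) auto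
  let ?A = "character2 t s"
  have 1: "eigen ?A (mon (1, 0)) t" "eigen ?A (mon (0, 1)) s"
    using st by (auto intro!: eigen_character2)
  from eigen_ev[OF this(2,1), of f] show ?thesis
    using st(3) by (auto dest: eigen_character2_nonzero)
qed

lemma ev_shift3_nonzero:
  assumes "f \<noteq> 0"
  shows "ev f (mon (0, 1, 0) + mon (0, 0, 1)) (mon (0, 0, 1) :: exp3 \<Rightarrow>\<^sub>0 complex) \<noteq> 0" (is ?th1)
    and "ev f (mon (1, 0, 0) + mon (0, 1, 0) + mon (0, 0, 1)) (mon (0, 0, 1) :: exp3 \<Rightarrow>\<^sub>0 complex) \<noteq> 0" (is ?th2)
    and "ev f (mon (1, 0, 0) + mon (0, 1, 0) + mon (0, 0, 1))
           (mon (0, 1, 0) + mon (0, 0, 1) :: exp3 \<Rightarrow>\<^sub>0 complex) \<noteq> 0" (is ?th3)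
proof -
  obtain s t where st: "t \<notin> {0, 1}" "s \<notin> {t, t + 1}" "eval2 id f s t \<noteq> 0"
    by (rule exists_nonroot[OF assms, of "{0, 1}" "\<lambda>t. {t, t + 1}"]) auto
  have 1: "eigen (character3 x y z) (mon (0, 1, 0) + mon (0, 0, 1)) (y + z)"
      "eigen (character3 x y z) (mon (1, 0, 0) + mon (0, 1, 0) + mon (0, 0, 1)) (x + y + z)"
    if "x \<noteq> 0" "y \<noteq> 0" "z \<noteq> 0" for x y z
    using that by (auto intro!: eigen_add eigen_character3)
  have e: "ev f p q \<noteq> 0"
    if "eigen (character3 x y z) p s" "eigen (character3 x y z) q t" for p q x y z
    using eigen_ev[OF that, of f] st(3) by (rule eigen_character3_nonzero)
  have nz: "s - t - 1 \<noteq> 0" "s - t \<noteq> 0" "t \<noteq> 0" "t - 1 \<noteq> 0"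
    using st(1,2) by (simp_all add: diff_eq_eq add.commute)
  show ?th1
    using e[of 1 "s - t" t] 1(1)[of 1 "s - t" t] eigen_character3(3)[of 1 "s - t" t] nz by simp
  show ?th2
    using e[of "s - t - 1" 1 t] 1(2)[of "s - t - 1" 1 t] eigen_character3(3)[of "s - t - 1" 1 t] nz
    by simp
  have "eigen (character3 (s - t) (t - 1) 1) (mon (1, 0, 0) + mon (0, 1, 0) + mon (0, 0, 1)) s"
    "eigen (character3 (s - t) (t - 1) 1) (mon (0, 1, 0) + mon (0, 0, 1)) t"
    using 1(2)[OF nz(2,4) one_neq_zero] 1(1)[OF nz(2,4) one_neq_zero]
    by (simp_all only: diff_add_cancel add_diff_eq)
  then show ?th3 by (rule e)
qed

lemma ev_diagonal_nonzero:
  assumes "poly f [:0, 1:] \<noteq> 0"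
  shows "ev f (mon (0, 0, 1)) (mon (0, 0, 1) :: exp3 \<Rightarrow>\<^sub>0 complex) \<noteq> 0"
proof -
  let ?p = "poly f [:0, 1:]"
  obtain t where t: "t \<noteq> 0" "poly ?p t \<noteq> 0"
    using exists_poly_nonroot[of ?p "{0}"] assms by auto
  have "poly (poly f [:0, 1:]) t = eval2 id f t t"
    by (induction f) (simp_all add: eval2_pCons)
  then have "eval2 id f t t \<noteq> 0" using t by simp
  moreover have "eigen (character3 1 1 t) (mon (0, 0, 1)) t"
    using t by (intro eigen_character3) auto
  from eigen_ev[OF this this] have "eigen (character3 1 1 t) (ev f (mon (0, 0, 1)) (mon (0, 0, 1))) (eval2 id f t t)" .
  ultimately show ?thesis
    by (rule eigen_character3_nonzero[rotated])
qed


section \<open>Cancellation of nonzero Laurent polynomials\<close>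

context complex_vector_space
begin

text \<open>
  A series whose support has a least element for a translation invariant total order
  is not killed by a nonzero Laurent polynomial: the product of the two leading terms survives.
\<close>

lemma act_cancel_order:
  fixes A :: "'e::ab_group_add \<Rightarrow> 'w" and lt :: "'e \<Rightarrow> 'e \<Rightarrow> bool"
  assumes irrefl: "\<And>a. \<not> lt a a" and trans: "\<And>a b c. lt a b \<Longrightarrow> lt b c \<Longrightarrow> lt a c"
    and total: "\<And>a b. a \<noteq> b \<Longrightarrow> lt a b \<or> lt b a" and transl: "\<And>a b c. lt a b \<Longrightarrow> lt (a + c) (b + c)"
    and p: "p \<noteq> 0" "p \<bullet> A = 0"
    and e: "A e \<noteq> 0" "\<And>e'. A e' \<noteq> 0 \<Longrightarrow> e' = e \<or> lt e e'"
  shows False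
proof -
  have "\<exists>d\<in>I. \<forall>d'\<in>I. d' = d \<or> lt d d'" if "finite I" "I \<noteq> {}" for I
    using that
  proof (induction I rule: finite_ne_induct)
    case (insert x F)
    then obtain d where d: "d \<in> F" "\<forall>d'\<in>F. d' = d \<or> lt d d'" by blast
    show ?case
    proof (cases "lt x d")
      case True
      then have "d' = x \<or> lt x d'" if "d' \<in> insert x F" for d'
        using that d(2) trans[OF True, of d'] by auto
      then show ?thesis by blast
    next
      case False
      then have "x = d \<or> lt d x" using total[of x d] by blast
      then show ?thesis using d by auto
    qed
  qed auto
  then obtain d where d: "d \<in> Poly_Mapping.keys p" "\<And>d'. d' \<in> Poly_Mapping.keys p \<Longrightarrow> d' = d \<or> lt d d'"
    using p by (metis finite_keys keys_eq_empty)
  have z: "A (d + e - d') = 0" if d': "d' \<in> Poly_Mapping.keys p - {d}" for d'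
  proof (rule ccontr)
    assume "A (d + e - d') \<noteq> 0"
    then have "d + e - d' = e \<or> lt e (d + e - d')" by (rule e)
    moreover have "lt (d + (e - d')) (d' + (e - d'))" using d d' by (intro transl) auto
    ultimately show False using d' irrefl trans by (auto simp: algebra_simps)
  qed
  have "(p \<bullet> A) (d + e) = scale (Poly_Mapping.lookup p d) (A e)"
    using d(1) z by (simp add: act_eq sum.remove[of _ d])
  then show False using p e d by (simp add: in_keys_iff)
qed

end

text \<open>
  \<open>W((x))((x\<^sub>0))\<close> in the exponents \<open>(x\<^sub>0, x)\<close>, and \<open>W((x))((x\<^sub>2))((x\<^sub>0))\<close> in the exponents
  \<open>(x\<^sub>0, x\<^sub>2, x)\<close>.
\<close>

definition iter_laurent2 :: "(exp2 \<Rightarrow> 'w::zero) set"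
  where "iter_laurent2 = {A. (\<exists>N. \<forall>p<N. \<forall>q. A (p, q) = 0) \<and> (\<forall>p. \<exists>N. \<forall>q<N. A (p, q) = 0)}"

definition iter_laurent3 :: "(exp3 \<Rightarrow> 'w::zero) set"
  where "iter_laurent3 = {A. (\<exists>N. \<forall>p<N. \<forall>q r. A (p, q, r) = 0) \<and>
    (\<forall>p. \<exists>N. \<forall>q<N. \<forall>r. A (p, q, r) = 0) \<and> (\<forall>p q. \<exists>N. \<forall>r<N. A (p, q, r) = 0)}"

lemma iter_laurent2D:
  assumes "A \<in> iter_laurent2"
  shows "\<exists>N. \<forall>p<N. \<forall>q. A (p, q) = 0" "\<exists>N. \<forall>q<N. A (p, q) = 0"
  using assms unfolding iter_laurent2_def by blast+

lemma iter_laurent3D: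
  assumes "A \<in> iter_laurent3"
  shows "\<exists>N. \<forall>p<N. \<forall>q r. A (p, q, r) = 0"
    "\<exists>N. \<forall>q<N. \<forall>r. A (p, q, r) = 0" "\<exists>N. \<forall>r<N. A (p, q, r) = 0"
  using assms unfolding iter_laurent3_def by auto

lemma int_least:
  assumes "P (n::int)" "\<And>m. m < N \<Longrightarrow> \<not> P m"
  obtains k where "P k" "\<And>m. P m \<Longrightarrow> k \<le> m"
proof -
  let ?Q = "\<lambda>j. P (N + int j)"
  have "n \<ge> N" using assms by (meson not_le)
  then have Q: "?Q (nat (n - N))" using assms by simp
  have "P (N + int (LEAST j. ?Q j))" using Q by (rule LeastI)
  moreover have "N + int (LEAST j. ?Q j) \<le> m" if "P m" for m
  proof -
    have "m \<ge> N" using assms(2) that by (meson not_le)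
    then have "?Q (nat (m - N))" using that by simp
    then have "(LEAST j. ?Q j) \<le> nat (m - N)" by (rule Least_le)
    then show ?thesis using \<open>m \<ge> N\<close> by linarith
  qed
  ultimately show thesis by (rule that)
qed

text \<open>The lexicographic orders on exponents, the first exponent being the most significant.\<close>

definition lex2 :: "exp2 \<Rightarrow> exp2 \<Rightarrow> bool"
  where "lex2 = (\<lambda>(a, b) (a', b'). a < a' \<or> a = a' \<and> b < b')"

definition lex3 :: "exp3 \<Rightarrow> exp3 \<Rightarrow> bool"
  where "lex3 = (\<lambda>(a, b, c) (a', b', c'). a < a' \<or> a = a' \<and> (b < b' \<or> b = b' \<and> c < c'))"

lemma lex3_order:
  shows "\<not> lex3 a a" "lex3 a b \<Longrightarrow> lex3 b c \<Longrightarrow> lex3 a c" "a \<noteq> b \<Longrightarrow> lex3 a b \<or> lex3 b a"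
    "lex3 a b \<Longrightarrow> lex3 (a + c) (b + c)"
proof -
  obtain a1 a2 a3 b1 b2 b3 c1 c2 c3 where [simp]: "a = (a1, a2, a3)" "b = (b1, b2, b3)" "c = (c1, c2, c3)"
    by (metis surj_pair)
  show "\<not> lex3 a a" "lex3 a b \<Longrightarrow> lex3 (a + c) (b + c)" by (simp_all add: lex3_def)
  show "lex3 a b \<Longrightarrow> lex3 b c \<Longrightarrow> lex3 a c" unfolding lex3_def by (simp, linarith)
  show "a \<noteq> b \<Longrightarrow> lex3 a b \<or> lex3 b a" unfolding lex3_def by (simp, linarith)
qed

context complex_vector_space
begin

lemma cancel_iter_laurent2:
  assumes "p \<noteq> 0" "A \<in> iter_laurent2" "p \<bullet> A = 0"
  shows "A = 0"
proof (rule ccontr)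
  assume "A \<noteq> 0"
  then obtain m n where mn: "A (m, n) \<noteq> 0" by (auto simp: fun_eq_iff)
  obtain N where N: "\<And>p q. p < N \<Longrightarrow> A (p, q) = 0"
    using iter_laurent2D(1)[OF assms(2)] by blast
  obtain k where k: "\<exists>q. A (k, q) \<noteq> 0" "\<And>m. \<exists>q. A (m, q) \<noteq> 0 \<Longrightarrow> k \<le> m"
    by (rule int_least[of "\<lambda>k. \<exists>q. A (k, q) \<noteq> 0" m N]) (use mn N in blast)+
  obtain N' where N': "\<And>q. q < N' \<Longrightarrow> A (k, q) = 0"
    using iter_laurent2D(2)[OF assms(2)] by blast
  obtain q where "A (k, q) \<noteq> 0" using k by blast
  then obtain l where l: "A (k, l) \<noteq> 0" "\<And>m. A (k, m) \<noteq> 0 \<Longrightarrow> l \<le> m"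
    by (rule int_least[of "\<lambda>q. A (k, q) \<noteq> 0" q N']) (use N' in blast)+
  show False
  proof (rule act_cancel_order[of lex2 p A "(k, l)"])
    fix e assume "A e \<noteq> 0"
    then show "e = (k, l) \<or> lex2 (k, l) e"
      using k(2)[of "fst e"] l(2)[of "snd e"] by (cases e) (fastforce simp: lex2_def)
  qed (auto simp: lex2_def l(1) assms(1,3))
qed

lemma cancel_iter_laurent3:
  assumes "p \<noteq> 0" "A \<in> iter_laurent3" "p \<bullet> A = 0"
  shows "A = 0"
proof (rule ccontr)
  assume "A \<noteq> 0"
  then obtain m n r where mn: "A (m, n, r) \<noteq> 0" by (auto simp: fun_eq_iff)
  obtain N where N: "\<And>p q r. p < N \<Longrightarrow> A (p, q, r) = 0"
    using iter_laurent3D(1)[OF assms(2)] by blast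
  obtain k where k: "\<exists>q r. A (k, q, r) \<noteq> 0" "\<And>m. \<exists>q r. A (m, q, r) \<noteq> 0 \<Longrightarrow> k \<le> m"
    by (rule int_least[of "\<lambda>k. \<exists>q r. A (k, q, r) \<noteq> 0" m N]) (use mn N in blast)+
  obtain N' where N': "\<And>q r. q < N' \<Longrightarrow> A (k, q, r) = 0"
    using iter_laurent3D(2)[OF assms(2)] by blast
  obtain q where q: "\<exists>r. A (k, q, r) \<noteq> 0" using k by blast
  obtain l where l: "\<exists>r. A (k, l, r) \<noteq> 0" "\<And>m. \<exists>r. A (k, m, r) \<noteq> 0 \<Longrightarrow> l \<le> m"
    by (rule int_least[of "\<lambda>q. \<exists>r. A (k, q, r) \<noteq> 0" q N']) (use q N' in blast)+
  obtain N'' where N'': "\<And>r. r < N'' \<Longrightarrow> A (k, l, r) = 0"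
    using iter_laurent3D(3)[OF assms(2)] by blast
  obtain r where r: "A (k, l, r) \<noteq> 0" using l by blast
  obtain j where j: "A (k, l, j) \<noteq> 0" "\<And>m. A (k, l, m) \<noteq> 0 \<Longrightarrow> j \<le> m"
    by (rule int_least[of "\<lambda>q. A (k, l, q) \<noteq> 0" r N'']) (use r N'' in blast)+
  show False
  proof (rule act_cancel_order[of lex3 p A "(k, l, j)"])
    fix e assume e: "A e \<noteq> 0"
    obtain a b c where abc: "e = (a, b, c)" by (cases e)
    have "k \<le> a" using k(2)[of a] e abc by blast
    moreover have "l \<le> b" if "a = k" using l(2)[of b] e abc that by blast
    moreover have "j \<le> c" if "a = k" "b = l" using j(2)[of c] e abc that by blast
    ultimately show "e = (k, l, j) \<or> lex3 (k, l, j) e"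
      unfolding abc lex3_def by force
  qed (fact lex3_order j(1) assms(1,3))+
qed

end

lemma laurent_poly3_mult_nonzero:
  assumes "p \<noteq> 0" "q \<noteq> (0 :: exp3 \<Rightarrow>\<^sub>0 complex)"
  shows "p * q \<noteq> 0"
proof
  assume "p * q = 0"
  have fin: "finite {e. Poly_Mapping.lookup q e \<noteq> 0}" by simp
  have bd: "\<exists>N. \<forall>e. g e < N \<longrightarrow> Poly_Mapping.lookup q e = 0" for g :: "exp3 \<Rightarrow> int"
  proof -
    have "\<exists>N. \<forall>e\<in>{e. Poly_Mapping.lookup q e \<noteq> 0}. N \<le> g e"
      using fin by (intro exI[of _ "Min (g ` {e. Poly_Mapping.lookup q e \<noteq> 0})"] ballI Min_le) auto
    then show ?thesis by (metis (mono_tags, lifting) mem_Collect_eq not_le)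
  qed
  have "Poly_Mapping.lookup q \<in> iter_laurent3"
    using bd[of fst] bd[of "\<lambda>e. fst (snd e)"] bd[of "\<lambda>e. snd (snd e)"]
    unfolding iter_laurent3_def mem_Collect_eq by (metis fst_conv snd_conv)
  moreover have "act (*) p (Poly_Mapping.lookup q) = 0"
    using \<open>p * q = 0\<close> by (simp add: act_lookup fun_eq_iff)
  ultimately have "Poly_Mapping.lookup q = 0"
    using assms(1) complex_field.cancel_iter_laurent3 by blast
  then have "q = 0" by (intro poly_mapping_eqI) simp
  then show False using assms(2) by simp
qed

section \<open>The substitution \<open>x\<^sub>1 = \<alpha>x + x\<^sub>0\<close>\<close>

text \<open>
  The general form of the substitution, for series with exponents in any group: \<open>\<pi> e\<close> is
  the exponent of the variable \<open>x\<^sub>1\<close> that is replaced, \<open>u\<close> and \<open>v\<close> are the exponents of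
  \<open>x\<^sub>1\<close> and \<open>x\<close>, and \<open>h j = j(u - v)\<close>.  The slot of \<open>x\<^sub>1\<close> is reused for \<open>x\<^sub>0\<close>.
\<close>

definition expand_shift ::
    "(complex \<Rightarrow> 'w \<Rightarrow> 'w) \<Rightarrow> complex \<Rightarrow> ('e \<Rightarrow> int) \<Rightarrow> (int \<Rightarrow> 'e) \<Rightarrow> ('e::ab_group_add \<Rightarrow> 'w::ab_group_add) \<Rightarrow> 'e \<Rightarrow> 'w"
  where "expand_shift scale \<alpha> \<pi> h A e =
    Sum_any (\<lambda>j. scale (\<alpha> powi j * zchoose (\<pi> e + j) (\<pi> e)) (A (e + h j)))"

text \<open>The series for which the sums defining the substitution are finite.\<close>

definition finite_along :: "(int \<Rightarrow> 'e) \<Rightarrow> ('e::ab_group_add \<Rightarrow> 'w::zero) set"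
  where "finite_along h = {A. \<forall>e. finite {j. A (e + h j) \<noteq> 0}}"

lemma finite_alongD: "A \<in> finite_along h \<Longrightarrow> finite {j. A (e + h j) \<noteq> 0}"
  by (simp add: finite_along_def)

lemma finite_along_shift:
  "A \<in> finite_along h \<Longrightarrow> (\<lambda>e. A (e - d)) \<in> finite_along h" for h :: "int \<Rightarrow> 'e::ab_group_add"
  unfolding finite_along_def
proof (intro CollectI allI)
  fix e assume "A \<in> {A. \<forall>e. finite {j. A (e + h j) \<noteq> 0}}"
  then have "finite {j. A (e - d + h j) \<noteq> 0}" by blast
  then show "finite {j. A (e + h j - d) \<noteq> 0}" by (simp add: algebra_simps)
qed

text \<open>
  The exponent of \<open>x\<^sub>1\<close> is an additive function equal to \<open>1\<close> at \<open>u\<close> and \<open>0\<close> at \<open>v\<close>, and the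
  substitution moves exponents by multiples of \<open>u - v\<close>.
\<close>

locale shift_direction =
  fixes \<pi> :: "'e::ab_group_add \<Rightarrow> int" and h :: "int \<Rightarrow> 'e" and u v :: 'e
  assumes h_add: "h (i + j) = h i + h j" and \<pi>_add: "\<pi> (a + b) = \<pi> a + \<pi> b"
    and h_1: "h 1 = u - v" and \<pi>_u: "\<pi> u = 1" and \<pi>_v: "\<pi> v = 0"
begin

lemma \<pi>_diff: "\<pi> (a - b) = \<pi> a - \<pi> b"
  by (metis \<pi>_add add_diff_cancel diff_add_cancel)

end

context complex_vector_space
begin

lemma finite_support_scale: "finite {j. A j \<noteq> 0} \<Longrightarrow> finite {j. scale (c j) (A j) \<noteq> 0}"
  by (erule rev_finite_subset) auto

lemma Sum_any_scale: "finite {j. A j \<noteq> 0} \<Longrightarrow> scale c (Sum_any A) = Sum_any (\<lambda>j. scale c (A j))"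
  by (rule Sum_any_additive) (simp_all add: scale_right_distrib)

lemma linear_expand_shift:
  "linear_series_map scale scale (finite_along h) (expand_shift scale \<alpha> \<pi> h)"
proof
  fix A B :: "'a \<Rightarrow> 'w" and c :: complex
  assume A: "A \<in> finite_along h"
  show "(\<lambda>e. scale c (A e)) \<in> finite_along h"
    using A by (auto simp: finite_along_def intro: finite_support_scale)
  show "expand_shift scale \<alpha> \<pi> h (\<lambda>e. scale c (A e)) = (\<lambda>e. scale c (expand_shift scale \<alpha> \<pi> h A e))"
    unfolding expand_shift_def
    by (rule ext) (simp add: Sum_any_scale finite_support_scale finite_alongD[OF A] mult.commute)
  assume B: "B \<in> finite_along h"
  show "(\<lambda>e. A e + B e) \<in> finite_along h"
    unfolding finite_along_def
  proof (intro CollectI allI)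
    fix e
    show "finite {j. A (e + h j) + B (e + h j) \<noteq> 0}"
      by (rule finite_subset[OF _ finite_UnI[OF finite_alongD[OF A, of e] finite_alongD[OF B, of e]]]) auto
  qed
  show "expand_shift scale \<alpha> \<pi> h (\<lambda>e. A e + B e) =
      (\<lambda>e. expand_shift scale \<alpha> \<pi> h A e + expand_shift scale \<alpha> \<pi> h B e)"
    unfolding expand_shift_def
    by (rule ext) (simp add: scale_right_distrib Sum_any.distrib finite_support_scale
        finite_alongD[OF A] finite_alongD[OF B])
qed

lemma expand_shift_variable:
  assumes "shift_direction \<pi> h u v" "\<alpha> \<noteq> 0" and A: "A \<in> finite_along h"
  shows "expand_shift scale \<alpha> \<pi> h (\<lambda>e. A (e - u)) =
    (\<lambda>e. expand_shift scale \<alpha> \<pi> h A (e - u) + scale \<alpha> (expand_shift scale \<alpha> \<pi> h A (e - v)))"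
proof
  fix e
  interpret shift_direction \<pi> h u v by fact
  let ?z = zchoose
  have fin: "finite {j. A (e - u + h j) \<noteq> 0}" using A by (rule finite_alongD)
  have "expand_shift scale \<alpha> \<pi> h A (e - v) =
      (\<Sum>j. scale (\<alpha> powi j * ?z (\<pi> e + j) (\<pi> e)) (A (e - v + h j)))"
    by (simp add: expand_shift_def \<pi>_diff \<pi>_v)
  also have "\<dots> = (\<Sum>i. scale (\<alpha> powi (i - 1) * ?z (\<pi> e + (i - 1)) (\<pi> e)) (A (e - v + h (i - 1))))"
    by (rule Sum_any_int_shift)
  also have "\<dots> = (\<Sum>i. scale (\<alpha> powi (i - 1) * ?z (\<pi> e + (i - 1)) (\<pi> e)) (A (e - u + h i)))"
  proof -
    have "e - v + h (i - 1) = e - u + h i" for i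
      using h_add[of "i - 1" 1] h_1 by (simp add: algebra_simps)
    then show ?thesis by (simp only:)
  qed
  finally have v: "scale \<alpha> (expand_shift scale \<alpha> \<pi> h A (e - v)) =
      (\<Sum>i. scale (\<alpha> * (\<alpha> powi (i - 1) * ?z (\<pi> e + (i - 1)) (\<pi> e))) (A (e - u + h i)))"
    by (simp add: Sum_any_scale finite_support_scale fin)
  have u: "expand_shift scale \<alpha> \<pi> h A (e - u) =
      (\<Sum>j. scale (\<alpha> powi j * ?z (\<pi> e - 1 + j) (\<pi> e - 1)) (A (e - u + h j)))"
    by (simp add: expand_shift_def \<pi>_diff \<pi>_u)
  have c: "\<alpha> powi j * ?z (\<pi> e + j) (\<pi> e) =
      \<alpha> powi j * ?z (\<pi> e - 1 + j) (\<pi> e - 1) + \<alpha> * (\<alpha> powi (j - 1) * ?z (\<pi> e + (j - 1)) (\<pi> e))" for j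
  proof -
    have p: "\<alpha> * \<alpha> powi (j - 1) = \<alpha> powi j"
      using power_int_add[of \<alpha> 1 "j - 1"] assms(2) by simp
    have "?z (\<pi> e + j) (\<pi> e) = ?z (\<pi> e - 1 + j) (\<pi> e) + ?z (\<pi> e - 1 + j) (\<pi> e - 1)"
      using zchoose_pascal[of "\<pi> e - 1 + j" "\<pi> e"] by (simp add: add.commute)
    moreover have "\<pi> e + (j - 1) = \<pi> e - 1 + j" by simp
    ultimately show ?thesis
      by (simp only: mult.assoc[symmetric] p distrib_left add.commute)
  qed
  have "expand_shift scale \<alpha> \<pi> h (\<lambda>e. A (e - u)) e =
      (\<Sum>j. scale (\<alpha> powi j * ?z (\<pi> e + j) (\<pi> e)) (A (e - u + h j)))"
    by (simp add: expand_shift_def algebra_simps)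
  also have "\<dots> = (\<Sum>j. scale (\<alpha> powi j * ?z (\<pi> e - 1 + j) (\<pi> e - 1)) (A (e - u + h j)) +
      scale (\<alpha> * (\<alpha> powi (j - 1) * ?z (\<pi> e + (j - 1)) (\<pi> e))) (A (e - u + h j)))"
  proof (rule Sum_any.cong)
    fix j
    show "scale (\<alpha> powi j * ?z (\<pi> e + j) (\<pi> e)) (A (e - u + h j)) =
        scale (\<alpha> powi j * ?z (\<pi> e - 1 + j) (\<pi> e - 1)) (A (e - u + h j)) +
        scale (\<alpha> * (\<alpha> powi (j - 1) * ?z (\<pi> e + (j - 1)) (\<pi> e))) (A (e - u + h j))"
      unfolding c[of j] by (rule scale_left_distrib)
  qed
  also have "\<dots> = expand_shift scale \<alpha> \<pi> h A (e - u) + scale \<alpha> (expand_shift scale \<alpha> \<pi> h A (e - v))"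
    unfolding u v by (rule Sum_any.distrib) (rule finite_support_scale[OF fin])+
  finally show "expand_shift scale \<alpha> \<pi> h (\<lambda>e. A (e - u)) e =
      expand_shift scale \<alpha> \<pi> h A (e - u) + scale \<alpha> (expand_shift scale \<alpha> \<pi> h A (e - v))" .
qed

text \<open>The substitution is semilinear: it carries \<open>x\<^sub>1\<close> to \<open>\<alpha>x + x\<^sub>0\<close> and fixes every monomial without \<open>x\<^sub>1\<close>.\<close>

lemma rel_expand_shift:
  assumes "shift_direction \<pi> h u v" "\<alpha> \<noteq> 0"
  shows "carries (finite_along h) (expand_shift scale \<alpha> \<pi> h)
      (mon u) (mon u + cnst \<alpha> * mon v)" (is ?th1)
    and "\<pi> c = 0 \<Longrightarrow> carries (finite_along h) (expand_shift scale \<alpha> \<pi> h)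
      (mon c) (mon c)" (is "_ \<Longrightarrow> ?th2")
proof -
  interpret shift_direction \<pi> h u v by fact
  interpret S: linear_series_map scale scale "finite_along h" "expand_shift scale \<alpha> \<pi> h"
    by (rule linear_expand_shift)
  have "act scale (mon u + cnst \<alpha> * mon v) A = (\<lambda>e. A (e - u) + scale \<alpha> (A (e - v)))" for A
    by (rule ext) (simp add: act_add_left mult_single)
  then show ?th1
    by (simp add: S.rel_def finite_along_shift expand_shift_variable[OF assms])
  assume c: "\<pi> c = 0"
  show ?th2
  proof (rule S.rel_mon)
    show "expand_shift scale \<alpha> \<pi> h (\<lambda>e. A (e - c)) = (\<lambda>e. expand_shift scale \<alpha> \<pi> h A (e - c))" for A
      using c by (simp add: expand_shift_def \<pi>_diff algebra_simps fun_eq_iff)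
  qed (rule finite_along_shift)
qed

end

text \<open>
  The directions \<open>j(u - v)\<close> for the substitutions used below, and the first two exponents in three
  variables.  The digits name the slot of the variable that is replaced and the slot of the
  variable to which the new one is added; in two variables they are the first and the second.
\<close>

abbreviation dir2 :: "int \<Rightarrow> exp2" where "dir2 \<equiv> \<lambda>j. (j, - j)"
abbreviation dir12 :: "int \<Rightarrow> exp3" where "dir12 \<equiv> \<lambda>j. (j, - j, 0)"
abbreviation dir13 :: "int \<Rightarrow> exp3" where "dir13 \<equiv> \<lambda>j. (j, 0, - j)"
abbreviation dir23 :: "int \<Rightarrow> exp3" where "dir23 \<equiv> \<lambda>j. (0, j, - j)"
abbreviation slot1 :: "exp3 \<Rightarrow> int" where "slot1 \<equiv> \<lambda>(p, q, r). p"
abbreviation slot2 :: "exp3 \<Rightarrow> int" where "slot2 \<equiv> \<lambda>(p, q, r). q"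

lemma shift_direction_dir:
  "shift_direction fst dir2 (1, 0) (0, 1)"
  "shift_direction slot1 dir12 (1, 0, 0) (0, 1, 0)"
  "shift_direction slot1 dir13 (1, 0, 0) (0, 0, 1)"
  "shift_direction slot2 dir23 (0, 1, 0) (0, 0, 1)"
  by (unfold_locales, auto)+

lemma laurent2_finite_along: "laurent2 \<subseteq> finite_along dir2"
proof
  fix A :: "exp2 \<Rightarrow> 'w::zero" assume "A \<in> laurent2"
  then obtain N where N: "\<And>m n. m < N \<or> n < N \<Longrightarrow> A (m, n) = 0" unfolding laurent2_def by blast
  have "finite {j. A ((p, q) + (j, - j)) \<noteq> 0}" for p q
    by (rule finite_support_int[of "N - p" _ "q - N"]) (auto intro!: N)
  then show "A \<in> finite_along dir2" by (simp add: finite_along_def split_paired_All)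
qed

lemma (in complex_vector_space) subst_shift_eq: "subst_shift scale \<alpha> A = expand_shift scale \<alpha> fst dir2 A"
proof
  fix e :: exp2
  obtain p q where e: "e = (p, q)" by (cases e)
  let ?g = "\<lambda>(m, n). scale (binomial_coeff \<alpha> 1 m (q - n) p) (A (m, n))"
  have "Sum_any ?g = Sum_any (\<lambda>j. ?g (p + j, q - j))"
  proof (rule Sum_any_reindex)
    show "inj (\<lambda>j. (p + j, q - j))" by (rule injI) simp
    fix x assume x: "x \<notin> range (\<lambda>j. (p + j, q - j))"
    obtain m n where mn: "x = (m, n)" by (cases x)
    have "q - n + p \<noteq> m"
    proof
      assume "q - n + p = m"
      then have "x = (p + (q - n), q - (q - n))" by (simp add: mn)
      then show False using x by blast
    qed
    then show "?g x = 0" by (simp add: mn binomial_coeff_def)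
  qed
  also have "\<dots> = (\<Sum>j. scale (\<alpha> powi j * zchoose (p + j) p) (A (p + j, q - j)))"
    by (rule Sum_any.cong) (auto simp: binomial_coeff_def zchoose_def)
  finally show "subst_shift scale \<alpha> A e = expand_shift scale \<alpha> fst dir2 A e"
    by (simp add: subst_shift_def expand_shift_def e)
qed


section \<open>Polynomials as series\<close>

lemma lookup_mon_mult: "Poly_Mapping.lookup (mon d * p) e = Poly_Mapping.lookup p (e - d)" for d e :: "'e::ab_group_add"
  using fun_cong[OF act_lookup[of "mon d" p], of e] by simp

lemma poly_series_eq:
  "poly_series f = Poly_Mapping.lookup (ev f (mon (1, 0)) (mon (0, 1)))"
proof -
  have inner: "Poly_Mapping.lookup (poly (map_poly cnst p) (mon (0, 1) :: exp2 \<Rightarrow>\<^sub>0 complex)) (m, n) =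
      (if m = 0 \<and> n \<ge> 0 then coeff p (nat n) else 0)" for p m n
  proof (induction p arbitrary: m n)
    case (pCons a p)
    have "n > 0 \<Longrightarrow> nat n = Suc (nat (n - 1))" by simp
    then show ?case
      using pCons(2)[of m "n - 1"]
      by (auto simp: map_poly_pCons lookup_add lookup_mon_mult lookup_single zero_prod_def when_def
          coeff_pCons split: nat.split)
  qed simp
  have "Poly_Mapping.lookup (ev f (mon (1, 0)) (mon (0, 1) :: exp2 \<Rightarrow>\<^sub>0 complex)) (m, n) = poly_series f (m, n)" for m n
  proof (induction f arbitrary: m n)
    case 0
    then show ?case by (simp add: poly_series_def)
  next
    case (pCons p f)
    have "m > 0 \<Longrightarrow> nat m = Suc (nat (m - 1))" by simp
    then show ?case
      using pCons(2)[of "m - 1" n]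
      by (auto simp: ev_pCons lookup_add lookup_mon_mult inner poly_series_def coeff_pCons split: nat.split)
  qed
  then show ?thesis by auto
qed

lemma series_in_12_poly_series:
  "series_in_12 (poly_series f) = Poly_Mapping.lookup (ev f (mon (0, 1, 0)) (mon (0, 0, 1)))"
proof -
  have inner: "Poly_Mapping.lookup (poly (map_poly cnst p) (mon (0, 0, 1) :: exp3 \<Rightarrow>\<^sub>0 complex)) (k, m, n) =
      (if k = 0 \<and> m = 0 \<and> n \<ge> 0 then coeff p (nat n) else 0)" for p k m n
  proof (induction p arbitrary: k m n)
    case (pCons a p)
    have "n > 0 \<Longrightarrow> nat n = Suc (nat (n - 1))" by simp
    then show ?case
      using pCons(2)[of k m "n - 1"]
      by (auto simp: map_poly_pCons lookup_add lookup_mon_mult lookup_single zero_prod_def when_def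
          coeff_pCons split: nat.split)
  qed simp
  have "Poly_Mapping.lookup (ev f (mon (0, 1, 0)) (mon (0, 0, 1) :: exp3 \<Rightarrow>\<^sub>0 complex)) (k, m, n) =
      series_in_12 (poly_series f) (k, m, n)" for k m n
  proof (induction f arbitrary: k m n)
    case 0
    then show ?case by (simp add: poly_series_def series_in_12_def)
  next
    case (pCons p f)
    have "m > 0 \<Longrightarrow> nat m = Suc (nat (m - 1))" by simp
    then show ?case
      using pCons(2)[of k "m - 1" n]
      by (auto simp: ev_pCons lookup_add lookup_mon_mult inner poly_series_def series_in_12_def
          coeff_pCons split: nat.split)
  qed
  then show ?thesis by auto
qed

text \<open>\<open>f(x\<^sub>1, x\<^sub>2)\<close> as a Laurent polynomial.\<close>

abbreviation poly12 :: "complex poly poly \<Rightarrow> exp2 \<Rightarrow>\<^sub>0 complex"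
  where "poly12 f \<equiv> ev f (mon (1, 0)) (mon (0, 1))"

lemma series_mult_poly_series: "series_mult scale (poly_series f) = act scale (poly12 f)"
  by (rule ext)+ (simp add: act_def poly_series_eq)


section \<open>The delta function identity\<close>

lemma minus_one_powi: "(-1 :: complex) powi n = (if even n then 1 else -1)"
  by (simp add: power_int_minus_left)

text \<open>
  The delta function identity, coefficient by coefficient: the two expansions of \<open>(x\<^sub>1 - x\<^sub>2)\<^sup>-\<^sup>p\<^sup>-\<^sup>1\<close>
  contribute for \<open>r \<ge> p\<close> and for \<open>r < 0\<close> respectively, which may overlap for negative \<open>p\<close> only, where the
  two contributions cancel.
\<close>

lemma delta_coefficients:
  "(-1) powi (r - p) * zchoose (- p - 1) (r - p) -
     (-1) powi (- p - 1) * ((-1) powi (- 1 - r) * zchoose (- p - 1) (- 1 - r)) = zchoose r p"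
proof -
  consider "0 \<le> p" "p \<le> r" | "0 \<le> r" "r < p" | "0 \<le> p" "r < 0" | "p < 0" by linarith
  then show ?thesis
  proof cases
    case 1
    have "zchoose (- p - 1) (r - p) = (-1) powi (r - p) * zchoose r (r - p)"
      using 1 zchoose_negate[of "r - p" "- p - 1"] by simp
    then show ?thesis using 1 zchoose_symmetric[of r p] by (simp add: minus_one_powi)
  next
    case 2
    then show ?thesis by (simp add: zchoose_eq_0)
  next
    case 3
    define s where "s = - 1 - r"
    have "zchoose (- p - 1) s = (-1) powi s * zchoose (s + p) s"
      using 3 zchoose_negate[of s "- p - 1"] by (simp add: s_def algebra_simps)
    moreover have "zchoose (s + p) s = zchoose (s + p) p"
      using 3 zchoose_symmetric[of "s + p" s] by (simp add: s_def)
    moreover have "zchoose r p = (-1) powi p * zchoose (s + p) p"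
      using 3 zchoose_negate[of p r] by (simp add: s_def algebra_simps)
    moreover have "zchoose (- p - 1) (r - p) = 0" using 3 by simp
    ultimately show ?thesis by (simp add: minus_one_powi flip: s_def)
  next
    case 4
    have "zchoose (- p - 1) (r - p) = zchoose (- p - 1) (- 1 - r)"
      using 4 zchoose_symmetric[of "- p - 1" "r - p"] by simp
    then show ?thesis using 4 by (simp add: minus_one_powi)
  qed
qed

context complex_vector_space
begin

lemma delta_12_series:
  "series_mult scale delta_12 (series_in_12 A) (p, m, n) =
    (\<Sum>j. scale ((-1) powi j * zchoose (- p - 1) j) (A (m + p + 1 + j, n - j)))"
proof -
  let ?g = "\<lambda>d. scale (delta_12 d) (series_in_12 A ((p, m, n) - d))"
  have "Sum_any ?g = Sum_any (\<lambda>j. ?g (p, - p - 1 - j, j))"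
  proof (rule Sum_any_reindex)
    show "inj (\<lambda>j. (p, - p - 1 - j, j))" by (rule injI) simp
    show "?g d = 0" if "d \<notin> range (\<lambda>j. (p, - p - 1 - j, j))" for d
    proof -
      obtain a b c where d: "d = (a, b, c)" by (cases d)
      have "\<not> (a = p \<and> b + c = - a - 1)"
        using that rangeI[of "\<lambda>j. (p, - p - 1 - j, j)" c] unfolding d by (auto simp: algebra_simps)
      then show ?thesis by (auto simp: d delta_12_def binomial_coeff_def series_in_12_def)
    qed
  qed
  also have "\<dots> = (\<Sum>j. scale ((-1) powi j * zchoose (- p - 1) j) (A (m + p + 1 + j, n - j)))"
  proof (rule Sum_any.cong)
    fix j
    have "(-1) ^ nat j = (-1 :: complex) powi j" if "0 \<le> j" using that by (simp add: power_int_def)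
    moreover have e: "(p, m, n) - (p, - p - 1 - j, j) = (0, m + p + 1 + j, n - j)" by simp
    ultimately show "?g (p, - p - 1 - j, j) =
       scale ((-1) powi j * zchoose (- p - 1) j) (A (m + p + 1 + j, n - j))"
      unfolding e
      by (cases "j < 0") (simp_all add: delta_12_def binomial_coeff_def series_in_12_def zchoose_def)
  qed
  finally show ?thesis by (simp add: series_mult_def)
qed

lemma delta_21_series:
  "series_mult scale delta_21 (series_in_12 A) (p, m, n) =
    (\<Sum>j. scale ((-1) powi (- p - 1) * ((-1) powi j * zchoose (- p - 1) j)) (A (m - j, n + p + 1 + j)))"
proof -
  let ?g = "\<lambda>d. scale (delta_21 d) (series_in_12 A ((p, m, n) - d))"
  have "Sum_any ?g = Sum_any (\<lambda>j. ?g (p, j, - p - 1 - j))"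
  proof (rule Sum_any_reindex)
    show "inj (\<lambda>j. (p, j, - p - 1 - j))" by (rule injI) simp
    show "?g d = 0" if "d \<notin> range (\<lambda>j. (p, j, - p - 1 - j))" for d
    proof -
      obtain a b c where d: "d = (a, b, c)" by (cases d)
      have "\<not> (a = p \<and> c + b = - a - 1)"
        using that rangeI[of "\<lambda>j. (p, j, - p - 1 - j)" b] unfolding d by (auto simp: algebra_simps)
      then show ?thesis by (auto simp: d delta_21_def binomial_coeff_def series_in_12_def)
    qed
  qed
  also have "\<dots> = (\<Sum>j. scale ((-1) powi (- p - 1) * ((-1) powi j * zchoose (- p - 1) j)) (A (m - j, n + p + 1 + j)))"
  proof (rule Sum_any.cong)
    fix j
    have "(-1) ^ nat j = (-1 :: complex) powi j" if "0 \<le> j" using that by (simp add: power_int_def)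
    moreover have e: "(p, m, n) - (p, j, - p - 1 - j) = (0, m - j, n + p + 1 + j)" by simp
    ultimately show "?g (p, j, - p - 1 - j) =
       scale ((-1) powi (- p - 1) * ((-1) powi j * zchoose (- p - 1) j)) (A (m - j, n + p + 1 + j))"
      unfolding e
      by (cases "j < 0") (simp_all add: delta_21_def binomial_coeff_def series_in_12_def zchoose_def)
  qed
  finally show ?thesis by (simp add: series_mult_def)
qed

lemma delta_10_series:
  "series_mult scale delta_10 (series_in_02 A) (p, m, n) =
    (\<Sum>j. scale ((-1) powi j * zchoose (m + j) j) (A (p - j, n + m + 1 + j)))"
proof -
  let ?g = "\<lambda>d. scale (delta_10 d) (series_in_02 A ((p, m, n) - d))"
  have "Sum_any ?g = Sum_any (\<lambda>j. ?g (j, m, - m - 1 - j))"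
  proof (rule Sum_any_reindex)
    show "inj (\<lambda>j. (j, m, - m - 1 - j))" by (rule injI) simp
    show "?g d = 0" if "d \<notin> range (\<lambda>j. (j, m, - m - 1 - j))" for d
    proof -
      obtain a b c where d: "d = (a, b, c)" by (cases d)
      have "\<not> (b = m \<and> b + a = - c - 1)"
        using that rangeI[of "\<lambda>j. (j, m, - m - 1 - j)" a] unfolding d by (auto simp: algebra_simps)
      then show ?thesis by (auto simp: d delta_10_def binomial_coeff_def series_in_02_def)
    qed
  qed
  also have "\<dots> = (\<Sum>j. scale ((-1) powi j * zchoose (m + j) j) (A (p - j, n + m + 1 + j)))"
  proof (rule Sum_any.cong)
    fix j
    have "(-1) ^ nat j = (-1 :: complex) powi j" if "0 \<le> j" using that by (simp add: power_int_def)
    moreover have e: "(p, m, n) - (j, m, - m - 1 - j) = (p - j, 0, n + m + 1 + j)" by simp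
    ultimately show "?g (j, m, - m - 1 - j) =
       scale ((-1) powi j * zchoose (m + j) j) (A (p - j, n + m + 1 + j))"
      unfolding e
      by (cases "j < 0") (simp_all add: delta_10_def binomial_coeff_def series_in_02_def zchoose_def add.commute[of "of_int j"])
  qed
  finally show ?thesis by (simp add: series_mult_def)
qed

text \<open>
  The three-term delta function identity, multiplied by \<open>F(x\<^sub>1, x\<^sub>2)\<close>; on the right-hand side
  \<open>x\<^sub>1\<close> has been replaced by \<open>x\<^sub>2 + x\<^sub>0\<close> in \<open>F\<close>.
\<close>

lemma delta_identity:
  assumes F: "F \<in> laurent2"
  shows "series_mult scale delta_12 (series_in_12 F) e - series_mult scale delta_21 (series_in_12 F) e =
    series_mult scale delta_10 (series_in_02 (expand_shift scale 1 fst dir2 F)) e"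
proof -
  obtain p m n where e: "e = (p, m, n)" by (cases e)
  obtain N where N: "\<And>m n. m < N \<or> n < N \<Longrightarrow> F (m, n) = 0" using F unfolding laurent2_def by blast
  \<comment> \<open>All exponents of \<open>F\<close> that contribute to the coefficient at \<open>e\<close> have total degree \<open>T\<close>; the
    three sums are written as sums over the exponent \<open>k\<close> of \<open>x\<^sub>1\<close>.\<close>
  let ?T = "n + m + p + 1"
  let ?F = "\<lambda>k. F (k, ?T - k)"
  have fin: "finite {k. ?F k \<noteq> 0}"
    by (rule finite_support_int[of N _ "?T - N"]) (auto intro!: N)
  have S: "(\<Sum>k. scale (c k) (?F k)) = (\<Sum>k\<in>{k. ?F k \<noteq> 0}. scale (c k) (?F k))" for c
    by (rule Sum_any.expand_superset[OF fin]) auto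
  have Sdiff: "(\<Sum>k. scale (c k) (?F k) - scale (d k) (?F k)) =
      (\<Sum>k. scale (c k) (?F k)) - (\<Sum>k. scale (d k) (?F k))" for c d
    unfolding S sum_subtractf[symmetric] by (rule Sum_any.expand_superset[OF fin]) auto
  have eqs1: "k - (m + p + 1) = k - m - 1 - p" "m + p + 1 + (k - m - 1 - p) = k" "n - (k - m - 1 - p) = ?T - k"
    and eqs2: "m - k = - 1 - (k - m - 1)" "- 1 - (- 1 - (k - m - 1) - m - 1) = k" "n + p + 1 + (- 1 - (k - m - 1)) = ?T - k"
    and eqs3: "p - j + (k - (p - j)) = k" "n + m + 1 + j + - (k - (p - j)) = ?T - k" for k j
    by simp_all
  have 1: "series_mult scale delta_12 (series_in_12 F) e =
      (\<Sum>k. scale ((-1) powi (k - m - 1 - p) * zchoose (- p - 1) (k - m - 1 - p)) (?F k))"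
    unfolding e delta_12_series
    by (subst Sum_any_int_shift[of _ "m + p + 1"]) (simp only: eqs1)
  have 2: "series_mult scale delta_21 (series_in_12 F) e =
      (\<Sum>k. scale ((-1) powi (- p - 1) * ((-1) powi (- 1 - (k - m - 1)) * zchoose (- p - 1) (- 1 - (k - m - 1)))) (?F k))"
    unfolding e delta_21_series
    by (subst Sum_any_int_reflect[of _ m]) (simp only: eqs2)
  have 3: "expand_shift scale 1 fst dir2 F (p - j, n + m + 1 + j) = (\<Sum>k. scale (zchoose k (p - j)) (?F k))" for j
    unfolding expand_shift_def
    by (subst Sum_any_int_shift[of _ "p - j"]) (simp only: fst_conv add_Pair power_int_1_left mult_1_left eqs3)
  have "series_mult scale delta_10 (series_in_02 (expand_shift scale 1 fst dir2 F)) e =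
      (\<Sum>j. scale (zchoose (- m - 1) j) (\<Sum>k. scale (zchoose k (p - j)) (?F k)))"
    unfolding e delta_10_series 3 zchoose_sign ..
  also have "\<dots> = (\<Sum>j\<in>{0..p}. scale (zchoose (- m - 1) j) (\<Sum>k. scale (zchoose k (p - j)) (?F k)))"
  proof (rule Sum_any.expand_superset)
    have "scale (zchoose (- m - 1) j) (\<Sum>k. scale (zchoose k (p - j)) (?F k)) = 0" if "j \<notin> {0..p}" for j
      using that by (cases "j < 0") simp_all
    then show "{j. scale (zchoose (- m - 1) j) (\<Sum>k. scale (zchoose k (p - j)) (?F k)) \<noteq> 0} \<subseteq> {0..p}"
      by blast
  qed simp
  also have "\<dots> = (\<Sum>j\<in>{0..p}. \<Sum>k\<in>{k. ?F k \<noteq> 0}. scale (zchoose (- m - 1) j * zchoose k (p - j)) (?F k))"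
    by (simp add: S scale_sum_right)
  also have "\<dots> = (\<Sum>k\<in>{k. ?F k \<noteq> 0}. scale (\<Sum>j=0..p. zchoose (- m - 1) j * zchoose k (p - j)) (?F k))"
    by (subst sum.swap) (simp add: scale_sum_left)
  also have "\<dots> = (\<Sum>k. scale (zchoose (k - m - 1) p) (?F k))"
  proof -
    have "- m - 1 + k = k - m - 1" for k by simp
    then show ?thesis unfolding zchoose_vandermonde by (simp only: S)
  qed
  also have "\<dots> = (\<Sum>k. scale ((-1) powi (k - m - 1 - p) * zchoose (- p - 1) (k - m - 1 - p)) (?F k)
      - scale ((-1) powi (- p - 1) * ((-1) powi (- 1 - (k - m - 1)) * zchoose (- p - 1) (- 1 - (k - m - 1)))) (?F k))"
    by (simp only: scale_left_diff_distrib[symmetric] delta_coefficients)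
  also have "\<dots> = series_mult scale delta_12 (series_in_12 F) e - series_mult scale delta_21 (series_in_12 F) e"
    unfolding 1 2 by (rule Sdiff)
  finally show ?thesis by simp
qed

lemma linear_series_mult:
  "linear_series_map scale scale {A. \<forall>e. finite {d. c d \<noteq> 0 \<and> A (e - d) \<noteq> 0}} (series_mult scale c)"
    (is "linear_series_map _ _ ?D _")
  and rel_series_mult:
  "carries {A. \<forall>e. finite {d. c d \<noteq> 0 \<and> A (e - d) \<noteq> 0}}
     (series_mult scale c) (mon x) (mon x)"
proof -
  have fin: "finite {d. scale (c d) (A (e - d)) \<noteq> 0}" if "A \<in> ?D" for A e
    using that by (auto elim!: rev_finite_subset[of "{d. c d \<noteq> 0 \<and> A (e - d) \<noteq> 0}"])
  have shift: "(\<lambda>e. A (e - x)) \<in> ?D" if "A \<in> ?D" for A x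
  proof (intro CollectI allI)
    fix e
    have "finite {d. c d \<noteq> 0 \<and> A (e - x - d) \<noteq> 0}" using that by blast
    then show "finite {d. c d \<noteq> 0 \<and> A (e - d - x) \<noteq> 0}" by (simp add: algebra_simps)
  qed
  interpret L: linear_series_map scale scale ?D "series_mult scale c"
  proof
    fix A B :: "'a \<Rightarrow> 'w" and k
    assume A: "A \<in> ?D"
    show "(\<lambda>e. scale k (A e)) \<in> ?D"
    proof (intro CollectI allI)
      fix e
      have "finite {d. c d \<noteq> 0 \<and> A (e - d) \<noteq> 0}" using A by blast
      then show "finite {d. c d \<noteq> 0 \<and> scale k (A (e - d)) \<noteq> 0}" by (rule rev_finite_subset) auto
    qed
    show "series_mult scale c (\<lambda>e. scale k (A e)) = (\<lambda>e. scale k (series_mult scale c A e))"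
      unfolding series_mult_def
      by (rule ext) (simp only: Sum_any_scale[OF fin[OF A]] scale_left_commute[of _ k])
    assume B: "B \<in> ?D"
    show "(\<lambda>e. A e + B e) \<in> ?D"
    proof (intro CollectI allI)
      fix e
      have "finite {d. c d \<noteq> 0 \<and> A (e - d) \<noteq> 0}" "finite {d. c d \<noteq> 0 \<and> B (e - d) \<noteq> 0}"
        using A B by blast+
      from finite_UnI[OF this] show "finite {d. c d \<noteq> 0 \<and> A (e - d) + B (e - d) \<noteq> 0}"
        by (rule rev_finite_subset) auto
    qed
    show "series_mult scale c (\<lambda>e. A e + B e) = (\<lambda>e. series_mult scale c A e + series_mult scale c B e)"
      unfolding series_mult_def
      by (rule ext) (simp only: scale_right_distrib Sum_any.distrib[OF fin[OF A] fin[OF B]])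
  qed
  show "linear_series_map scale scale ?D (series_mult scale c)" ..
  show "L.rel (mon x) (mon x)"
  proof (rule L.rel_mon)
    have "e - d - x = e - x - d" for e d :: 'a by (simp add: algebra_simps)
    then show "series_mult scale c (\<lambda>e. A (e - x)) = (\<lambda>e. series_mult scale c A (e - x))" for A
      unfolding series_mult_def by (simp only:)
  qed (rule shift)
qed

text \<open>The series with exponents \<open>e\<close> such that \<open>\<pi> e\<close> is bounded below.\<close>

definition bounded_along :: "('e \<Rightarrow> int) \<Rightarrow> ('e \<Rightarrow> 'w) set"
  where "bounded_along \<pi> = {A. \<exists>N. \<forall>e. \<pi> e < N \<longrightarrow> A e = 0}"

lemma bounded_along_closed:
  assumes \<pi>: "\<And>a b. \<pi> (a - b) = \<pi> a - \<pi> b" and A: "A \<in> bounded_along \<pi>"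
  shows "B \<in> bounded_along \<pi> \<Longrightarrow> (\<lambda>e. A e + B e) \<in> bounded_along \<pi>"
    "(\<lambda>e. scale c (A e)) \<in> bounded_along \<pi>" "(\<lambda>e. A (e - d)) \<in> bounded_along \<pi>"
proof -
  obtain N where N: "\<And>e. \<pi> e < N \<Longrightarrow> A e = 0" using A unfolding bounded_along_def by blast
  show "(\<lambda>e. scale c (A e)) \<in> bounded_along \<pi>"
    unfolding bounded_along_def by (auto intro!: exI[of _ N] simp: N)
  show "(\<lambda>e. A (e - d)) \<in> bounded_along \<pi>"
    unfolding bounded_along_def by (auto intro!: exI[of _ "N + \<pi> d"] N simp: \<pi>)
  assume "B \<in> bounded_along \<pi>"
  then obtain M where "\<And>e. \<pi> e < M \<Longrightarrow> B e = 0" unfolding bounded_along_def by blast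
  with N show "(\<lambda>e. A e + B e) \<in> bounded_along \<pi>"
    unfolding bounded_along_def by (auto intro!: exI[of _ "min N M"])
qed

lemma bounded_alongD:
  "A \<in> bounded_along fst \<Longrightarrow> \<exists>N. \<forall>m n. m < N \<longrightarrow> A (m, n) = 0"
  "A \<in> bounded_along snd \<Longrightarrow> \<exists>N. \<forall>m n. n < N \<longrightarrow> A (m, n) = 0"
  by (auto simp: bounded_along_def)

lemma slot_diff: "fst (a - b :: exp2) = fst a - fst b" "snd (a - b :: exp2) = snd a - snd b"
  "slot1 (x - y) = slot1 x - slot1 y" "slot2 (x - y) = slot2 x - slot2 y" "snd (snd (x - y)) = snd (snd x) - snd (snd y)"
  by (auto split: prod.split)

lemma finite_delta_12:
  assumes "A \<in> bounded_along snd"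
  shows "finite {j. scale ((-1) powi j * zchoose k j) (A (m + p + 1 + j, n - j)) \<noteq> 0}"
proof -
  obtain N where N: "\<And>m n. n < N \<Longrightarrow> A (m, n) = 0" using bounded_alongD(2)[OF assms] by blast
  show ?thesis by (rule finite_support_int[of 0 _ "n - N"]) (auto intro!: N)
qed

lemma finite_delta_21:
  assumes "A \<in> bounded_along fst"
  shows "finite {j. scale (c * ((-1) powi j * zchoose k j)) (A (m - j, n + p + 1 + j)) \<noteq> 0}"
proof -
  obtain N where N: "\<And>m n. m < N \<Longrightarrow> A (m, n) = 0" using bounded_alongD(1)[OF assms] by blast
  show ?thesis by (rule finite_support_int[of 0 _ "m - N"]) (auto intro!: N)
qed

lemma finite_delta_10:
  assumes "A \<in> bounded_along fst"
  shows "finite {j. scale (zchoose k j) (A (p - j, n + m + 1 + j)) \<noteq> 0}"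
proof -
  obtain N where N: "\<And>m n. m < N \<Longrightarrow> A (m, n) = 0" using bounded_alongD(1)[OF assms] by blast
  show ?thesis by (rule finite_support_int[of 0 _ "p - N"]) (auto intro!: N)
qed

text \<open>
  The products with \<open>x\<^sub>0\<^sup>-\<^sup>1 \<delta>((x\<^sub>1 - x\<^sub>2) / x\<^sub>0)\<close>, \<open>x\<^sub>0\<^sup>-\<^sup>1 \<delta>((x\<^sub>2 - x\<^sub>1) / -x\<^sub>0)\<close> and
  \<open>x\<^sub>2\<^sup>-\<^sup>1 \<delta>((x\<^sub>1 - x\<^sub>0) / x\<^sub>2)\<close>, as linear maps; they are defined on the series whose exponents of the
  variable expanded in nonnegative powers are bounded below.
\<close>

definition D12 :: "(exp2 \<Rightarrow> 'w) \<Rightarrow> exp3 \<Rightarrow> 'w"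
  where "D12 A = series_mult scale delta_12 (series_in_12 A)"

definition D21 :: "(exp2 \<Rightarrow> 'w) \<Rightarrow> exp3 \<Rightarrow> 'w"
  where "D21 A = series_mult scale delta_21 (series_in_12 A)"

definition D10 :: "(exp2 \<Rightarrow> 'w) \<Rightarrow> exp3 \<Rightarrow> 'w"
  where "D10 A = series_mult scale delta_10 (series_in_02 A)"

lemma D12_eq: "D12 A (p, m, n) = (\<Sum>j. scale ((-1) powi j * zchoose (- p - 1) j) (A (m + p + 1 + j, n - j)))"
  by (simp add: D12_def delta_12_series)

lemma D21_eq: "D21 A (p, m, n) =
    (\<Sum>j. scale ((-1) powi (- p - 1) * ((-1) powi j * zchoose (- p - 1) j)) (A (m - j, n + p + 1 + j)))"
  by (simp add: D21_def delta_21_series)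

lemma D10_eq: "D10 A (p, m, n) = (\<Sum>j. scale (zchoose (- m - 1) j) (A (p - j, n + m + 1 + j)))"
  by (simp add: D10_def delta_10_series zchoose_sign)

lemma linear_D12: "linear_series_map scale scale (bounded_along snd) D12"
proof
  fix A B :: "exp2 \<Rightarrow> 'w" and c assume A: "A \<in> bounded_along snd"
  then show "(\<lambda>e. scale c (A e)) \<in> bounded_along snd" by (rule bounded_along_closed[OF slot_diff(2)])
  show "D12 (\<lambda>e. scale c (A e)) = (\<lambda>e. scale c (D12 A e))"
    by (simp only: D12_eq fun_eq_iff split_paired_All Sum_any_scale finite_delta_12[OF A] scale_left_commute[of _ c])
      simp
  assume B: "B \<in> bounded_along snd"
  with A show "(\<lambda>e. A e + B e) \<in> bounded_along snd" by (rule bounded_along_closed[OF slot_diff(2)])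
  show "D12 (\<lambda>e. A e + B e) = (\<lambda>e. D12 A e + D12 B e)"
    by (simp only: D12_eq fun_eq_iff split_paired_All scale_right_distrib Sum_any.distrib
        finite_delta_12[OF A] finite_delta_12[OF B]) simp
qed

lemma linear_D21: "linear_series_map scale scale (bounded_along fst) D21"
proof
  fix A B :: "exp2 \<Rightarrow> 'w" and c assume A: "A \<in> bounded_along fst"
  then show "(\<lambda>e. scale c (A e)) \<in> bounded_along fst" by (rule bounded_along_closed[OF slot_diff(1)])
  show "D21 (\<lambda>e. scale c (A e)) = (\<lambda>e. scale c (D21 A e))"
    by (simp only: D21_eq fun_eq_iff split_paired_All Sum_any_scale finite_delta_21[OF A] scale_left_commute[of _ c])
      simp
  assume B: "B \<in> bounded_along fst"
  with A show "(\<lambda>e. A e + B e) \<in> bounded_along fst" by (rule bounded_along_closed[OF slot_diff(1)])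
  show "D21 (\<lambda>e. A e + B e) = (\<lambda>e. D21 A e + D21 B e)"
    by (simp only: D21_eq fun_eq_iff split_paired_All scale_right_distrib Sum_any.distrib
        finite_delta_21[OF A] finite_delta_21[OF B]) simp
qed

lemma linear_D10: "linear_series_map scale scale (bounded_along fst) D10"
proof
  fix A B :: "exp2 \<Rightarrow> 'w" and c assume A: "A \<in> bounded_along fst"
  then show "(\<lambda>e. scale c (A e)) \<in> bounded_along fst" by (rule bounded_along_closed[OF slot_diff(1)])
  show "D10 (\<lambda>e. scale c (A e)) = (\<lambda>e. scale c (D10 A e))"
    by (simp only: D10_eq fun_eq_iff split_paired_All Sum_any_scale finite_delta_10[OF A] scale_left_commute[of _ c])
      simp
  assume B: "B \<in> bounded_along fst"
  with A show "(\<lambda>e. A e + B e) \<in> bounded_along fst" by (rule bounded_along_closed[OF slot_diff(1)])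
  show "D10 (\<lambda>e. A e + B e) = (\<lambda>e. D10 A e + D10 B e)"
    by (simp only: D10_eq fun_eq_iff split_paired_All scale_right_distrib Sum_any.distrib
        finite_delta_10[OF A] finite_delta_10[OF B]) simp
qed

lemma Sum_any_scale_add:
  assumes "finite {j. A j \<noteq> 0}" "\<And>j. c j = a j + b j"
  shows "(\<Sum>j. scale (c j) (A j)) = (\<Sum>j. scale (a j) (A j)) + (\<Sum>j. scale (b j) (A j))"
  unfolding assms(2) scale_left_distrib
  by (rule Sum_any.distrib) (rule finite_support_scale[OF assms(1)])+

text \<open>
  The next three lemmas say that \<open>x\<^sub>0 = x\<^sub>1 - x\<^sub>2\<close> in the presence of each of the delta functions.
\<close>

lemma D12_variables:
  assumes A: "A \<in> bounded_along snd"
  shows "D12 A (p, m - 1, n) = D12 A (p - 1, m, n) + D12 A (p, m, n - 1)"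
proof -
  let ?A = "\<lambda>j. if j < 0 then 0 else A (m + p + j, n - j)"
  obtain N where N: "\<And>m n. n < N \<Longrightarrow> A (m, n) = 0" using bounded_alongD(2)[OF A] by blast
  have fin: "finite {j. ?A j \<noteq> 0}" by (rule finite_support_int[of 0 _ "n - N"]) (auto intro!: N)
  have 1: "D12 A (p, m - 1, n) = (\<Sum>j. scale ((-1) powi j * zchoose (- p - 1) j) (?A j))"
  proof -
    have e: "m - 1 + p + 1 + j = m + p + j" for j :: int
      by simp_all
    show ?thesis
      unfolding D12_eq e by (rule Sum_any.cong) simp
  qed
  have 2: "D12 A (p - 1, m, n) = (\<Sum>j. scale ((-1) powi j * zchoose (- p) j) (?A j))"
  proof -
    have e: "m + (p - 1) + 1 + j = m + p + j" "- (p - 1) - 1 = - p" for j :: int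
      by simp_all
    show ?thesis
      unfolding D12_eq e by (rule Sum_any.cong) simp
  qed
  have 3: "D12 A (p, m, n - 1) = (\<Sum>j. scale ((-1) powi (j - 1) * zchoose (- p - 1) (j - 1)) (?A j))"
  proof -
    have e: "m + p + 1 + (j - 1) = m + p + j" "n - 1 - (j - 1) = n - j" for j :: int
      by simp_all
    show ?thesis
      unfolding D12_eq by (subst Sum_any_int_shift[of _ 1], rule Sum_any.cong) (simp only: e, simp)
  qed
  show ?thesis unfolding 1 2 3
  proof (rule Sum_any_scale_add[OF fin])
    fix j
    show "(-1) powi j * zchoose (- p - 1) j =
        (-1) powi j * zchoose (- p) j + (-1) powi (j - 1) * zchoose (- p - 1) (j - 1)"
      using zchoose_pascal[of "- p - 1" j] by (simp add: minus_one_powi)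
  qed
qed

lemma D21_variables:
  assumes A: "A \<in> bounded_along fst"
  shows "D21 A (p, m - 1, n) = D21 A (p - 1, m, n) + D21 A (p, m, n - 1)"
proof -
  let ?A = "\<lambda>j. if j < 0 then 0 else A (m - j, n + p + j)"
  obtain N where N: "\<And>m n. m < N \<Longrightarrow> A (m, n) = 0" using bounded_alongD(1)[OF A] by blast
  have fin: "finite {j. ?A j \<noteq> 0}" by (rule finite_support_int[of 0 _ "m - N"]) (auto intro!: N)
  have 1: "D21 A (p, m - 1, n) =
      (\<Sum>j. scale ((-1) powi (- p - 1) * ((-1) powi (j - 1) * zchoose (- p - 1) (j - 1))) (?A j))"
  proof -
    have e: "m - 1 - (j - 1) = m - j" "n + p + 1 + (j - 1) = n + p + j" for j :: int
      by simp_all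
    show ?thesis
      unfolding D21_eq by (subst Sum_any_int_shift[of _ 1], rule Sum_any.cong) (simp only: e, simp)
  qed
  have 2: "D21 A (p - 1, m, n) = (\<Sum>j. scale ((-1) powi (- p) * ((-1) powi j * zchoose (- p) j)) (?A j))"
  proof -
    have e: "n + (p - 1) + 1 + j = n + p + j" "- (p - 1) - 1 = - p" for j :: int
      by simp_all
    show ?thesis
      unfolding D21_eq e by (rule Sum_any.cong) simp
  qed
  have 3: "D21 A (p, m, n - 1) =
      (\<Sum>j. scale ((-1) powi (- p - 1) * ((-1) powi j * zchoose (- p - 1) j)) (?A j))"
  proof -
    have e: "n - 1 + p + 1 + j = n + p + j" for j :: int
      by simp_all
    show ?thesis
      unfolding D21_eq e by (rule Sum_any.cong) simp
  qed
  show ?thesis unfolding 1 2 3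
  proof (rule Sum_any_scale_add[OF fin])
    fix j
    show "(-1) powi (- p - 1) * ((-1) powi (j - 1) * zchoose (- p - 1) (j - 1)) =
        (-1) powi (- p) * ((-1) powi j * zchoose (- p) j) +
        (-1) powi (- p - 1) * ((-1) powi j * zchoose (- p - 1) j)"
      using zchoose_pascal[of "- p - 1" j] by (simp add: minus_one_powi)
  qed
qed

lemma D10_variables:
  assumes A: "A \<in> bounded_along fst"
  shows "D10 A (p, m - 1, n) = D10 A (p - 1, m, n) + D10 A (p, m, n - 1)"
proof -
  let ?A = "\<lambda>j. if j < 0 then 0 else A (p - j, n + m + j)"
  obtain N where N: "\<And>m n. m < N \<Longrightarrow> A (m, n) = 0" using bounded_alongD(1)[OF A] by blast
  have fin: "finite {j. ?A j \<noteq> 0}" by (rule finite_support_int[of 0 _ "p - N"]) (auto intro!: N)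
  have 1: "D10 A (p, m - 1, n) = (\<Sum>j. scale (zchoose (- m) j) (?A j))"
  proof -
    have e: "n + (m - 1) + 1 + j = n + m + j" "- (m - 1) - 1 = - m" for j :: int
      by simp_all
    show ?thesis
      unfolding D10_eq e by (rule Sum_any.cong) simp
  qed
  have 2: "D10 A (p - 1, m, n) = (\<Sum>j. scale (zchoose (- m - 1) (j - 1)) (?A j))"
  proof -
    have e: "p - 1 - (j - 1) = p - j" "n + m + 1 + (j - 1) = n + m + j" for j :: int
      by simp_all
    show ?thesis
      unfolding D10_eq by (subst Sum_any_int_shift[of _ 1], rule Sum_any.cong) (simp only: e, simp)
  qed
  have 3: "D10 A (p, m, n - 1) = (\<Sum>j. scale (zchoose (- m - 1) j) (?A j))"
  proof -
    have e: "n - 1 + m + 1 + j = n + m + j" for j :: int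
      by simp_all
    show ?thesis
      unfolding D10_eq e by (rule Sum_any.cong) simp
  qed
  show ?thesis unfolding 1 2 3
  proof (rule Sum_any_scale_add[OF fin])
    fix j
    show "zchoose (- m) j = zchoose (- m - 1) (j - 1) + zchoose (- m - 1) j"
      using zchoose_pascal[of "- m - 1" j] by simp
  qed
qed

lemma mon_diff_eq: "mon d - mon d' = mon d + cnst (-1) * mon d'" for d d' :: "'e::ab_group_add"
  by (simp add: mult_single flip: single_uminus)

lemma act_two_mon: "(mon d + cnst c * mon d') \<bullet> A = (\<lambda>e. A (e - d) + scale c (A (e - d')))"
  by (rule ext) (simp add: act_add_left mult_single)

lemma rel_D12: "carries (bounded_along snd) D12
    (mon (1, 0) - mon (0, 1)) (mon (1, 0, 0))"
proof -
  interpret L: linear_series_map scale scale "bounded_along snd" D12 by (rule linear_D12)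
  have e: "m + p + 1 + j - 1 = m - 1 + p + 1 + j" "n - j - 1 = n - 1 - j" for m n p j :: int
    by simp_all
  have "L.rel (mon (1, 0)) (mon (0, 1, 0))" "L.rel (mon (0, 1)) (mon (0, 0, 1))"
    by (rule L.rel_mon, erule bounded_along_closed(3)[OF slot_diff(2)],
        simp only: fun_eq_iff split_paired_All D12_eq diff_Pair diff_zero e simp_thms)+
  then have "L.rel (mon (1, 0) + cnst (-1) * mon (0, 1)) (mon (0, 1, 0) + cnst (-1) * mon (0, 0, 1))"
    by (intro L.rel_add L.rel_mult L.rel_cnst)
  moreover have "(mon (0, 1, 0) + cnst (-1) * mon (0, 0, 1)) \<bullet> D12 A = mon (1, 0, 0) \<bullet> D12 A"
    if "A \<in> bounded_along snd" for A
    unfolding act_two_mon act_mon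
    by (auto simp: fun_eq_iff D12_variables[OF that])
  ultimately show ?thesis unfolding mon_diff_eq by (rule L.rel_cong)
qed

lemma rel_D21: "carries (bounded_along fst) D21
    (mon (1, 0) - mon (0, 1)) (mon (1, 0, 0))"
proof -
  interpret L: linear_series_map scale scale "bounded_along fst" D21 by (rule linear_D21)
  have e: "m - j - 1 = m - 1 - j" "n + p + 1 + j - 1 = n - 1 + p + 1 + j" for m n p j :: int
    by simp_all
  have "L.rel (mon (1, 0)) (mon (0, 1, 0))" "L.rel (mon (0, 1)) (mon (0, 0, 1))"
    by (rule L.rel_mon, erule bounded_along_closed(3)[OF slot_diff(1)],
        simp only: fun_eq_iff split_paired_All D21_eq diff_Pair diff_zero e simp_thms)+
  then have "L.rel (mon (1, 0) + cnst (-1) * mon (0, 1)) (mon (0, 1, 0) + cnst (-1) * mon (0, 0, 1))"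
    by (intro L.rel_add L.rel_mult L.rel_cnst)
  moreover have "(mon (0, 1, 0) + cnst (-1) * mon (0, 0, 1)) \<bullet> D21 A = mon (1, 0, 0) \<bullet> D21 A"
    if "A \<in> bounded_along fst" for A
    unfolding act_two_mon act_mon
    by (auto simp: fun_eq_iff D21_variables[OF that])
  ultimately show ?thesis unfolding mon_diff_eq by (rule L.rel_cong)
qed

lemma rel_D10:
  "carries (bounded_along fst) D10 (mon (1, 0)) (mon (1, 0, 0))" (is ?th1)
  "carries (bounded_along fst) D10 (mon (0, 1)) (mon (0, 0, 1))" (is ?th2)
  "carries (bounded_along fst) D10 (mon (1, 0) + mon (0, 1)) (mon (0, 1, 0))" (is ?th3)
proof -
  interpret L: linear_series_map scale scale "bounded_along fst" D10 by (rule linear_D10)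
  have e: "p - j - 1 = p - 1 - j" "n + m + 1 + j - 1 = n - 1 + m + 1 + j" for m n p j :: int
    by simp_all
  show ?th1 ?th2
    by (rule L.rel_mon, erule bounded_along_closed(3)[OF slot_diff(1)],
        simp only: fun_eq_iff split_paired_All D10_eq diff_Pair diff_zero e simp_thms)+
  then have "L.rel (mon (1, 0) + mon (0, 1)) (mon (1, 0, 0) + mon (0, 0, 1))"
    by (rule L.rel_add)
  moreover have "(mon (1, 0, 0) + mon (0, 0, 1)) \<bullet> D10 A = mon (0, 1, 0) \<bullet> D10 A"
    if "A \<in> bounded_along fst" for A
    unfolding act_add_left act_mon
    by (auto simp: fun_eq_iff D10_variables[OF that])
  ultimately show ?th3 by (rule L.rel_cong)
qed

text \<open>
  The Jacobi identity multiplied by \<open>f\<close>, for series \<open>A, B, G\<close> which are the three expansions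
  of \<open>F / f\<close>.
\<close>

theorem quasi_jacobi_of_expansions:
  assumes A: "poly12 f \<bullet> A = F" and B: "poly12 f \<bullet> B = F" and F: "F \<in> laurent2"
    and G: "G \<in> bounded_along fst"
    and GF: "ev f (mon (1, 0) + mon (0, 1)) (mon (0, 1)) \<bullet> G = expand_shift scale 1 fst dir2 F"
  shows "series_mult scale delta_12 (series_in_12 (series_mult scale (poly_series f) A)) e
     - series_mult scale delta_21 (series_in_12 (series_mult scale (poly_series f) B)) e
     = series_mult scale delta_10 (series_mult scale (series_in_12 (poly_series f)) (series_in_02 G)) e"
proof -
  let ?p = "ev f (mon (0, 1, 0)) (mon (0, 0, 1))"
  let ?D = "{A. \<forall>e. finite {d. delta_10 d \<noteq> 0 \<and> A (e - d) \<noteq> 0}} :: (exp3 \<Rightarrow> 'w) set"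
  interpret L: linear_series_map scale scale "bounded_along fst" D10 by (rule linear_D10)
  interpret M: linear_series_map scale scale ?D "series_mult scale delta_10" by (rule linear_series_mult)
  have "series_in_02 G \<in> ?D"
  proof (intro CollectI allI)
    fix e :: exp3
    obtain p m n where e: "e = (p, m, n)" by (cases e)
    obtain N where N: "\<And>m n. m < N \<Longrightarrow> G (m, n) = 0" using bounded_alongD(1)[OF G] by blast
    have "d \<in> (\<lambda>j. (j, m, - m - 1 - j)) ` {0..p - N}"
      if d: "delta_10 d \<noteq> 0" "series_in_02 G (e - d) \<noteq> 0" for d
    proof -
      obtain a b c where abc: "d = (a, b, c)" by (cases d)
      have "a \<ge> 0" "b + a = - c - 1" "b = m" "\<not> p - a < N"
        using d N by (auto simp: e abc delta_10_def binomial_coeff_def series_in_02_def split: if_splits)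
      then show ?thesis by (auto simp: abc)
    qed
    then have "{d. delta_10 d \<noteq> 0 \<and> series_in_02 G (e - d) \<noteq> 0} \<subseteq> (\<lambda>j. (j, m, - m - 1 - j)) ` {0..p - N}"
      by blast
    then show "finite {d. delta_10 d \<noteq> 0 \<and> series_in_02 G (e - d) \<noteq> 0}"
      by (rule finite_subset) simp
  qed
  then have "series_mult scale delta_10 (?p \<bullet> series_in_02 G) = ?p \<bullet> D10 G"
    unfolding D10_def
    by (intro M.relD M.rel_ev rel_series_mult)
  also have "\<dots> = D10 (ev f (mon (1, 0) + mon (0, 1)) (mon (0, 1)) \<bullet> G)"
    by (rule L.relD[OF _ G, symmetric]) (intro L.rel_ev rel_D10)
  finally have "series_mult scale delta_10 (?p \<bullet> series_in_02 G) = D10 (expand_shift scale 1 fst dir2 F)"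
    unfolding GF .
  then show ?thesis
    using delta_identity[OF F, of e]
    unfolding series_mult_poly_series A B D10_def series_in_12_poly_series act_def[of scale ?p, symmetric]
    by simp
qed

lemma act_mon_power_cancel:
  assumes "mon d ^ k \<bullet> A = mon d ^ k \<bullet> B" shows "A = B"
proof -
  have "mon (- d) ^ k * mon d ^ k = (mon (- d) * mon d) ^ k" by (simp add: power_mult_distrib)
  also have "mon (- d) * mon d = 1" by (simp add: mult_single)
  finally have "mon (- d) ^ k * mon d ^ k = 1" by simp
  then show ?thesis using assms
    by (metis act.scale_one act_mult)
qed

text \<open>
  For \<open>f = (x\<^sub>1 - x\<^sub>2)\<^sup>k\<close> the factor \<open>f\<close> turns into \<open>x\<^sub>0\<^sup>k\<close> and can be cancelled.
\<close>

theorem jacobi_of_expansions: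
  assumes A: "(mon (1, 0) - mon (0, 1)) ^ k \<bullet> A = F" and B: "(mon (1, 0) - mon (0, 1)) ^ k \<bullet> B = F"
    and AB: "A \<in> bounded_along snd" "B \<in> bounded_along fst" and F: "F \<in> laurent2"
    and G: "G \<in> bounded_along fst" and GF: "mon (1, 0) ^ k \<bullet> G = expand_shift scale 1 fst dir2 F"
  shows "series_mult scale delta_12 (series_in_12 A) e - series_mult scale delta_21 (series_in_12 B) e
     = series_mult scale delta_10 (series_in_02 G) e"
proof -
  interpret L12: linear_series_map scale scale "bounded_along snd" D12 by (rule linear_D12)
  interpret L21: linear_series_map scale scale "bounded_along fst" D21 by (rule linear_D21)
  interpret L10: linear_series_map scale scale "bounded_along fst" D10 by (rule linear_D10)
  have 1: "D12 F = mon (1, 0, 0) ^ k \<bullet> D12 A"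
    unfolding A[symmetric] by (rule L12.relD[OF L12.rel_power[OF rel_D12] AB(1)])
  have 2: "D21 F = mon (1, 0, 0) ^ k \<bullet> D21 B"
    unfolding B[symmetric] by (rule L21.relD[OF L21.rel_power[OF rel_D21] AB(2)])
  have 3: "D10 (expand_shift scale 1 fst dir2 F) = mon (1, 0, 0) ^ k \<bullet> D10 G"
    unfolding GF[symmetric] by (rule L10.relD[OF L10.rel_power[OF rel_D10(1)] G])
  have "D12 F - D21 F = D10 (expand_shift scale 1 fst dir2 F)"
    using delta_identity[OF F] by (simp add: D12_def D21_def D10_def fun_eq_iff)
  then have "mon (1, 0, 0) ^ k \<bullet> (D12 A - D21 B) = mon (1, 0, 0) ^ k \<bullet> D10 G"
    unfolding 1 2 3 act.scale_right_diff_distrib .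
  then have "D12 A - D21 B = D10 G" by (rule act_mon_power_cancel)
  from fun_cong[OF this, of e] have "D12 A e - D21 B e = D10 G e" by simp
  then show ?thesis by (simp only: D12_def D21_def D10_def)
qed

end


section \<open>Inverting polynomials in \<open>\<complex>((x))((x\<^sub>0))\<close>\<close>

text \<open>The coefficients of an element of \<open>\<complex>((x))((x\<^sub>0))\<close>, with exponents in the order \<open>(x\<^sub>0, x)\<close>.\<close>

definition coeffs :: "complex fls fls \<Rightarrow> exp2 \<Rightarrow> complex"
  where "coeffs d = (\<lambda>(p, q). fls_nth (fls_nth d p) q)"

lemma coeffs_iter_laurent2: "coeffs d \<in> iter_laurent2"
proof -
  have "\<forall>q<fls_subdegree (fls_nth d p). fls_nth (fls_nth d p) q = 0" for p by simp
  then show ?thesis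
    unfolding iter_laurent2_def coeffs_def mem_Collect_eq prod.case
    by (metis fls_eq0_below_subdegree fls_zero_nth)
qed

text \<open>The constants in \<open>\<complex>((x))((x\<^sub>0))\<close>.\<close>

abbreviation fls_const2 :: "complex \<Rightarrow> complex fls fls"
  where "fls_const2 c \<equiv> fls_const (fls_const c)"

lemma poly_shift_eq:
  "poly_shift \<alpha> f = eval2 fls_const2 f (fls_X + fls_const2 \<alpha> * fls_const fls_X) (fls_const fls_X)"
proof -
  have "fls_const (fps_to_fls (fps_of_poly p)) = poly (map_poly fls_const2 p) (fls_const fls_X)" for p :: "complex poly"
    by (induction p) (simp_all add: map_poly_pCons fps_of_poly_pCons fls_times_fps_to_fls mult.commute
        flip: fls_plus_const fls_const_mult_const)
  then show ?thesis by (simp add: poly_shift_def eval2_def)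
qed

text \<open>
  The action of the Laurent polynomial \<open>f(\<alpha>x + x\<^sub>0, x)\<close> on coefficients is multiplication by the
  element \<open>f(x\<^sub>0 + \<alpha>x, x)\<close> of the field.
\<close>

lemma act_coeffs:
  "act (*) (ev f (mon (1, 0) + cnst \<alpha> * mon (0, 1)) (mon (0, 1))) (coeffs d) = coeffs (poly_shift \<alpha> f * d)"
proof -
  interpret intertwiner "(*) :: complex fls fls \<Rightarrow> _" "act (*)" UNIV coeffs
    by unfold_locales (auto simp: coeffs_def algebra_simps)
  have c: "rel (fls_const2 c) (cnst c)" for c
    by (auto simp: rel_def coeffs_def fun_eq_iff)
  have 1: "rel fls_X (mon (1, 0))" "rel (fls_const fls_X) (mon (0, 1))"
    by (auto simp: rel_def coeffs_def fun_eq_iff fls_X_times_conv_shift)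
  have "rel (poly_shift \<alpha> f) (ev f (mon (1, 0) + cnst \<alpha> * mon (0, 1)) (mon (0, 1)))"
    unfolding poly_shift_eq by (intro rel_eval2 rel_add rel_mult c 1) simp_all
  then show ?thesis by (simp add: rel_def)
qed

lemma poly_shift_nonzero: "f \<noteq> 0 \<Longrightarrow> poly_shift \<alpha> f \<noteq> 0"
proof
  assume "f \<noteq> 0" "poly_shift \<alpha> f = 0"
  then have "act (*) (ev f (mon (1, 0) + cnst \<alpha> * mon (0, 1)) (mon (0, 1))) (coeffs 1) = 0"
    by (simp add: act_coeffs) (simp add: coeffs_def fun_eq_iff)
  then have "coeffs 1 = 0"
    using complex_field.cancel_iter_laurent2[OF ev_shift_nonzero[OF \<open>f \<noteq> 0\<close>] coeffs_iter_laurent2] by blast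
  then have "coeffs 1 (0, 0) = 0" by simp
  then show False by (simp add: coeffs_def)
qed

lemma iter_laurent2I:
  assumes "\<And>p q. p < N \<Longrightarrow> A (p, q) = 0" "\<And>p q. q < M p \<Longrightarrow> A (p, q) = 0"
  shows "A \<in> iter_laurent2"
  using assms unfolding iter_laurent2_def by blast

lemma iter_laurent2E:
  assumes "A \<in> iter_laurent2"
  obtains N M where "\<And>p q. p < N \<Longrightarrow> A (p, q) = 0" "\<And>p q. q < M p \<Longrightarrow> A (p, q) = 0"
proof -
  obtain N where "\<And>p q. p < N \<Longrightarrow> A (p, q) = 0" using iter_laurent2D(1)[OF assms] by blast
  moreover obtain M where "\<And>p q. q < M p \<Longrightarrow> A (p, q) = 0" using iter_laurent2D(2)[OF assms] by metis
  ultimately show thesis by (rule that)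
qed

lemma iter_laurent2_add:
  fixes A B :: "exp2 \<Rightarrow> 'w::ab_group_add"
  assumes "A \<in> iter_laurent2" "B \<in> iter_laurent2"
  shows "(\<lambda>e. A e + B e) \<in> iter_laurent2"
proof -
  obtain N M where A: "\<And>p q. p < N \<Longrightarrow> A (p, q) = 0" "\<And>p q. q < M p \<Longrightarrow> A (p, q) = 0"
    using assms(1) by (rule iter_laurent2E) auto
  obtain N' M' where B: "\<And>p q. p < N' \<Longrightarrow> B (p, q) = 0" "\<And>p q. q < M' p \<Longrightarrow> B (p, q) = 0"
    using assms(2) by (rule iter_laurent2E) auto
  show ?thesis
    by (rule iter_laurent2I[of "min N N'" _ "\<lambda>p. min (M p) (M' p)"]) (auto simp: A B)
qed

lemma iter_laurent2_image: "A \<in> iter_laurent2 \<Longrightarrow> F 0 = 0 \<Longrightarrow> (\<lambda>e. F (A e)) \<in> iter_laurent2"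
proof -
  assume A: "A \<in> iter_laurent2" and F: "F 0 = 0"
  obtain N M where "\<And>p q. p < N \<Longrightarrow> A (p, q) = 0" "\<And>p q. q < M p \<Longrightarrow> A (p, q) = 0"
    using A by (rule iter_laurent2E) auto
  then show ?thesis by (intro iter_laurent2I[of N _ M]) (simp_all add: F)
qed

lemma iter_laurent2_shift:
  assumes "A \<in> iter_laurent2"
  shows "(\<lambda>e. A (e - d)) \<in> iter_laurent2"
proof -
  obtain N M where A: "\<And>p q. p < N \<Longrightarrow> A (p, q) = 0" "\<And>p q. q < M p \<Longrightarrow> A (p, q) = 0"
    using assms by (rule iter_laurent2E) auto
  obtain a b where "d = (a, b)" by (cases d)
  then show ?thesis
    by (intro iter_laurent2I[of "N + a" _ "\<lambda>p. M (p - a) + b"]) (auto intro: A)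
qed

context complex_vector_space
begin

lemma finite_convolution:
  assumes c: "c \<in> iter_laurent2" and B: "(B :: exp2 \<Rightarrow> 'w) \<in> iter_laurent2"
  shows "finite {d. c d \<noteq> 0 \<and> B (e - d) \<noteq> 0}"
proof -
  obtain p q where e: "e = (p, q)" by (cases e)
  obtain N M where c: "\<And>p q. p < N \<Longrightarrow> c (p, q) = 0" "\<And>p q. q < M p \<Longrightarrow> c (p, q) = 0"
    using c by (rule iter_laurent2E) auto
  obtain N' M' where B: "\<And>p q. p < N' \<Longrightarrow> B (p, q) = 0" "\<And>p q. q < M' p \<Longrightarrow> B (p, q) = 0"
    using B by (rule iter_laurent2E) auto
  have "d \<in> (\<Union>a\<in>{N..p - N'}. {a} \<times> {M a..q - M' (p - a)})" if "c d \<noteq> 0" "B (e - d) \<noteq> 0" for d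
  proof -
    obtain a b where d: "d = (a, b)" by (cases d)
    have "\<not> a < N" "\<not> b < M a" "\<not> p - a < N'" "\<not> q - b < M' (p - a)"
      using that c B by (auto simp: d e)
    then show ?thesis by (auto simp: d)
  qed
  then have "{d. c d \<noteq> 0 \<and> B (e - d) \<noteq> 0} \<subseteq> (\<Union>a\<in>{N..p - N'}. {a} \<times> {M a..q - M' (p - a)})"
    by blast
  then show ?thesis by (rule finite_subset) auto
qed

lemma linear_series_mult_left:
  assumes "B \<in> iter_laurent2"
  shows "linear_series_map (*) scale iter_laurent2 (\<lambda>c. series_mult scale c B)"
    and "intertwiner.rel (act (*)) (act scale) iter_laurent2 (\<lambda>c. series_mult scale c B) (mon d) (mon d)"
proof -
  have fin: "finite {d. scale (c d) (B (e - d)) \<noteq> 0}" if "c \<in> iter_laurent2" for c e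
    by (rule finite_subset[OF _ finite_convolution[OF that assms, of e]]) auto
  interpret L: linear_series_map "(*)" scale iter_laurent2 "\<lambda>c. series_mult scale c B"
  proof
    fix c c' :: "exp2 \<Rightarrow> complex" and k :: complex
    assume c: "c \<in> iter_laurent2"
    then show "(\<lambda>e. k * c e) \<in> iter_laurent2" by (rule iter_laurent2_image) simp
    show "series_mult scale (\<lambda>e. k * c e) B = (\<lambda>e. scale k (series_mult scale c B e))"
      unfolding series_mult_def
      by (rule ext) (simp only: Sum_any_scale[OF fin[OF c]] scale_scale)
    assume c': "c' \<in> iter_laurent2"
    with c show "(\<lambda>e. c e + c' e) \<in> iter_laurent2" by (rule iter_laurent2_add)
    show "series_mult scale (\<lambda>e. c e + c' e) B = (\<lambda>e. series_mult scale c B e + series_mult scale c' B e)"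
      unfolding series_mult_def
      by (rule ext) (simp only: scale_left_distrib Sum_any.distrib[OF fin[OF c] fin[OF c']])
  qed
  show "linear_series_map (*) scale iter_laurent2 (\<lambda>c. series_mult scale c B)" ..
  show "L.rel (mon d) (mon d)"
  proof (rule L.rel_mon)
    fix c :: "exp2 \<Rightarrow> complex" assume "c \<in> iter_laurent2"
    then show "(\<lambda>e. c (e - d)) \<in> iter_laurent2" by (rule iter_laurent2_shift)
    show "series_mult scale (\<lambda>e. c (e - d)) B = (\<lambda>e. series_mult scale c B (e - d))"
    proof
      fix e
      have "Sum_any (\<lambda>x. scale (c (x - d)) (B (e - x))) =
          Sum_any (\<lambda>y. scale (c (y + d - d)) (B (e - (y + d))))"
      proof (rule Sum_any_reindex)
        show "x \<notin> range (\<lambda>y. y + d) \<Longrightarrow> scale (c (x - d)) (B (e - x)) = 0" for x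
          using rangeI[of "\<lambda>y. y + d" "x - d"] by simp
      qed (simp add: inj_def)
      then show "series_mult scale (\<lambda>e. c (e - d)) B e = series_mult scale c B (e - d)"
        by (simp add: series_mult_def algebra_simps)
    qed
  qed
qed

text \<open>
  Multiplication by the inverse of \<open>f(x\<^sub>0 + \<alpha>x, x)\<close> in the field \<open>\<complex>((x))((x\<^sub>0))\<close> undoes the action of
  that polynomial on \<open>W((x))((x\<^sub>0))\<close>.
\<close>

lemma series_mult_inverse:
  assumes f: "f \<noteq> 0" and B: "B \<in> iter_laurent2"
  shows "ev f (mon (1, 0) + cnst \<alpha> * mon (0, 1)) (mon (0, 1)) \<bullet>
    series_mult scale (coeffs (inverse (poly_shift \<alpha> f))) B = B" (is "?p \<bullet> _ = _")
proof -
  interpret L: linear_series_map "(*)" scale iter_laurent2 "\<lambda>c. series_mult scale c B"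
    by (rule linear_series_mult_left(1)[OF B])
  have "L.rel ?p ?p"
    by (intro L.rel_ev L.rel_add L.rel_mult L.rel_cnst linear_series_mult_left(2)[OF B])
  then have "?p \<bullet> series_mult scale (coeffs (inverse (poly_shift \<alpha> f))) B =
      series_mult scale (act (*) ?p (coeffs (inverse (poly_shift \<alpha> f)))) B"
    using L.relD coeffs_iter_laurent2 by metis
  also have "act (*) ?p (coeffs (inverse (poly_shift \<alpha> f))) = coeffs 1"
    using poly_shift_nonzero[OF f] by (simp add: act_coeffs)
  also have "series_mult scale (coeffs 1) B = B"
  proof
    fix e
    have "Sum_any (\<lambda>d. scale (coeffs 1 d) (B (e - d))) = (\<Sum>d\<in>{0}. scale (coeffs 1 d) (B (e - d)))"
      by (rule Sum_any.expand_superset) (auto simp: coeffs_def zero_prod_def split: if_splits)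
    then show "series_mult scale (coeffs 1) B e = B e"
      by (simp add: series_mult_def coeffs_def zero_prod_def) (simp flip: zero_prod_def)
  qed
  finally show ?thesis .
qed

lemma series_mult_iter_laurent2:
  assumes c: "c \<in> iter_laurent2" and B: "B \<in> iter_laurent2"
  shows "series_mult scale c B \<in> iter_laurent2"
    and "(\<And>p q. p < N \<Longrightarrow> c (p, q) = 0) \<Longrightarrow> (\<And>p q. p < N' \<Longrightarrow> B (p, q) = 0) \<Longrightarrow>
      p < N + N' \<Longrightarrow> series_mult scale c B (p, q) = 0"
proof -
  have z: "series_mult scale c B (p, q) = 0"
    if "\<And>p q. p < N \<Longrightarrow> c (p, q) = 0" "\<And>p q. p < N' \<Longrightarrow> B (p, q) = 0" "p < N + N'" for N N' p q
  proof -
    have "scale (c d) (B ((p, q) - d)) = 0" for d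
    proof -
      obtain a b where "d = (a, b)" by (cases d)
      moreover have "a < N \<or> p - a < N'" using that(3) by linarith
      ultimately show ?thesis using that(1,2) by auto
    qed
    then show ?thesis by (simp only: series_mult_def Sum_any.neutral)
  qed
  then show "(\<And>p q. p < N \<Longrightarrow> c (p, q) = 0) \<Longrightarrow> (\<And>p q. p < N' \<Longrightarrow> B (p, q) = 0) \<Longrightarrow>
      p < N + N' \<Longrightarrow> series_mult scale c B (p, q) = 0" by blast
  obtain N M where c: "\<And>p q. p < N \<Longrightarrow> c (p, q) = 0" "\<And>p q. q < M p \<Longrightarrow> c (p, q) = 0"
    using c by (rule iter_laurent2E) auto
  obtain N' M' where B: "\<And>p q. p < N' \<Longrightarrow> B (p, q) = 0" "\<And>p q. q < M' p \<Longrightarrow> B (p, q) = 0"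
    using B by (rule iter_laurent2E) auto
  have "\<exists>K. \<forall>q<K. series_mult scale c B (p, q) = 0" for p
  proof -
    define K where "K = Min ((\<lambda>a. M a + M' (p - a)) ` {N..p - N'} \<union> {0})"
    have K: "K \<le> M a + M' (p - a)" if "a \<in> {N..p - N'}" for a
      unfolding K_def using that by (intro Min_le) auto
    have "series_mult scale c B (p, q) = 0" if q: "q < K" for q
    proof -
      have "scale (c d) (B ((p, q) - d)) = 0" for d
      proof -
        obtain a b where d: "d = (a, b)" by (cases d)
        consider "a < N" | "p - a < N'" | "a \<in> {N..p - N'}" by fastforce
        then show ?thesis
        proof cases
          case 3
          then have "b < M a \<or> q - b < M' (p - a)" using K[OF 3] q by linarith
          then show ?thesis using c B d by auto
        qed (use c B d in auto)
      qed
      then show ?thesis by (simp only: series_mult_def Sum_any.neutral)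
    qed
    then show ?thesis by blast
  qed
  moreover have "series_mult scale c B (p, q) = 0" if "p < N + N'" for p q
    using z[of N N' p q] c(1) B(1) that by blast
  ultimately show "series_mult scale c B \<in> iter_laurent2"
    unfolding iter_laurent2_def by blast
qed

lemma expand_shift_iter_laurent2:
  assumes "F \<in> laurent2"
  shows "expand_shift scale \<alpha> fst dir2 F \<in> iter_laurent2"
    and "p < 0 \<Longrightarrow> expand_shift scale \<alpha> fst dir2 F (p, q) = 0"
proof -
  obtain N where N: "\<And>m n. m < N \<or> n < N \<Longrightarrow> F (m, n) = 0" using assms unfolding laurent2_def by blast
  show neg: "p < 0 \<Longrightarrow> expand_shift scale \<alpha> fst dir2 F (p, q) = 0" for p q
    by (simp add: expand_shift_def)
  have "expand_shift scale \<alpha> fst dir2 F (p, q) = 0" if "q < 2 * N - p" for p q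
  proof -
    have "p + j < N \<or> q - j < N" for j using that by linarith
    then have "F ((p, q) + (j, - j)) = 0" for j using N by simp
    then show ?thesis by (simp only: expand_shift_def scale_zero_right Sum_any.neutral)
  qed
  with neg show "expand_shift scale \<alpha> fst dir2 F \<in> iter_laurent2"
    by (rule iter_laurent2I[of 0 _ "\<lambda>p. 2 * N - p"])
qed

end

section \<open>The space \<open>\<E>(W)\<close> and the products\<close>

context complex_vector_space
begin

lemma fls_scale_nth [simp]: "fls_nth (fls_scale scale c F) n = scale c (fls_nth F n)"
  unfolding fls_scale_def
  by (rule nth_Abs_fls_lower_bound[of "fls_subdegree F"]) simp

lemma vector_space_fls_scale: "vector_space (fls_scale scale)"
  by unfold_locales (simp_all add: fls_eq_iff scale_right_distrib scale_left_distrib)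

lemma E_scale_nth [simp]: "fls_nth (E_scale scale c a w) n = scale c (fls_nth (a w) n)"
  by (simp add: E_scale_def)

lemma E_eqI: "(\<And>w n. fls_nth (a w) n = fls_nth (b w) n) \<Longrightarrow> a = b" for a b :: "'w \<Rightarrow> 'w fls"
  by (intro ext fls_eqI)

lemma complex_vector_space_E: "complex_vector_space (E_scale scale)"
  by unfold_locales (rule E_eqI; simp add: scale_right_distrib scale_left_distrib)+

lemma E_spaceI:
  assumes "\<And>x y n. fls_nth (a (x + y)) n = fls_nth (a x) n + fls_nth (a y) n"
    and "\<And>c x n. fls_nth (a (scale c x)) n = scale c (fls_nth (a x) n)"
  shows "a \<in> E_space scale"
proof -
  interpret F: vector_space "fls_scale scale" by (rule vector_space_fls_scale)
  show ?thesis
    unfolding E_space_def mem_Collect_eq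
    by unfold_locales (simp_all add: fls_eq_iff assms)
qed

lemma E_space_nth:
  assumes "a \<in> E_space scale"
  shows "fls_nth (a (x + y)) n = fls_nth (a x) n + fls_nth (a y) n"
    and "fls_nth (a (scale c x)) n = scale c (fls_nth (a x) n)"
    and "fls_nth (a 0) n = 0"
proof -
  interpret Vector_Spaces.linear scale "fls_scale scale" a using assms by (simp add: E_space_def)
  show "fls_nth (a (x + y)) n = fls_nth (a x) n + fls_nth (a y) n"
    "fls_nth (a (scale c x)) n = scale c (fls_nth (a x) n)" "fls_nth (a 0) n = 0"
    by (simp_all add: add scale)
qed

text \<open>The polynomial \<open>f\<close> is nonzero, and \<open>f(x\<^sub>1, x\<^sub>2) a(x\<^sub>1) b(x\<^sub>2)\<close> has values in \<open>W((x\<^sub>1, x\<^sub>2))\<close>.\<close>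

abbreviation compat :: "('w \<Rightarrow> 'w fls) \<Rightarrow> ('w \<Rightarrow> 'w fls) \<Rightarrow> complex poly poly \<Rightarrow> bool"
  where "compat \<equiv> compat_poly scale"

lemma compat_iff: "compat a b f \<longleftrightarrow> f \<noteq> 0 \<and> (\<forall>w. poly12 f \<bullet> op_prod a b w \<in> laurent2)"
  by (simp add: compat_poly_def series_mult_poly_series)

lemma linear_laurent2: "linear_series_map scale scale laurent2 (\<lambda>A. A)"
  and laurent2_act: "F \<in> laurent2 \<Longrightarrow> poly12 f \<bullet> F \<in> laurent2"
proof -
  interpret L: linear_series_map scale scale "laurent2 :: (exp2 \<Rightarrow> 'w) set" "\<lambda>A. A"
  proof
    fix A B :: "exp2 \<Rightarrow> 'w" and c assume "A \<in> laurent2"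
    then obtain N where A: "\<And>m n. m < N \<or> n < N \<Longrightarrow> A (m, n) = 0" unfolding laurent2_def by blast
    then show "(\<lambda>e. scale c (A e)) \<in> laurent2" by (auto simp: laurent2_def intro!: exI[of _ N])
    assume "B \<in> laurent2"
    then obtain M where "\<And>m n. m < M \<or> n < M \<Longrightarrow> B (m, n) = 0" unfolding laurent2_def by blast
    then show "(\<lambda>e. A e + B e) \<in> laurent2"
      using A by (auto simp: laurent2_def intro!: exI[of _ "min M N"])
  qed auto
  show "linear_series_map scale scale laurent2 (\<lambda>A. A)" ..
  have "L.rel (mon (i, j)) (mon (i, j))" for i j
  proof (rule L.rel_mon)
    fix A :: "exp2 \<Rightarrow> 'w" assume "A \<in> laurent2"
    then obtain N where N: "\<And>m n. m < N \<or> n < N \<Longrightarrow> A (m, n) = 0" unfolding laurent2_def by blast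
    then show "(\<lambda>e. A (e - (i, j))) \<in> laurent2"
      by (auto simp: laurent2_def min_def intro!: exI[of _ "N + min i j"] N split: if_splits)
  qed auto
  then show "F \<in> laurent2 \<Longrightarrow> poly12 f \<bullet> F \<in> laurent2"
    by (intro L.rel_closed[OF L.rel_ev])
qed

lemma compat_mult:
  assumes "compat a b f" "g \<noteq> 0" shows "compat a b (f * g)" "compat a b (g * f)"
proof -
  have "poly12 (g * f) \<bullet> op_prod a b w \<in> laurent2" for w
    unfolding ev_mult act_mult by (rule laurent2_act) (use assms(1) in \<open>simp add: compat_iff\<close>)
  then show "compat a b (g * f)" using assms by (simp add: compat_iff)
  then show "compat a b (f * g)" by (simp add: mult.commute)
qed

text \<open>The Laurent polynomial \<open>f(\<alpha>x + x\<^sub>0, x)\<close>.\<close>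

abbreviation shift_poly :: "complex \<Rightarrow> complex poly poly \<Rightarrow> exp2 \<Rightarrow>\<^sub>0 complex"
  where "shift_poly \<alpha> f \<equiv> ev f (mon (1, 0) + cnst \<alpha> * mon (0, 1)) (mon (0, 1))"

text \<open>Substitution of \<open>x\<^sub>1 = \<alpha>x + x\<^sub>0\<close> in a series of \<open>W((x\<^sub>1, x))\<close>.\<close>

abbreviation subst2 :: "complex \<Rightarrow> (exp2 \<Rightarrow> 'w) \<Rightarrow> exp2 \<Rightarrow> 'w"
  where "subst2 \<alpha> \<equiv> expand_shift scale \<alpha> fst dir2"

lemma subst2_act:
  assumes "\<alpha> \<noteq> 0" "F \<in> laurent2"
  shows "subst2 \<alpha> (poly12 f \<bullet> F) = shift_poly \<alpha> f \<bullet> subst2 \<alpha> F"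
proof -
  interpret S: linear_series_map scale scale "finite_along dir2" "subst2 \<alpha>" by (rule linear_expand_shift)
  have "S.rel (poly12 f) (shift_poly \<alpha> f)"
    by (intro S.rel_ev rel_expand_shift[OF shift_direction_dir(1) assms(1)]) simp
  then show ?thesis using S.relD assms(2) laurent2_finite_along by blast
qed

lemma Y_alpha_series_props:
  assumes f: "compat a b f" and \<alpha>: "\<alpha> \<noteq> 0"
  shows "Y_alpha_series scale \<alpha> f a b w \<in> iter_laurent2"
    and "shift_poly \<alpha> f \<bullet> Y_alpha_series scale \<alpha> f a b w = subst2 \<alpha> (poly12 f \<bullet> op_prod a b w)"
    and "p < fls_subdegree (inverse (poly_shift \<alpha> f)) \<Longrightarrow> Y_alpha_series scale \<alpha> f a b w (p, q) = 0"
proof -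
  let ?F = "poly12 f \<bullet> op_prod a b w" and ?c = "coeffs (inverse (poly_shift \<alpha> f))"
  have F: "?F \<in> laurent2" and f0: "f \<noteq> 0" using f by (auto simp: compat_iff)
  have eq: "Y_alpha_series scale \<alpha> f a b w = series_mult scale ?c (subst2 \<alpha> ?F)"
    by (simp add: Y_alpha_series_def coeffs_def subst_shift_eq series_mult_poly_series)
  note S = expand_shift_iter_laurent2[OF F, where \<alpha> = \<alpha>]
  show "Y_alpha_series scale \<alpha> f a b w \<in> iter_laurent2"
    unfolding eq by (rule series_mult_iter_laurent2(1)[OF coeffs_iter_laurent2 S(1)])
  show "shift_poly \<alpha> f \<bullet> Y_alpha_series scale \<alpha> f a b w = subst2 \<alpha> ?F"
    unfolding eq by (rule series_mult_inverse[OF f0 S(1)])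
  assume "p < fls_subdegree (inverse (poly_shift \<alpha> f))"
  then have "p < fls_subdegree (inverse (poly_shift \<alpha> f)) + 0" by simp
  then show "Y_alpha_series scale \<alpha> f a b w (p, q) = 0"
    unfolding eq
    by (rule series_mult_iter_laurent2(2)[OF coeffs_iter_laurent2 S(1), rotated 2])
      (simp_all add: coeffs_def S(2))
qed

lemma shift_poly_cancel:
  assumes "f \<noteq> 0" "A \<in> iter_laurent2" "B \<in> iter_laurent2" "shift_poly \<alpha> f \<bullet> A = shift_poly \<alpha> f \<bullet> B"
  shows "A = B"
proof -
  have "(\<lambda>e. A e + - B e) \<in> iter_laurent2"
    by (rule iter_laurent2_add[OF assms(2) iter_laurent2_image[OF assms(3), of uminus]]) simp
  then have "A - B \<in> iter_laurent2" by (simp add: fun_diff_def)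
  moreover have "shift_poly \<alpha> f \<bullet> (A - B) = 0"
    by (simp add: act.scale_right_diff_distrib assms(4))
  ultimately have "A - B = 0" by (rule cancel_iter_laurent2[OF ev_shift_nonzero[OF assms(1)]])
  then show ?thesis by simp
qed

text \<open>\<open>\<Y>\<^sub>\<alpha>(a(x), x\<^sub>0) b(x) w\<close>, with exponents in the order \<open>(x\<^sub>0, x)\<close>.\<close>

definition yprod :: "complex \<Rightarrow> ('w \<Rightarrow> 'w fls) \<Rightarrow> ('w \<Rightarrow> 'w fls) \<Rightarrow> 'w \<Rightarrow> exp2 \<Rightarrow> 'w"
  where "yprod \<alpha> a b w = Y_alpha_series scale \<alpha> (SOME f. compat a b f) a b w"

lemma yprod_iter_laurent2:
  assumes "compat a b f" "\<alpha> \<noteq> 0"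
  shows "yprod \<alpha> a b w \<in> iter_laurent2" "\<exists>N. \<forall>w p q. p < N \<longrightarrow> yprod \<alpha> a b w (p, q) = 0"
  using Y_alpha_series_props[OF someI[of "compat a b", OF assms(1)] assms(2)]
  unfolding yprod_def by blast+

text \<open>
  Independence of the polynomial: any compatible \<open>f\<close> determines the product, because the equations
  for \<open>f\<close> and for the chosen polynomial \<open>g\<close> give the same equation for \<open>f g\<close>.
\<close>

lemma yprod_eqI:
  assumes f: "compat a b f" and \<alpha>: "\<alpha> \<noteq> 0"
    and G: "G \<in> iter_laurent2" "shift_poly \<alpha> f \<bullet> G = subst2 \<alpha> (poly12 f \<bullet> op_prod a b w)"
  shows "yprod \<alpha> a b w = G"
proof -
  define g where "g = (SOME f. compat a b f)"
  have g: "compat a b g" unfolding g_def by (rule someI[of _ f]) (rule f)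
  have f0: "f \<noteq> 0" "g \<noteq> 0" and F: "poly12 f \<bullet> op_prod a b w \<in> laurent2" "poly12 g \<bullet> op_prod a b w \<in> laurent2"
    using f g by (simp_all add: compat_iff)
  have "shift_poly \<alpha> (f * g) \<bullet> yprod \<alpha> a b w = shift_poly \<alpha> f \<bullet> subst2 \<alpha> (poly12 g \<bullet> op_prod a b w)"
    using Y_alpha_series_props(2)[OF g \<alpha>] by (simp only: ev_mult act_mult yprod_def flip: g_def)
  also have "\<dots> = subst2 \<alpha> (poly12 f \<bullet> poly12 g \<bullet> op_prod a b w)"
    by (rule subst2_act[OF \<alpha> F(2), symmetric])
  also have "poly12 f \<bullet> poly12 g \<bullet> op_prod a b w = poly12 g \<bullet> poly12 f \<bullet> op_prod a b w"
    by (simp only: mult.commute[of "poly12 f"] flip: act_mult)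
  also have "subst2 \<alpha> \<dots> = shift_poly \<alpha> g \<bullet> subst2 \<alpha> (poly12 f \<bullet> op_prod a b w)"
    by (rule subst2_act[OF \<alpha> F(1)])
  also have "\<dots> = shift_poly \<alpha> (g * f) \<bullet> G"
    by (simp only: ev_mult act_mult G)
  finally have "shift_poly \<alpha> (f * g) \<bullet> yprod \<alpha> a b w = shift_poly \<alpha> (f * g) \<bullet> G"
    by (simp only: mult.commute[of g f])
  moreover have "f * g \<noteq> 0" using f0 by simp
  ultimately show ?thesis
    using G(1) yprod_iter_laurent2(1)[OF f \<alpha>] shift_poly_cancel by blast
qed

lemma yprod_char:
  assumes "compat a b f" "\<alpha> \<noteq> 0"
  shows "shift_poly \<alpha> f \<bullet> yprod \<alpha> a b w = subst2 \<alpha> (poly12 f \<bullet> op_prod a b w)"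
  using yprod_eqI[OF assms Y_alpha_series_props(1,2)[OF assms]] Y_alpha_series_props(2)[OF assms] by metis

lemma nth_prod_nth:
  assumes "compat a b f" "\<alpha> \<noteq> 0"
  shows "fls_nth (nth_prod scale \<alpha> n a b w) q = yprod \<alpha> a b w (- n - 1, q)"
  unfolding nth_prod_def yprod_def[symmetric]
  by (rule nth_Abs_fls_ex_lower_bound) (rule iter_laurent2D(2)[OF yprod_iter_laurent2(1)[OF assms]])

lemma Y_alpha_nth:
  assumes "compat a b f" "\<alpha> \<noteq> 0"
  shows "fls_nth (Y_alpha scale \<alpha> a b) p = nth_prod scale \<alpha> (- p - 1) a b"
  unfolding Y_alpha_def
proof (rule nth_Abs_fls_ex_lower_bound)
  obtain N where N: "\<And>w p q. p < N \<Longrightarrow> yprod \<alpha> a b w (p, q) = 0"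
    using yprod_iter_laurent2(2)[OF assms] by blast
  have "nth_prod scale \<alpha> (- p - 1) a b = 0" if "p < N" for p
    using N[OF that] by (intro E_eqI) (simp add: nth_prod_nth[OF assms])
  then show "\<exists>N. \<forall>p<N. nth_prod scale \<alpha> (- p - 1) a b = 0" by blast
qed

lemma Y_alpha_nth_nth:
  assumes "compat a b f" "\<alpha> \<noteq> 0"
  shows "fls_nth (fls_nth (Y_alpha scale \<alpha> a b) p w) q = yprod \<alpha> a b w (p, q)"
  by (simp add: Y_alpha_nth[OF assms] nth_prod_nth[OF assms])

lemma subst2_add:
  assumes "A \<in> laurent2" "B \<in> laurent2"
  shows "subst2 \<alpha> (A + B) = subst2 \<alpha> A + subst2 \<alpha> B"
proof -
  interpret S: linear_series_map scale scale "finite_along dir2" "subst2 \<alpha>" by (rule linear_expand_shift)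
  show ?thesis using S.L_add assms laurent2_finite_along by blast
qed

lemma subst2_scale:
  assumes "A \<in> laurent2"
  shows "subst2 \<alpha> (\<lambda>e. scale c (A e)) = (\<lambda>e. scale c (subst2 \<alpha> A e))"
proof -
  interpret S: linear_series_map scale scale "finite_along dir2" "subst2 \<alpha>" by (rule linear_expand_shift)
  show ?thesis using S.scale_L assms laurent2_finite_along by blast
qed

text \<open>
  The series is determined by a linear condition, so that it is additive in each argument.
\<close>

lemma yprod_sum:
  assumes f: "compat a b f" "compat a1 b1 f" "compat a2 b2 f" and \<alpha>: "\<alpha> \<noteq> 0"
    and eq: "op_prod a b w = op_prod a1 b1 w1 + op_prod a2 b2 w2"
  shows "yprod \<alpha> a b w = yprod \<alpha> a1 b1 w1 + yprod \<alpha> a2 b2 w2"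
proof (rule yprod_eqI[OF f(1) \<alpha>])
  show "yprod \<alpha> a1 b1 w1 + yprod \<alpha> a2 b2 w2 \<in> iter_laurent2"
    unfolding plus_fun_def by (intro iter_laurent2_add yprod_iter_laurent2(1)[OF f(2) \<alpha>] yprod_iter_laurent2(1)[OF f(3) \<alpha>])
  show "shift_poly \<alpha> f \<bullet> (yprod \<alpha> a1 b1 w1 + yprod \<alpha> a2 b2 w2) = subst2 \<alpha> (poly12 f \<bullet> op_prod a b w)"
    unfolding eq act_add_right yprod_char[OF f(2) \<alpha>] yprod_char[OF f(3) \<alpha>]
    by (rule subst2_add[symmetric]) (use f in \<open>simp_all add: compat_iff\<close>)
qed

lemma yprod_scaled:
  assumes f: "compat a b f" "compat a1 b1 f" and \<alpha>: "\<alpha> \<noteq> 0"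
    and eq: "op_prod a b w = (\<lambda>e. scale c (op_prod a1 b1 w1 e))"
  shows "yprod \<alpha> a b w = (\<lambda>e. scale c (yprod \<alpha> a1 b1 w1 e))"
proof (rule yprod_eqI[OF f(1) \<alpha>])
  show "(\<lambda>e. scale c (yprod \<alpha> a1 b1 w1 e)) \<in> iter_laurent2"
    by (rule iter_laurent2_image[OF yprod_iter_laurent2(1)[OF f(2) \<alpha>], of "scale c"]) simp
  show "shift_poly \<alpha> f \<bullet> (\<lambda>e. scale c (yprod \<alpha> a1 b1 w1 e)) = subst2 \<alpha> (poly12 f \<bullet> op_prod a b w)"
    unfolding eq act_scale_right yprod_char[OF f(2) \<alpha>]
    by (rule subst2_scale[symmetric]) (use f in \<open>simp_all add: compat_iff\<close>)
qed

lemma op_prod_linear: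
  assumes "a \<in> E_space scale"
  shows "op_prod (a + a') b w = op_prod a b w + op_prod a' b w"
    and "op_prod (E_scale scale c a) b w = (\<lambda>e. scale c (op_prod a b w e))"
    and "op_prod a (b + b') w = op_prod a b w + op_prod a b' w"
    and "op_prod a (E_scale scale c b) w = (\<lambda>e. scale c (op_prod a b w e))"
    and "b \<in> E_space scale \<Longrightarrow> op_prod a b (w + w') = op_prod a b w + op_prod a b w'"
    and "b \<in> E_space scale \<Longrightarrow> op_prod a b (scale c w) = (\<lambda>e. scale c (op_prod a b w e))"
  by (auto simp: op_prod_def fun_eq_iff E_space_nth[OF assms] E_space_nth[of b])

lemma nth_prod_in_E:
  assumes "a \<in> E_space scale" "b \<in> E_space scale" and f: "compat a b f" and \<alpha>: "\<alpha> \<noteq> 0"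
  shows "nth_prod scale \<alpha> n a b \<in> E_space scale"
proof (rule E_spaceI)
  show "fls_nth (nth_prod scale \<alpha> n a b (x + y)) q =
      fls_nth (nth_prod scale \<alpha> n a b x) q + fls_nth (nth_prod scale \<alpha> n a b y) q" for x y q
    using yprod_sum[OF f f f \<alpha> op_prod_linear(5)[OF assms(1,2)]] by (simp add: nth_prod_nth[OF f \<alpha>])
  show "fls_nth (nth_prod scale \<alpha> n a b (scale c x)) q = scale c (fls_nth (nth_prod scale \<alpha> n a b x) q)" for c x q
    using yprod_scaled[OF f f \<alpha> op_prod_linear(6)[OF assms(1,2)]] by (simp add: nth_prod_nth[OF f \<alpha>])
qed

lemma compat_add:
  assumes "compat a b f" "compat a' b' f"
    and "\<And>w. op_prod a'' b'' w = op_prod a b w + op_prod a' b' w"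
  shows "compat a'' b'' f"
proof -
  interpret L: linear_series_map scale scale "laurent2 :: (exp2 \<Rightarrow> 'w) set" "\<lambda>A. A" by (rule linear_laurent2)
  show ?thesis
    using assms(1,2) by (auto simp: compat_iff assms(3) act_add_right intro!: L.D_add)
qed

lemma compat_scaled:
  assumes "compat a b f" and "\<And>w. op_prod a'' b'' w = (\<lambda>e. scale c (op_prod a b w e))"
  shows "compat a'' b'' f"
proof -
  interpret L: linear_series_map scale scale "laurent2 :: (exp2 \<Rightarrow> 'w) set" "\<lambda>A. A" by (rule linear_laurent2)
  show ?thesis
    using assms(1) by (auto simp: compat_iff assms(2) act_scale_right intro!: L.scale_D)
qed

lemma Y_alpha_sum:
  assumes "compat a b f" "compat a' b' f'" and \<alpha>: "\<alpha> \<noteq> 0"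
    and eq: "\<And>w. op_prod a'' b'' w = op_prod a b w + op_prod a' b' w"
  shows "Y_alpha scale \<alpha> a'' b'' = Y_alpha scale \<alpha> a b + Y_alpha scale \<alpha> a' b'"
proof -
  have g: "compat a b (f * f')" "compat a' b' (f * f')"
    using compat_mult(1)[OF assms(1)] compat_mult(2)[OF assms(2)] assms(1,2)
    by (simp_all add: compat_iff)
  note g'' = compat_add[OF g eq]
  show ?thesis
    by (intro fls_eqI E_eqI)
      (simp add: Y_alpha_nth_nth[OF g(1) \<alpha>] Y_alpha_nth_nth[OF g(2) \<alpha>] Y_alpha_nth_nth[OF g'' \<alpha>]
        yprod_sum[OF g'' g \<alpha> eq])
qed

lemma Y_alpha_scaled:
  assumes f: "compat a b f" and \<alpha>: "\<alpha> \<noteq> 0" and eq: "\<And>w. op_prod a'' b'' w = (\<lambda>e. scale c (op_prod a b w e))"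
  shows "Y_alpha scale \<alpha> a'' b'' = fls_scale (E_scale scale) c (Y_alpha scale \<alpha> a b)"
proof -
  interpret E: complex_vector_space "E_scale scale" by (rule complex_vector_space_E)
  note f'' = compat_scaled[OF f eq]
  show ?thesis
    by (intro fls_eqI E_eqI)
      (simp add: Y_alpha_nth_nth[OF f \<alpha>] Y_alpha_nth_nth[OF f'' \<alpha>] yprod_scaled[OF f'' f \<alpha> eq])
qed

lemma fls_const_in_E: "fls_const \<in> E_space scale"
  by (rule E_spaceI) simp_all

lemma compat_vacuum_left: "compat fls_const b 1"
proof -
  have "op_prod fls_const b w \<in> laurent2" for w
    by (auto simp: laurent2_def op_prod_def intro!: exI[of _ "min 0 (fls_subdegree (b w))"])
  then show ?thesis by (simp add: compat_iff)
qed

lemma Y_alpha_vacuum_left: "Y_alpha scale 1 fls_const b = fls_const b"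
proof (intro fls_eqI E_eqI)
  fix p q w
  have "yprod 1 fls_const b w = subst2 1 (op_prod fls_const b w)"
    using yprod_char[OF compat_vacuum_left, of 1 b w] by simp
  moreover have "subst2 1 (op_prod fls_const b w) (p, q) =
      (\<Sum>j\<in>{- p}. scale (1 powi j * zchoose (fst (p, q) + j) (fst (p, q))) (op_prod fls_const b w ((p, q) + (j, - j))))"
    unfolding expand_shift_def
    by (rule Sum_any.expand_superset) (auto simp: op_prod_def split: if_splits)
  ultimately show "fls_nth (fls_nth (Y_alpha scale 1 fls_const b) p w) q = fls_nth (fls_nth (fls_const b) p w) q"
    using zchoose_eq_0[of 0 p]
    by (cases p "0 :: int" rule: linorder_cases)
      (simp_all add: Y_alpha_nth_nth[OF compat_vacuum_left] op_prod_def)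
qed

lemma compat_vacuum_right:
  assumes "a \<in> E_space scale" shows "compat a fls_const 1"
proof -
  have "op_prod a fls_const w \<in> laurent2" for w
    by (auto simp: laurent2_def op_prod_def E_space_nth[OF assms] intro!: exI[of _ "min 0 (fls_subdegree (a w))"])
  then show ?thesis by (simp add: compat_iff)
qed

lemma Y_alpha_vacuum_right:
  assumes a: "a \<in> E_space scale"
  shows "p < 0 \<Longrightarrow> fls_nth (Y_alpha scale 1 a fls_const) p = 0"
    and "fls_nth (Y_alpha scale 1 a fls_const) 0 = a"
proof -
  note c = compat_vacuum_right[OF a]
  have 1: "yprod 1 a fls_const w = subst2 1 (op_prod a fls_const w)" for w
    using yprod_char[OF c, of 1 w] by simp
  have 2: "subst2 1 (op_prod a fls_const w) (p, q) =
      (\<Sum>j\<in>{q}. scale (1 powi j * zchoose (fst (p, q) + j) (fst (p, q))) (op_prod a fls_const w ((p, q) + (j, - j))))"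
    for w p q
    unfolding expand_shift_def
    by (rule Sum_any.expand_superset) (auto simp: op_prod_def E_space_nth[OF a] split: if_splits)
  show "p < 0 \<Longrightarrow> fls_nth (Y_alpha scale 1 a fls_const) p = 0"
    by (rule E_eqI) (simp add: Y_alpha_nth_nth[OF c] 1 2)
  show "fls_nth (Y_alpha scale 1 a fls_const) 0 = a"
    by (rule E_eqI) (simp add: Y_alpha_nth_nth[OF c] 1 2, simp add: op_prod_def)
qed

end

section \<open>Polynomials with nonnegative exponents\<close>

lemma ev_closed:
  assumes "\<And>c. P (cnst c)" "\<And>p q. P p \<Longrightarrow> P q \<Longrightarrow> P (p + q)" "\<And>p q. P p \<Longrightarrow> P q \<Longrightarrow> P (p * q)"
    and "P s" "P t"
  shows "P (ev f s t)"
proof -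
  have 0: "P 0" using assms(1)[of 0] by simp
  have 1: "P (poly (map_poly cnst p) t)" for p
    by (induction p) (auto simp: map_poly_pCons 0 intro: assms)
  show ?thesis
    by (induction f) (simp_all add: ev_pCons 0 assms(2)[OF 1 assms(3)[OF assms(4)]])
qed

text \<open>All exponents of \<open>p\<close> are nonnegative in the direction \<open>\<pi>\<close>.\<close>

definition nonneg_exp :: "('e \<Rightarrow> int) \<Rightarrow> ('e \<Rightarrow>\<^sub>0 complex) \<Rightarrow> bool"
  where "nonneg_exp \<pi> p \<longleftrightarrow> (\<forall>d\<in>Poly_Mapping.keys p. 0 \<le> \<pi> d)"

lemma nonneg_exp_add: "nonneg_exp \<pi> p \<Longrightarrow> nonneg_exp \<pi> q \<Longrightarrow> nonneg_exp \<pi> (p + q)"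
  unfolding nonneg_exp_def using Poly_Mapping.keys_add[of p q] by blast

lemma nonneg_exp_mult:
  assumes "\<And>a b. \<pi> (a + b) = \<pi> a + \<pi> b" "nonneg_exp \<pi> p" "nonneg_exp \<pi> q"
  shows "nonneg_exp \<pi> (p * q)"
  unfolding nonneg_exp_def
proof
  fix d assume "d \<in> Poly_Mapping.keys (p * q)"
  then obtain a b where "d = a + b" "a \<in> Poly_Mapping.keys p" "b \<in> Poly_Mapping.keys q"
    using Poly_Mapping.keys_mult[of p q] by blast
  then show "0 \<le> \<pi> d" using assms by (simp add: nonneg_exp_def)
qed

lemma nonneg_exp_single: "0 \<le> \<pi> d \<Longrightarrow> nonneg_exp \<pi> (Poly_Mapping.single d c)"
  by (simp add: nonneg_exp_def)

lemma nonneg_exp_ev: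
  fixes \<pi> :: "'e::ab_group_add \<Rightarrow> int"
  assumes "\<And>a b. \<pi> (a + b) = \<pi> a + \<pi> b" "nonneg_exp \<pi> s" "nonneg_exp \<pi> t"
  shows "nonneg_exp \<pi> (ev f s t)"
proof (rule ev_closed)
  have "\<pi> 0 = 0" using assms(1)[of 0 0] by simp
  then show "nonneg_exp \<pi> (cnst c)" for c by (intro nonneg_exp_single) simp
qed (use assms in \<open>auto intro: nonneg_exp_add nonneg_exp_mult\<close>)

lemma slot_add: "slot1 (a + b) = slot1 a + slot1 b" "slot2 (a + b) = slot2 a + slot2 b"
  by (auto split: prod.split)

lemmas nonneg_exp_intros = nonneg_exp_ev nonneg_exp_add nonneg_exp_mult nonneg_exp_single slot_add

section \<open>Series in three variables\<close>

text \<open>The three variables.\<close>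

abbreviation Y1 :: "exp3 \<Rightarrow>\<^sub>0 complex" where "Y1 \<equiv> mon (1, 0, 0)"
abbreviation Y2 :: "exp3 \<Rightarrow>\<^sub>0 complex" where "Y2 \<equiv> mon (0, 1, 0)"
abbreviation Y3 :: "exp3 \<Rightarrow>\<^sub>0 complex" where "Y3 \<equiv> mon (0, 0, 1)"

text \<open>
  The coefficient of the \<open>k\<close>th power of the second, respectively third, variable, and the
  interchange of the first two variables.
\<close>

definition slice2 :: "int \<Rightarrow> (exp3 \<Rightarrow> 'w) \<Rightarrow> exp2 \<Rightarrow> 'w"
  where "slice2 k C = (\<lambda>(m, q). C (m, k, q))"

definition slice3 :: "int \<Rightarrow> (exp3 \<Rightarrow> 'w) \<Rightarrow> exp2 \<Rightarrow> 'w"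
  where "slice3 k C = (\<lambda>(m, n). C (m, n, k))"

definition swap12 :: "(exp3 \<Rightarrow> 'w) \<Rightarrow> exp3 \<Rightarrow> 'w"
  where "swap12 C = (\<lambda>(m, n, q). C (n, m, q))"

lemma slice2_apply [simp]: "slice2 k C (m, q) = C (m, k, q)"
  and slice3_apply [simp]: "slice3 k C (m, n) = C (m, n, k)"
  and swap12_apply [simp]: "swap12 C (m, n, q) = C (n, m, q)"
  by (simp_all add: slice2_def slice3_def swap12_def)

lemma swap12_swap12 [simp]: "swap12 (swap12 C) = C"
  by (simp add: fun_eq_iff split_paired_All)

lemma slice2_eqI: "(\<And>k. slice2 k C = slice2 k C') \<Longrightarrow> C = C'"
  by (metis (no_types, lifting) ext slice2_apply surj_pair)

lemma slice3_eqI: "(\<And>k. slice3 k C = slice3 k C') \<Longrightarrow> C = C'"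
  by (metis (no_types, lifting) ext slice3_apply surj_pair)

context complex_vector_space
begin

text \<open>
  If \<open>p\<close> has no negative exponents in the direction \<open>\<pi>\<close>, the coefficients of \<open>p A\<close> up to level \<open>n\<close>
  depend only on those of \<open>A\<close> up to level \<open>n\<close>.
\<close>

lemma act_agree:
  assumes \<pi>: "\<And>a b. \<pi> (a - b) = \<pi> a - \<pi> b" and p: "nonneg_exp \<pi> p"
    and "\<And>e. \<pi> e \<le> n \<Longrightarrow> A e = B e" "\<pi> e \<le> n"
  shows "(p \<bullet> A) e = (p \<bullet> B) e"
  unfolding act_eq
proof (rule sum.cong)
  fix d assume "d \<in> Poly_Mapping.keys p"
  then have "\<pi> (e - d) \<le> n" using p assms(4) by (auto simp: \<pi> nonneg_exp_def)
  then show "scale (Poly_Mapping.lookup p d) (A (e - d)) = scale (Poly_Mapping.lookup p d) (B (e - d))"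
    by (simp add: assms(3))
qed simp

lemma act_closed:
  assumes "0 \<in> D" "\<And>A B. A \<in> D \<Longrightarrow> B \<in> D \<Longrightarrow> (\<lambda>e. A e + B e) \<in> D"
    "\<And>A c d. A \<in> D \<Longrightarrow> (\<lambda>e. scale c (A (e - d))) \<in> D" and A: "A \<in> D"
  shows "p \<bullet> A \<in> D"
proof (induction p rule: poly_mapping_single_induct)
  case zero
  show ?case by (simp only: act_zero_left assms(1))
next
  case (single d c)
  have "Poly_Mapping.single d c \<bullet> A = (\<lambda>e. scale c (A (e - d)))" by (rule ext) simp
  then show ?case by (simp add: assms(3) A)
next
  case (add p q)
  then show ?case using assms(2) by (simp add: act_add_left plus_fun_def)
qed

lemma linear_slice2: "linear_series_map scale scale UNIV (slice2 k)"
  by unfold_locales (simp_all add: fun_eq_iff split_paired_All)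

lemma rel_slice2:
  "carries UNIV (slice2 k) Y1 (mon (1, 0))"
  "carries UNIV (slice2 k) Y3 (mon (0, 1))"
proof -
  interpret L: linear_series_map scale scale UNIV "slice2 k" by (rule linear_slice2)
  show "L.rel Y1 (mon (1, 0))" "L.rel Y3 (mon (0, 1))"
    by (rule L.rel_mon; simp add: fun_eq_iff split_paired_All)+
qed

lemma linear_slice3: "linear_series_map scale scale UNIV (slice3 k)"
  by unfold_locales (simp_all add: fun_eq_iff split_paired_All)

lemma rel_slice3:
  "carries UNIV (slice3 k) Y1 (mon (1, 0))"
  "carries UNIV (slice3 k) Y2 (mon (0, 1))"
proof -
  interpret L: linear_series_map scale scale UNIV "slice3 k" by (rule linear_slice3)
  show "L.rel Y1 (mon (1, 0))" "L.rel Y2 (mon (0, 1))"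
    by (rule L.rel_mon; simp add: fun_eq_iff split_paired_All)+
qed

lemma linear_swap12: "linear_series_map scale scale UNIV swap12"
  by unfold_locales (simp_all add: fun_eq_iff split_paired_All)

lemma rel_swap12:
  "carries UNIV swap12 Y1 Y2"
  "carries UNIV swap12 Y2 Y1"
  "carries UNIV swap12 Y3 Y3"
proof -
  interpret L: linear_series_map scale scale UNIV swap12 by (rule linear_swap12)
  show "L.rel Y1 Y2" "L.rel Y2 Y1" "L.rel Y3 Y3"
    by (rule L.rel_mon; simp add: fun_eq_iff split_paired_All)+
qed

text \<open>
  The substitutions \<open>y\<^sub>1 = y\<^sub>2 + x\<^sub>0\<close>, \<open>y\<^sub>1 = x + x\<^sub>1\<close> and \<open>y\<^sub>2 = x + x\<^sub>2\<close> in series in \<open>(y\<^sub>1, y\<^sub>2, x)\<close>; the new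
  variable takes the slot of the replaced one, and powers are expanded in nonnegative powers of
  it.  Applied to series in \<open>(x\<^sub>1, x\<^sub>2, x)\<close>, the first one is \<open>x\<^sub>1 = x\<^sub>2 + x\<^sub>0\<close>.
\<close>

abbreviation S12 :: "(exp3 \<Rightarrow> 'w) \<Rightarrow> exp3 \<Rightarrow> 'w" where "S12 \<equiv> expand_shift scale 1 slot1 dir12"
abbreviation S13 :: "(exp3 \<Rightarrow> 'w) \<Rightarrow> exp3 \<Rightarrow> 'w" where "S13 \<equiv> expand_shift scale 1 slot1 dir13"
abbreviation S23 :: "(exp3 \<Rightarrow> 'w) \<Rightarrow> exp3 \<Rightarrow> 'w" where "S23 \<equiv> expand_shift scale 1 slot2 dir23"

lemma rel_S12:
  "carries (finite_along dir12) S12 Y1 (Y1 + Y2)"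
  "carries (finite_along dir12) S12 Y2 Y2"
  "carries (finite_along dir12) S12 Y3 Y3"
  using rel_expand_shift(1)[OF shift_direction_dir(2), of 1]
  by (auto intro!: rel_expand_shift(2)[OF shift_direction_dir(2)])

lemma rel_S13:
  "carries (finite_along dir13) S13 Y1 (Y1 + Y3)"
  "carries (finite_along dir13) S13 Y2 Y2"
  "carries (finite_along dir13) S13 Y3 Y3"
  using rel_expand_shift(1)[OF shift_direction_dir(3), of 1]
  by (auto intro!: rel_expand_shift(2)[OF shift_direction_dir(3)])

lemma rel_S23:
  "carries (finite_along dir23) S23 Y1 Y1"
  "carries (finite_along dir23) S23 Y2 (Y2 + Y3)"
  "carries (finite_along dir23) S23 Y3 Y3"
  using rel_expand_shift(1)[OF shift_direction_dir(4), of 1]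
  by (auto intro!: rel_expand_shift(2)[OF shift_direction_dir(4)])

lemma slice2_S13: "slice2 k (S13 C) = subst2 1 (slice2 k C)"
  by (auto simp: fun_eq_iff expand_shift_def)

lemma finite_along_dir13I: "(\<And>k. slice2 k C \<in> laurent2) \<Longrightarrow> C \<in> finite_along dir13"
proof -
  assume C: "\<And>k. slice2 k C \<in> laurent2"
  have "finite {j. C ((p, k, q) + (j, 0, - j)) \<noteq> 0}" for p k q
  proof -
    have "slice2 k C \<in> finite_along dir2" using C laurent2_finite_along by blast
    from finite_alongD[OF this, of "(p, q)"] show ?thesis by simp
  qed
  then show ?thesis by (simp add: finite_along_def split_paired_All)
qed

section \<open>Products of families of fields\<close>

text \<open>
  The polynomial needed to define \<open>\<Y>(a\<^sub>k(x), x\<^sub>1) b\<^sub>k(x)\<close> depends on \<open>k\<close>, so that there need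
  not be one for the whole family.  For each \<open>n\<close> there is one for all \<open>k \<le> n\<close>; since \<open>r\<close> has no
  negative powers of the variable recording \<open>k\<close>, the terms with \<open>k \<le> n\<close> can be treated separately.
\<close>

lemma family_yprod:
  fixes a b :: "int \<Rightarrow> 'w \<Rightarrow> 'w fls"
  assumes compat: "\<And>k. \<exists>f. compat (a k) (b k) f"
    and zero: "\<And>k w'. k < N \<Longrightarrow> op_prod (a k) (b k) w' = 0"
    and A: "A = (\<lambda>(m, k, q). op_prod (a k) (b k) w (m, q))"
    and P: "P = (\<lambda>(p, k, q). yprod 1 (a k) (b k) w (p, q))"
    and r: "carries (finite_along dir13) S13 r r'"
    and nonneg: "nonneg_exp slot2 r" "nonneg_exp slot2 r'"
    and K: "\<And>k. slice2 k (r \<bullet> A) \<in> laurent2"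
  shows "r' \<bullet> P = S13 (r \<bullet> A)"
proof (rule slice2_eqI)
  fix n
  interpret S: linear_series_map scale scale "finite_along dir13" S13 by (rule linear_expand_shift)
  interpret L: linear_series_map scale scale UNIV "slice2 k" for k by (rule linear_slice2)
  have diff: "slot2 (x - y) = slot2 x - slot2 y" for x y by (auto split: prod.split)
  \<comment> \<open>A common polynomial for all \<open>k\<close> with \<open>N \<le> k \<le> n\<close>; below \<open>N\<close> the products vanish.\<close>
  have "\<exists>g. g \<noteq> 0 \<and> (\<forall>k\<in>I. compat (a k) (b k) g)" if "finite I" for I
    using that
  proof (induction I rule: finite_induct)
    case empty
    show ?case by (rule exI[of _ 1]) simp
  next
    case (insert k I)
    then obtain g where g: "g \<noteq> 0" "\<forall>k\<in>I. compat (a k) (b k) g" by blast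
    obtain f where f: "compat (a k) (b k) f" using compat by blast
    then have "f \<noteq> 0" by (simp add: compat_iff)
    then have "\<forall>k\<in>insert k I. compat (a k) (b k) (f * g)"
      using compat_mult(1)[OF f g(1)] compat_mult(2)[OF _ \<open>f \<noteq> 0\<close>] g(2) by blast
    then show ?case using \<open>f \<noteq> 0\<close> g(1) by (intro exI[of _ "f * g"]) simp
  qed
  from this[of "{N..n}"] obtain g where g: "g \<noteq> 0" "\<And>k. k \<in> {N..n} \<Longrightarrow> compat (a k) (b k) g" by auto
  have compat_g: "compat (a k) (b k) g" if "k \<le> n" for k
  proof (cases "k < N")
    case True
    have "op_prod (a k) (b k) w' = 0" for w' by (rule zero[OF True])
    then show ?thesis using g(1) by (simp add: compat_iff laurent2_def)
  next
    case False
    then show ?thesis using that g(2) by simp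
  qed
  \<comment> \<open>The families truncated to \<open>k \<le> n\<close>; for them the claim holds after multiplication by \<open>g\<close>, and
    their coefficients at \<open>k = n\<close> are not affected by the truncation.\<close>
  define A' P' where "A' = (\<lambda>(m, k, q). if k \<le> n then A (m, k, q) else 0)"
    and "P' = (\<lambda>(m, k, q). if k \<le> n then P (m, k, q) else 0)"
  define h h' where "h = ev g Y1 Y3" and "h' = ev g (Y1 + Y3) Y3"
  have h: "S.rel h h'" unfolding h_def h'_def by (intro S.rel_ev rel_S13)
  have Lh: "L.rel k h (poly12 g)" "L.rel k h' (shift_poly 1 g)" for k
    unfolding h_def h'_def single_one[symmetric]
    by (intro L.rel_ev L.rel_add rel_slice2, (simp add: rel_slice2)?)+
  have slice_A': "slice2 k A' = (if k \<le> n then op_prod (a k) (b k) w else 0)"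
    and slice_P': "slice2 k P' = (if k \<le> n then yprod 1 (a k) (b k) w else 0)" for k
    by (auto simp: fun_eq_iff A'_def P'_def A P)
  have hA'_slice: "slice2 k (h \<bullet> A') = poly12 g \<bullet> slice2 k A'" for k
    by (rule L.relD[OF Lh(1)]) simp
  have "slice2 k (h \<bullet> A') \<in> laurent2" for k
    using compat_g[of k] by (simp add: hA'_slice slice_A' compat_iff laurent2_def)
  then have hA': "h \<bullet> A' \<in> finite_along dir13" by (rule finite_along_dir13I)
  have hP': "S13 (h \<bullet> A') = h' \<bullet> P'"
  proof (rule slice2_eqI)
    fix k
    have "slice2 k (S13 (h \<bullet> A')) = subst2 1 (poly12 g \<bullet> slice2 k A')"
      by (simp only: slice2_S13 hA'_slice)
    also have "\<dots> = shift_poly 1 g \<bullet> slice2 k P'"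
    proof (cases "k \<le> n")
      case True
      then show ?thesis by (simp only: slice_A' slice_P' if_True yprod_char[OF compat_g[OF True] one_neq_zero])
    next
      case False
      then show ?thesis by (simp add: slice_A' slice_P' expand_shift_def fun_eq_iff)
    qed
    also have "\<dots> = slice2 k (h' \<bullet> P')" by (rule L.relD[OF Lh(2), symmetric]) simp
    finally show "slice2 k (S13 (h \<bullet> A')) = slice2 k (h' \<bullet> P')" .
  qed
  have "h' \<bullet> r' \<bullet> P' = r' \<bullet> S13 (h \<bullet> A')"
    by (simp only: hP' act_mult[symmetric] mult.commute)
  also have "\<dots> = S13 (r \<bullet> h \<bullet> A')" by (rule S.relD[OF r hA', symmetric])
  also have "r \<bullet> h \<bullet> A' = h \<bullet> r \<bullet> A'" by (simp only: act_mult[symmetric] mult.commute)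
  finally have eq: "h' \<bullet> r' \<bullet> P' = S13 (h \<bullet> r \<bullet> A')" .
  \<comment> \<open>Taking the coefficient at \<open>k = n\<close> removes the truncation, after which \<open>g\<close> is cancelled.\<close>
  have rA: "slice2 n (r \<bullet> A') = slice2 n (r \<bullet> A)"
    by (auto simp: fun_eq_iff A'_def intro!: act_agree[where \<pi> = slot2, OF diff nonneg(1), of n])
  have rP: "slice2 n (r' \<bullet> P') = slice2 n (r' \<bullet> P)"
    by (auto simp: fun_eq_iff P'_def intro!: act_agree[where \<pi> = slot2, OF diff nonneg(2), of n])
  have "shift_poly 1 g \<bullet> slice2 n (r' \<bullet> P) = slice2 n (h' \<bullet> r' \<bullet> P')"
    unfolding rP[symmetric] by (rule L.relD[OF Lh(2), symmetric]) simp
  also have "\<dots> = subst2 1 (slice2 n (h \<bullet> r \<bullet> A'))" by (simp only: eq slice2_S13)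
  also have "slice2 n (h \<bullet> r \<bullet> A') = poly12 g \<bullet> slice2 n (r \<bullet> A)"
    unfolding rA[symmetric] by (rule L.relD[OF Lh(1)]) simp
  also have "subst2 1 \<dots> = shift_poly 1 g \<bullet> subst2 1 (slice2 n (r \<bullet> A))"
    by (rule subst2_act[OF _ K]) simp
  finally have "shift_poly 1 g \<bullet> slice2 n (r' \<bullet> P) = shift_poly 1 g \<bullet> subst2 1 (slice2 n (r \<bullet> A))" .
  moreover have "slice2 n (r' \<bullet> P) \<in> iter_laurent2"
  proof -
    let ?D = "{C :: exp3 \<Rightarrow> 'w. \<forall>k. slice2 k C \<in> iter_laurent2}"
    have "slice2 k P' \<in> iter_laurent2" for k
    proof (cases "k \<le> n")
      case True
      then show ?thesis using yprod_iter_laurent2(1)[OF compat_g[OF True], of 1] by (simp only: slice_P' if_True one_neq_zero not_False_eq_True)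
    next
      case False
      then show ?thesis by (simp only: slice_P' if_False) (simp add: iter_laurent2_def)
    qed
    then have "P' \<in> ?D" by blast
    then have "r' \<bullet> P' \<in> ?D"
    proof (rule act_closed[rotated 3])
      show "0 \<in> ?D" by (auto simp: iter_laurent2_def slice2_def)
      fix C C' :: "exp3 \<Rightarrow> 'w" and c and d :: exp3 assume C: "C \<in> ?D"
      obtain d1 d2 d3 where d: "d = (d1, d2, d3)" by (cases d)
      have "slice2 k (\<lambda>e. scale c (C (e - d))) = (\<lambda>e. scale c (slice2 (k - d2) C (e - (d1, d3))))" for k
        by (auto simp: fun_eq_iff d)
      moreover have "(\<lambda>e. scale c (slice2 (k - d2) C (e - (d1, d3)))) \<in> iter_laurent2" for k
        by (rule iter_laurent2_image[OF iter_laurent2_shift, of _ "scale c"]) (use C in simp_all)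
      ultimately show "(\<lambda>e. scale c (C (e - d))) \<in> ?D" by simp
      assume C': "C' \<in> ?D"
      have "slice2 k (\<lambda>e. C e + C' e) = (\<lambda>e. slice2 k C e + slice2 k C' e)" for k
        by (auto simp: fun_eq_iff)
      then show "(\<lambda>e. C e + C' e) \<in> ?D" using C C' by (simp add: iter_laurent2_add)
    qed
    then show ?thesis by (simp flip: rP)
  qed
  ultimately have "slice2 n (r' \<bullet> P) = subst2 1 (slice2 n (r \<bullet> A))"
    using shift_poly_cancel[OF g(1) _ expand_shift_iter_laurent2(1)[OF K]] by blast
  then show "slice2 n (r' \<bullet> P) = slice2 n (S13 (r \<bullet> A))" by (simp only: slice2_S13)
qed

end

section \<open>Division by a polynomial in \<open>\<complex>((x))[x\<^sub>1, x\<^sub>2]\<close> with nonzero constant term\<close>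

text \<open>
  Polynomials in the first two variables, with coefficients that are Laurent polynomials in the
  third.
\<close>

abbreviation nonneg12 :: "(exp3 \<Rightarrow>\<^sub>0 complex) \<Rightarrow> bool"
  where "nonneg12 p \<equiv> nonneg_exp slot1 p \<and> nonneg_exp slot2 p"

text \<open>Congruence modulo \<open>y\<close>, in the ring of polynomials in the first two variables.\<close>

definition cong_mod :: "(exp3 \<Rightarrow>\<^sub>0 complex) \<Rightarrow> (exp3 \<Rightarrow>\<^sub>0 complex) \<Rightarrow> (exp3 \<Rightarrow>\<^sub>0 complex) \<Rightarrow> bool"
  where "cong_mod y p q \<longleftrightarrow> nonneg12 p \<and> nonneg12 q \<and> (\<exists>r. nonneg12 r \<and> p = q + y * r)"

lemma cong_mod_add: "cong_mod y p q \<Longrightarrow> cong_mod y p' q' \<Longrightarrow> cong_mod y (p + p') (q + q')"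
proof -
  assume "cong_mod y p q" "cong_mod y p' q'"
  then obtain r r' where 1: "nonneg12 p" "nonneg12 q" "nonneg12 r" "p = q + y * r"
    and 2: "nonneg12 p'" "nonneg12 q'" "nonneg12 r'" "p' = q' + y * r'"
    unfolding cong_mod_def by blast
  have "p + p' = q + q' + y * (r + r')" by (simp add: 1(4) 2(4) algebra_simps)
  moreover have "nonneg12 (p + p')" "nonneg12 (q + q')" "nonneg12 (r + r')"
    using 1(1-3) 2(1-3) by (simp_all add: nonneg_exp_add)
  ultimately show ?thesis unfolding cong_mod_def by blast
qed

lemma cong_mod_mult: "cong_mod y p q \<Longrightarrow> cong_mod y p' q' \<Longrightarrow> cong_mod y (p * p') (q * q')"
proof -
  assume "cong_mod y p q" "cong_mod y p' q'"
  then obtain r r' where 1: "nonneg12 p" "nonneg12 q" "nonneg12 r" "p = q + y * r"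
    and 2: "nonneg12 p'" "nonneg12 q'" "nonneg12 r'" "p' = q' + y * r'"
    unfolding cong_mod_def by blast
  have "p * p' = q * p' + y * (r * p')" by (simp add: 1(4) algebra_simps)
  also have "q * p' = q * q' + y * (q * r')" by (simp add: 2(4) algebra_simps)
  finally have "p * p' = q * q' + y * (r * p' + q * r')" by (simp add: algebra_simps)
  moreover have "nonneg12 (p * p')" "nonneg12 (q * q')" "nonneg12 (r * p' + q * r')"
    using 1(1-3) 2(1-3) by (auto intro!: nonneg_exp_add nonneg_exp_mult slot_add)
  ultimately show ?thesis unfolding cong_mod_def by blast
qed

lemma cong_mod_refl: "nonneg12 p \<Longrightarrow> cong_mod y p p"
  unfolding cong_mod_def by (intro conjI exI[of _ 0]) (simp_all add: nonneg_exp_def)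

lemma cong_mod_ev:
  assumes "cong_mod y s s'" "cong_mod y t t'"
  shows "cong_mod y (ev f s t) (ev f s' t')"
proof -
  have c: "cong_mod y (cnst c) (cnst c)" for c
    by (rule cong_mod_refl) (simp add: nonneg_exp_single zero_prod_def)
  then have 0: "cong_mod y 0 0" using c[of 0] by simp
  have 1: "cong_mod y (poly (map_poly cnst p) t) (poly (map_poly cnst p) t')" for p
    by (induction p) (auto simp: map_poly_pCons 0 assms intro!: cong_mod_add cong_mod_mult c)
  show ?thesis by (induction f) (auto simp: ev_pCons 0 1 assms intro!: cong_mod_add cong_mod_mult)
qed

lemma nonneg12_variables: "nonneg12 Y1" "nonneg12 Y2" "nonneg12 Y3" "nonneg12 (cnst c)"
  by (simp_all add: nonneg_exp_single zero_prod_def)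

lemma cong_mod_self: "nonneg12 y \<Longrightarrow> nonneg12 p \<Longrightarrow> cong_mod y (y + p) p"
  unfolding cong_mod_def
  by (intro conjI exI[of _ 1] nonneg_exp_add) (simp_all add: nonneg_exp_def zero_prod_def)

text \<open>Laurent polynomials in the third variable alone.\<close>

definition only3 :: "(exp3 \<Rightarrow>\<^sub>0 complex) \<Rightarrow> bool"
  where "only3 p \<longleftrightarrow> (\<forall>d\<in>Poly_Mapping.keys p. slot1 d = 0 \<and> slot2 d = 0)"

lemma only3_mult: "only3 p \<Longrightarrow> only3 q \<Longrightarrow> only3 (p * q)"
proof -
  assume *: "only3 p" "only3 q"
  show ?thesis unfolding only3_def
  proof
    fix d assume "d \<in> Poly_Mapping.keys (p * q)"
    then obtain a b where "d = a + b" "a \<in> Poly_Mapping.keys p" "b \<in> Poly_Mapping.keys q"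
      using Poly_Mapping.keys_mult[of p q] by blast
    then show "slot1 d = 0 \<and> slot2 d = 0" using * by (simp add: only3_def slot_add)
  qed
qed

lemma only3_ev: "only3 (ev f Y3 Y3)"
proof (rule ev_closed)
  show "only3 p \<Longrightarrow> only3 q \<Longrightarrow> only3 (p + q)" for p q
    unfolding only3_def using Poly_Mapping.keys_add[of p q] by blast
  show "only3 p \<Longrightarrow> only3 q \<Longrightarrow> only3 (p * q)" for p q by (rule only3_mult)
qed (simp_all add: only3_def zero_prod_def)

context complex_vector_space
begin

text \<open>
  Quotients by a polynomial whose constant term is invertible have no more poles in \<open>x\<^sub>1, x\<^sub>2\<close>
  than the dividend: \<open>bad\<close> is a set of exponents closed under decreasing them.  The constant term
  \<open>G0\<close> of \<open>G\<close> is reached by reducing modulo \<open>x\<^sub>1\<close> and then modulo \<open>x\<^sub>2\<close>.  By induction on the bad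
  exponents in lexicographic order, the other terms of \<open>G\<close> contribute nothing to \<open>G F\<close> there, so
  that \<open>G0\<close> annihilates the coefficient.
\<close>

lemma division_no_poles:
  assumes G: "cong_mod Y1 G G1" "cong_mod Y2 G1 G0" and G0: "only3 G0" "G0 \<noteq> 0" and F: "F \<in> iter_laurent3"
    and bad: "\<And>p1 p2 i j. bad p1 p2 \<Longrightarrow> 0 \<le> i \<Longrightarrow> 0 \<le> j \<Longrightarrow> bad (p1 - i) (p2 - j)"
    and zero: "\<And>p1 p2 q. bad p1 p2 \<Longrightarrow> (G \<bullet> F) (p1, p2, q) = 0"
  shows "bad p1 p2 \<Longrightarrow> F (p1, p2, q) = 0"
proof -
  obtain R1 R2 where R: "nonneg12 R1" "nonneg12 R2" and "G = G1 + Y1 * R1" "G1 = G0 + Y2 * R2"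
    using G unfolding cong_mod_def by blast
  then have R3: "G = G0 + Y1 * R1 + Y2 * R2" by (simp add: ac_simps)
  have step: "\<forall>q. F (p1, p2, q) = 0"
    if b: "bad p1 p2" and IH1: "\<And>p1' p2' q. p1' < p1 \<Longrightarrow> bad p1' p2' \<Longrightarrow> F (p1', p2', q) = 0"
      and IH2: "\<And>p2' q. p2' < p2 \<Longrightarrow> bad p1 p2' \<Longrightarrow> F (p1, p2', q) = 0" for p1 p2
  proof -
    have 1: "((Y1 * R1) \<bullet> F) (p1, p2, q) = 0" for q
    proof -
      have "F ((p1 - 1, p2, q) - d) = 0" if d: "d \<in> Poly_Mapping.keys R1" for d
      proof -
        obtain d1 d2 d3 where dd: "d = (d1, d2, d3)" by (cases d)
        then have "0 \<le> d1" "0 \<le> d2" using R(1) d by (auto simp: nonneg_exp_def)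
        then have "bad (p1 - (1 + d1)) (p2 - d2)" by (intro bad b) auto
        then show ?thesis using IH1[of "p1 - (1 + d1)" "p2 - d2"] \<open>0 \<le> d1\<close> by (simp add: dd algebra_simps)
      qed
      then have "(R1 \<bullet> F) (p1 - 1, p2, q) = 0" by (simp add: act_eq)
      then show ?thesis by (simp add: act_mult del: act.scale_scale)
    qed
    have 2: "((Y2 * R2) \<bullet> F) (p1, p2, q) = 0" for q
    proof -
      have "F ((p1, p2 - 1, q) - d) = 0" if d: "d \<in> Poly_Mapping.keys R2" for d
      proof -
        obtain d1 d2 d3 where dd: "d = (d1, d2, d3)" by (cases d)
        then have *: "0 \<le> d1" "0 \<le> d2" using R(2) d by (auto simp: nonneg_exp_def)
        then have "bad (p1 - d1) (p2 - (1 + d2))" by (intro bad b) auto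
        then show ?thesis
          using IH1[of "p1 - d1" "p2 - (1 + d2)"] IH2[of "p2 - (1 + d2)"] *
          by (cases "d1 = 0") (simp_all add: dd algebra_simps)
      qed
      then have "(R2 \<bullet> F) (p1, p2 - 1, q) = 0" by (simp add: act_eq)
      then show ?thesis by (simp add: act_mult del: act.scale_scale)
    qed
    define F' where "F' = (\<lambda>(a, b, c). if a = p1 \<and> b = p2 then F (a, b, c) else 0)"
    have "(G0 \<bullet> F') (a, b, c) = 0" for a b c
    proof (cases "a = p1 \<and> b = p2")
      case True
      have "(G0 \<bullet> F') (a, b, c) = (G0 \<bullet> F) (a, b, c)"
        unfolding act_eq by (rule sum.cong) (use G0(1) True in \<open>auto simp: F'_def only3_def\<close>)
      also have "\<dots> = 0"
        using zero[OF b, of c] 1[of c] 2[of c] True by (simp add: R3 act_add_left)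
      finally show ?thesis .
    next
      case False
      have "F' ((a, b, c) - d) = 0" if "d \<in> Poly_Mapping.keys G0" for d
        using G0(1) that False by (cases d) (auto simp: only3_def F'_def)
      then show ?thesis by (simp add: act_eq)
    qed
    then have "G0 \<bullet> F' = 0" by (simp add: fun_eq_iff split_paired_All)
    moreover have "F' \<in> iter_laurent3"
      using F unfolding iter_laurent3_def F'_def by fastforce
    ultimately have "F' = 0" by (rule cancel_iter_laurent3[OF G0(2), rotated])
    then have "F' (p1, p2, q) = 0" for q by simp
    then show ?thesis by (simp add: F'_def)
  qed
  obtain N where N: "\<And>p q r. p < N \<Longrightarrow> F (p, q, r) = 0" using iter_laurent3D(1)[OF F] by blast
  have outer: "\<forall>p2 q. bad p1 p2 \<longrightarrow> F (p1, p2, q) = 0" for p1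
  proof (induction "nat (p1 - N)" arbitrary: p1 rule: less_induct)
    case less
    have IH1: "F (p1', p2', q) = 0" if "p1' < p1" "bad p1' p2'" for p1' p2' q
      using less[of p1'] that N[of p1'] by (cases "p1' < N") auto
    obtain M where M: "\<And>q r. q < M \<Longrightarrow> F (p1, q, r) = 0" using iter_laurent3D(2)[OF F] by blast
    have "bad p1 p2 \<longrightarrow> (\<forall>q. F (p1, p2, q) = 0)" for p2
    proof (induction "nat (p2 - M)" arbitrary: p2 rule: less_induct)
      case less
      have "F (p1, p2', q) = 0" if "p2' < p2" "bad p1 p2'" for p2' q
        using less[of p2'] that M[of p2'] by (cases "p2' < M") auto
      then show ?case using step[of p1 p2] IH1 by blast
    qed
    then show ?case by blast
  qed
  then show "bad p1 p2 \<Longrightarrow> F (p1, p2, q) = 0" by blast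
qed

end

section \<open>Polynomials in polynomials\<close>

text \<open>Constants as polynomials in two variables; they allow substituting polynomials into polynomials.\<close>

abbreviation const_poly2 :: "complex \<Rightarrow> complex poly poly"
  where "const_poly2 c \<equiv> [:[:c:]:]"

lemma ev_const_poly2 [simp]: "ev (const_poly2 c) s t = cnst c"
  and ev_outer [simp]: "ev [:0, 1:] s t = s"
  and ev_inner [simp]: "ev [:[:0, 1:]:] s t = t"
  by (simp_all add: eval2_def map_poly_pCons)

lemma ev_subst: "ev (eval2 const_poly2 f p q) s t = ev f (ev p s t) (ev q s t)"
proof -
  have 1: "ev (poly (map_poly const_poly2 g) q) s t = poly (map_poly cnst g) (ev q s t)" for g
    by (induction g) (simp_all add: map_poly_pCons ev_add ev_mult)
  show ?thesis
    by (induction f) (simp_all add: eval2_pCons[of const_poly2] ev_pCons ev_add ev_mult 1)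
qed

text \<open>\<open>f(x\<^sub>2, x\<^sub>1)\<close>\<close>

definition swap_poly :: "complex poly poly \<Rightarrow> complex poly poly"
  where "swap_poly f = eval2 const_poly2 f [:[:0, 1:]:] [:0, 1:]"

lemma ev_swap_poly [simp]: "ev (swap_poly f) s t = ev f t s"
  by (simp add: swap_poly_def ev_subst)

lemma swap_poly_nonzero: "f \<noteq> 0 \<Longrightarrow> swap_poly f \<noteq> 0"
  by (metis ev_swap_nonzero ev_swap_poly eval2_0)

text \<open>Splitting off the highest power of \<open>x\<^sub>1 - x\<^sub>2\<close>.\<close>

lemma split_diagonal:
  assumes "f \<noteq> 0"
  obtains k g where "poly g [:0, 1:] \<noteq> 0" "\<And>s t :: 'e::ab_group_add \<Rightarrow>\<^sub>0 complex. ev f s t = (s - t) ^ k * ev g s t"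
proof -
  obtain g where g: "f = [:- [:0, 1:], 1:] ^ order [:0, 1:] f * g" "\<not> [:- [:0, 1:], 1:] dvd g"
    using order_decomp[OF assms] by blast
  have "ev [:- [:0, 1:], 1:] s t = s - t" for s t :: "'e \<Rightarrow>\<^sub>0 complex"
    by (simp add: eval2_def map_poly_pCons single_uminus)
  then have "ev f s t = (s - t) ^ order [:0, 1:] f * ev g s t" for s t :: "'e \<Rightarrow>\<^sub>0 complex"
    by (subst g(1)) (simp add: ev_mult ev_power)
  moreover have "poly g [:0, 1:] \<noteq> 0" using g(2) by (simp add: poly_eq_0_iff_dvd)
  ultimately show thesis using that by blast
qed


section \<open>Compositions of substitutions\<close>

text \<open>\<open>W((y\<^sub>1, y\<^sub>2, x))\<close>\<close>

definition laurent3 :: "(exp3 \<Rightarrow> 'w::zero) set"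
  where "laurent3 = {A. \<exists>N. \<forall>p q r. p < N \<or> q < N \<or> r < N \<longrightarrow> A (p, q, r) = 0}"

context complex_vector_space
begin

text \<open>A double sum supported in a finite rectangle, as an ordinary sum over it.\<close>

lemma Sum_any_double:
  fixes B :: "'i \<Rightarrow> 'j \<Rightarrow> 'w"
  assumes "finite I" "finite J" "\<And>i j. i \<notin> I \<or> j \<notin> J \<Longrightarrow> B i j = 0"
  shows "(\<Sum>i. scale (x i) (\<Sum>j. scale (y i j) (B i j))) = (\<Sum>i\<in>I. \<Sum>j\<in>J. scale (x i * y i j) (B i j))"
proof -
  have 1: "(\<Sum>j. scale (y i j) (B i j)) = (\<Sum>j\<in>J. scale (y i j) (B i j))" for i
    by (rule Sum_any.expand_superset[OF assms(2)]) (use assms(3) in auto)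
  have "(\<Sum>i. scale (x i) (\<Sum>j\<in>J. scale (y i j) (B i j))) = (\<Sum>i\<in>I. scale (x i) (\<Sum>j\<in>J. scale (y i j) (B i j)))"
  proof (rule Sum_any.expand_superset[OF assms(1)], rule subsetI, rule ccontr)
    fix i assume i: "i \<in> {i. scale (x i) (\<Sum>j\<in>J. scale (y i j) (B i j)) \<noteq> 0}" "i \<notin> I"
    then have "(\<Sum>j\<in>J. scale (y i j) (B i j)) = 0" by (simp add: assms(3))
    then show False using i by simp
  qed
  then show ?thesis unfolding 1 by (simp add: scale_sum_right)
qed

lemma S12_eq: "S12 A (p, q, r) = (\<Sum>j. scale (zchoose (p + j) p) (A (p + j, q - j, r)))"
  and S13_eq: "S13 A (p, q, r) = (\<Sum>j. scale (zchoose (p + j) p) (A (p + j, q, r - j)))"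
  and S23_eq: "S23 A (p, q, r) = (\<Sum>j. scale (zchoose (q + j) q) (A (p, q + j, r - j)))"
  by (simp_all add: expand_shift_def)

lemma S13_S23_commute:
  assumes "H \<in> laurent3" shows "S13 (S23 H) = S23 (S13 H)"
proof -
  obtain N where N: "\<And>p q r. p < N \<or> q < N \<or> r < N \<Longrightarrow> H (p, q, r) = 0" using assms unfolding laurent3_def by blast
  have "S13 (S23 H) (p, q, r) = S23 (S13 H) (p, q, r)" for p q r
  proof -
    let ?I = "{N - p..r - N + q - N}" and ?J = "{N - q..r - N + p - N}"
    have z: "H (p + i, q + j, r - i - j) = 0" if "i \<notin> ?I \<or> j \<notin> ?J" for i j
      using that by (intro N) (auto simp: not_le)
    have e: "r - j - i = r - i - j" for i j by simp
    have "S13 (S23 H) (p, q, r) = (\<Sum>i. scale (zchoose (p + i) p) (\<Sum>j. scale (zchoose (q + j) q) (H (p + i, q + j, r - i - j))))"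
      by (simp only: S13_eq S23_eq)
    also have "\<dots> = (\<Sum>i\<in>?I. \<Sum>j\<in>?J. scale (zchoose (p + i) p * zchoose (q + j) q) (H (p + i, q + j, r - i - j)))"
      by (rule Sum_any_double) (simp_all add: z del: atLeastAtMost_iff)
    also have "\<dots> = (\<Sum>j\<in>?J. \<Sum>i\<in>?I. scale (zchoose (q + j) q * zchoose (p + i) p) (H (p + i, q + j, r - i - j)))"
      by (subst sum.swap) (simp only: mult.commute)
    also have "\<dots> = (\<Sum>j. scale (zchoose (q + j) q) (\<Sum>i. scale (zchoose (p + i) p) (H (p + i, q + j, r - i - j))))"
      by (rule Sum_any_double[symmetric]) (auto simp: z simp del: atLeastAtMost_iff)
    also have "\<dots> = S23 (S13 H) (p, q, r)" by (simp only: S13_eq S23_eq e)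
    finally show ?thesis .
  qed
  then show ?thesis by (simp add: fun_eq_iff split_paired_All)
qed

text \<open>
  Substituting \<open>y\<^sub>1 = y\<^sub>2 + x\<^sub>0\<close>, then \<open>y\<^sub>2 = x + x\<^sub>2\<close>, is the same as substituting
  \<open>y\<^sub>1 = x + x\<^sub>1\<close>, \<open>y\<^sub>2 = x + x\<^sub>2\<close>, then \<open>x\<^sub>1 = x\<^sub>2 + x\<^sub>0\<close>.
\<close>

lemma S23_S12:
  assumes "H \<in> laurent3" shows "S23 (S12 H) = S12 (S13 (S23 H))"
proof -
  obtain N where N: "\<And>p q r. p < N \<or> q < N \<or> r < N \<Longrightarrow> H (p, q, r) = 0" using assms unfolding laurent3_def by blast
  have "S23 (S12 H) (p, j, q) = S12 (S13 (S23 H)) (p, j, q)" for p j q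
  proof -
    let ?I = "{N - p..j + q - N - N}" and ?K = "{N + N - p - j..q - N}"
    let ?H = "\<lambda>i k. H (p + i, j + k - i, q - k)"
    let ?z = zchoose
    have z: "?H i k = 0" if "i \<notin> ?I \<or> k \<notin> ?K" for i k
      using that by (intro N) (auto simp: not_le)
    have "S23 (S12 H) (p, j, q) = (\<Sum>k. scale (?z (j + k) j) (\<Sum>i. scale (?z (p + i) p) (?H i k)))"
      by (simp only: S23_eq S12_eq)
    also have "\<dots> = (\<Sum>k\<in>?K. \<Sum>i\<in>?I. scale (?z (j + k) j * ?z (p + i) p) (?H i k))"
      by (rule Sum_any_double) (auto simp: z simp del: atLeastAtMost_iff)
    finally have lhs: "S23 (S12 H) (p, j, q) = (\<Sum>k\<in>?K. \<Sum>i\<in>?I. scale (?z (j + k) j * ?z (p + i) p) (?H i k))" .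
    have G: "S13 (S23 H) (p + t, j - t, q) =
        (\<Sum>i\<in>?I. \<Sum>k\<in>?K. scale (?z (p + i) (p + t) * ?z (j + k - i) (j - t)) (?H i k))" for t
    proof -
      have "S13 (S23 H) (p + t, j - t, q) = (\<Sum>i. scale (?z (p + t + (i - t)) (p + t))
          (\<Sum>s. scale (?z (j - t + s) (j - t)) (H (p + t + (i - t), j - t + s, q - (i - t) - s))))"
        unfolding S13_eq S23_eq by (rule Sum_any_int_shift)
      also have "\<dots> = (\<Sum>i. scale (?z (p + t + (i - t)) (p + t))
          (\<Sum>k. scale (?z (j - t + (k - (i - t))) (j - t)) (H (p + t + (i - t), j - t + (k - (i - t)), q - (i - t) - (k - (i - t))))))"
        by (rule Sum_any.cong, rule arg_cong[of _ _ "scale _"], rule Sum_any_int_shift)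
      also have "\<dots> = (\<Sum>i. scale (?z (p + i) (p + t)) (\<Sum>k. scale (?z (j + k - i) (j - t)) (?H i k)))"
      proof -
        have "p + t + (i - t) = p + i" "j - t + (k - (i - t)) = j + k - i" "q - (i - t) - (k - (i - t)) = q - k" for i k
          by simp_all
        then show ?thesis by (simp only:)
      qed
      also have "\<dots> = (\<Sum>i\<in>?I. \<Sum>k\<in>?K. scale (?z (p + i) (p + t) * ?z (j + k - i) (j - t)) (?H i k))"
        by (rule Sum_any_double) (auto simp: z simp del: atLeastAtMost_iff)
      finally show ?thesis .
    qed
    have "S12 (S13 (S23 H)) (p, j, q) = (\<Sum>t. scale (?z (p + t) p) (S13 (S23 H) (p + t, j - t, q)))"
      by (simp only: S12_eq)
    also have "\<dots> = (\<Sum>t\<in>{0..j}. scale (?z (p + t) p) (S13 (S23 H) (p + t, j - t, q)))"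
    proof (rule Sum_any.expand_superset)
      have "scale (?z (p + t) p) (S13 (S23 H) (p + t, j - t, q)) = 0" if t: "t \<notin> {0..j}" for t
      proof (cases "t < 0")
        case True
        then consider "p + t < 0" | "0 \<le> p + t" "p + t < p" by linarith
        then show ?thesis by cases (simp_all add: zchoose_eq_0 G)
      next
        case False
        then show ?thesis using t by (simp add: G)
      qed
      then show "{t. scale (?z (p + t) p) (S13 (S23 H) (p + t, j - t, q)) \<noteq> 0} \<subseteq> {0..j}" by blast
    qed simp
    also have "\<dots> = (\<Sum>i\<in>?I. \<Sum>k\<in>?K. scale (\<Sum>t\<in>{0..j}. ?z (p + t) p * (?z (p + i) (p + t) * ?z (j + k - i) (j - t))) (?H i k))"
      unfolding G scale_sum_right scale_scale scale_sum_left
      by (subst sum.swap, rule sum.cong[OF refl], rule sum.swap)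
    also have "\<dots> = (\<Sum>i\<in>?I. \<Sum>k\<in>?K. scale (?z (j + k) j * ?z (p + i) p) (?H i k))"
    proof -
      have "(\<Sum>t\<in>{0..j}. ?z (p + t) p * (?z (p + i) (p + t) * ?z (j + k - i) (j - t))) = ?z (j + k) j * ?z (p + i) p" for i k
      proof (cases "p < 0")
        case False
        have "(\<Sum>t\<in>{0..j}. ?z (p + t) p * (?z (p + i) (p + t) * ?z (j + k - i) (j - t))) =
            (\<Sum>t\<in>{0..j}. ?z (p + i) p * (?z i t * ?z (j + k - i) (j - t)))"
        proof (rule sum.cong)
          fix t assume "t \<in> {0..j}"
          then have "?z (p + t) p * ?z (p + i) (p + t) = ?z (p + i) p * ?z i t"
            using zchoose_trinomial[of p t "p + i"] False by simp
          then show "?z (p + t) p * (?z (p + i) (p + t) * ?z (j + k - i) (j - t)) =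
              ?z (p + i) p * (?z i t * ?z (j + k - i) (j - t))"
            by (simp only: mult.assoc[symmetric])
        qed simp
        also have "\<dots> = ?z (p + i) p * ?z (i + (j + k - i)) j"
          by (simp only: sum_distrib_left[symmetric] zchoose_vandermonde)
        also have "i + (j + k - i) = j + k" by simp
        also have "?z (p + i) p * ?z (j + k) j = ?z (j + k) j * ?z (p + i) p" by (rule mult.commute)
        finally show ?thesis .
      qed simp
      then show ?thesis by (intro sum.cong refl arg_cong2[of _ _ _ _ scale])
    qed
    finally have rhs: "S12 (S13 (S23 H)) (p, j, q) =
        (\<Sum>i\<in>?I. \<Sum>k\<in>?K. scale (?z (j + k) j * ?z (p + i) p) (?H i k))" .
    show ?thesis unfolding lhs rhs by (rule sum.swap)
  qed
  then show ?thesis by (simp add: fun_eq_iff split_paired_All)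
qed

lemma swap12_S13: "swap12 (S13 C) = S23 (swap12 C)"
  and swap12_S23: "swap12 (S23 C) = S13 (swap12 C)"
  by (auto simp: fun_eq_iff S13_eq S23_eq)

end

section \<open>Iterated Laurent series in three variables\<close>

lemma iter_laurent3I:
  assumes "\<And>p q r. p < N \<Longrightarrow> A (p, q, r) = 0" "\<And>p q r. q < M p \<Longrightarrow> A (p, q, r) = 0"
    "\<And>p q r. r < K p q \<Longrightarrow> A (p, q, r) = 0"
  shows "A \<in> iter_laurent3"
  using assms unfolding iter_laurent3_def by blast

lemma iter_laurent3E:
  assumes "A \<in> iter_laurent3"
  obtains N M K where "\<And>p q r. p < N \<Longrightarrow> A (p, q, r) = 0" "\<And>p q r. q < M p \<Longrightarrow> A (p, q, r) = 0"
    "\<And>p q r. r < K p q \<Longrightarrow> A (p, q, r) = 0"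
proof -
  obtain N where "\<And>p q r. p < N \<Longrightarrow> A (p, q, r) = 0" using iter_laurent3D(1)[OF assms] by blast
  moreover obtain M where "\<And>p q r. q < M p \<Longrightarrow> A (p, q, r) = 0" using iter_laurent3D(2)[OF assms] by metis
  moreover obtain K where "\<And>p q r. r < K p q \<Longrightarrow> A (p, q, r) = 0" using iter_laurent3D(3)[OF assms] by metis
  ultimately show thesis by (rule that)
qed

context complex_vector_space
begin

lemma iter_laurent3_add:
  fixes A B :: "exp3 \<Rightarrow> 'w"
  assumes "A \<in> iter_laurent3" "B \<in> iter_laurent3" shows "(\<lambda>e. A e + B e) \<in> iter_laurent3"
proof -
  obtain N M K where A: "\<And>p q r. p < N \<Longrightarrow> A (p, q, r) = 0" "\<And>p q r. q < M p \<Longrightarrow> A (p, q, r) = 0"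
      "\<And>p q r. r < K p q \<Longrightarrow> A (p, q, r) = 0"
    using assms(1) by (rule iter_laurent3E) auto
  obtain N' M' K' where B: "\<And>p q r. p < N' \<Longrightarrow> B (p, q, r) = 0" "\<And>p q r. q < M' p \<Longrightarrow> B (p, q, r) = 0"
      "\<And>p q r. r < K' p q \<Longrightarrow> B (p, q, r) = 0"
    using assms(2) by (rule iter_laurent3E) auto
  show ?thesis
    by (rule iter_laurent3I[of "min N N'" _ "\<lambda>p. min (M p) (M' p)" "\<lambda>p q. min (K p q) (K' p q)"]) (auto simp: A B)
qed

lemma iter_laurent3_act:
  fixes A :: "exp3 \<Rightarrow> 'w"
  assumes "A \<in> iter_laurent3" shows "x \<bullet> A \<in> iter_laurent3"
proof (rule act_closed[OF _ _ _ assms])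
  show "(0 :: exp3 \<Rightarrow> 'w) \<in> iter_laurent3" by (simp add: iter_laurent3_def)
  fix A :: "exp3 \<Rightarrow> 'w" and c and d :: exp3 assume "A \<in> iter_laurent3"
  then obtain N M K where A: "\<And>p q r. p < N \<Longrightarrow> A (p, q, r) = 0" "\<And>p q r. q < M p \<Longrightarrow> A (p, q, r) = 0"
      "\<And>p q r. r < K p q \<Longrightarrow> A (p, q, r) = 0"
    by (rule iter_laurent3E) auto
  obtain i j k where d: "d = (i, j, k)" by (cases d)
  show "(\<lambda>e. scale c (A (e - d))) \<in> iter_laurent3"
    by (rule iter_laurent3I[of "N + i" _ "\<lambda>p. M (p - i) + j" "\<lambda>p q. K (p - i) (q - j) + k"]) (simp_all add: d A)
qed (rule iter_laurent3_add)

lemma iter_laurent3_diff: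
  fixes A B :: "exp3 \<Rightarrow> 'w"
  assumes "A \<in> iter_laurent3" "B \<in> iter_laurent3" shows "A - B \<in> iter_laurent3"
  using iter_laurent3_add[OF assms(1) iter_laurent3_act[OF assms(2), of "cnst (-1)"]]
  by (simp add: fun_diff_def)

lemma cancel3:
  assumes "p \<noteq> 0" "A \<in> iter_laurent3" "B \<in> iter_laurent3" "p \<bullet> A = p \<bullet> B" shows "A = B"
proof -
  have "p \<bullet> (A - B) = 0" by (simp add: act.scale_right_diff_distrib assms(4))
  then have "A - B = 0" by (rule cancel_iter_laurent3[OF assms(1) iter_laurent3_diff[OF assms(2,3)]])
  then show ?thesis by simp
qed

lemma bounded_along_act:
  assumes \<pi>: "\<And>a b. \<pi> (a - b) = \<pi> a - \<pi> b" and "A \<in> bounded_along \<pi>"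
  shows "p \<bullet> A \<in> bounded_along \<pi>"
proof (rule act_closed[OF _ _ _ assms(2)])
  show "0 \<in> bounded_along \<pi>" by (simp add: bounded_along_def)
  show "(\<lambda>e. A e + B e) \<in> bounded_along \<pi>" if "A \<in> bounded_along \<pi>" "B \<in> bounded_along \<pi>" for A B
    by (rule bounded_along_closed(1)[OF \<pi> that])
  show "(\<lambda>e. scale c (A (e - d))) \<in> bounded_along \<pi>" if "A \<in> bounded_along \<pi>" for A c d
    by (rule bounded_along_closed(2)[OF \<pi> bounded_along_closed(3)[OF \<pi> that]])
qed

lemma laurent2_iff: "A \<in> laurent2 \<longleftrightarrow> A \<in> bounded_along fst \<and> A \<in> bounded_along snd"
proof
  assume "A \<in> bounded_along fst \<and> A \<in> bounded_along snd"
  then obtain N M where "\<And>e. fst e < N \<Longrightarrow> A e = 0" "\<And>e. snd e < M \<Longrightarrow> A e = 0"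
    unfolding bounded_along_def by blast
  then show "A \<in> laurent2" unfolding laurent2_def by (auto intro!: exI[of _ "min N M"])
qed (auto simp: laurent2_def bounded_along_def)

lemma laurent3I:
  assumes "A \<in> bounded_along slot1" "A \<in> bounded_along slot2" "A \<in> bounded_along (\<lambda>e. snd (snd e))"
  shows "A \<in> laurent3"
proof -
  obtain N1 where "\<And>p q r. p < N1 \<Longrightarrow> A (p, q, r) = 0" using assms(1) unfolding bounded_along_def by auto
  moreover obtain N2 where "\<And>p q r. q < N2 \<Longrightarrow> A (p, q, r) = 0" using assms(2) unfolding bounded_along_def by auto
  moreover obtain N3 where "\<And>p q r. r < N3 \<Longrightarrow> A (p, q, r) = 0" using assms(3) unfolding bounded_along_def by auto
  ultimately show ?thesis unfolding laurent3_def by (auto intro!: exI[of _ "min N1 (min N2 N3)"])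
qed

lemma op_prod_bounded: "a \<in> E_space scale \<Longrightarrow> op_prod a b w \<in> bounded_along snd"
  unfolding bounded_along_def
  by (auto simp: op_prod_def E_space_nth intro!: exI[of _ "fls_subdegree (b w)"])

lemma op_prod_rev_bounded: "b \<in> E_space scale \<Longrightarrow> op_prod_rev a b w \<in> bounded_along fst"
  unfolding bounded_along_def
  by (auto simp: op_prod_rev_def E_space_nth intro!: exI[of _ "fls_subdegree (a w)"])

text \<open>The product \<open>a(x\<^sub>1) b(x\<^sub>2) w\<close> has finitely many negative powers of \<open>x\<^sub>2\<close>, the reversed one of \<open>x\<^sub>1\<close>.\<close>

lemma compat_of_quasi_local:
  assumes "a \<in> E_space scale" "b \<in> E_space scale" "f \<noteq> 0"
    and "\<And>w. poly12 f \<bullet> op_prod a b w = poly12 f \<bullet> op_prod_rev a b w"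
  shows "compat a b f"
proof -
  have "poly12 f \<bullet> op_prod a b w \<in> bounded_along snd" for w
    by (rule bounded_along_act[OF slot_diff(2) op_prod_bounded[OF assms(1)]])
  moreover have "poly12 f \<bullet> op_prod a b w \<in> bounded_along fst" for w
    unfolding assms(4) by (rule bounded_along_act[OF slot_diff(1) op_prod_rev_bounded[OF assms(2)]])
  ultimately show ?thesis using assms(3) by (simp add: compat_iff laurent2_iff)
qed

lemma yprod_zero:
  assumes "\<alpha> \<noteq> 0" "\<And>w. op_prod a b w = 0"
  shows "yprod \<alpha> a b w = 0" "compat a b 1"
proof -
  show c: "compat a b 1" using assms(2) by (simp add: compat_iff laurent2_def)
  show "yprod \<alpha> a b w = 0"
    by (rule yprod_eqI[OF c assms(1)]) (simp_all add: iter_laurent2_def assms(2) expand_shift_def fun_eq_iff)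
qed

end

section \<open>Three quasi local fields\<close>

context complex_vector_space
begin

text \<open>\<open>a(y\<^sub>1)\<close> applied to a series in two further variables.\<close>

definition apply1 :: "('w \<Rightarrow> 'w fls) \<Rightarrow> (exp2 \<Rightarrow> 'w) \<Rightarrow> exp3 \<Rightarrow> 'w"
  where "apply1 a C = (\<lambda>(m, k, q). fls_nth (a (C (k, q))) m)"

lemma apply1_apply [simp]: "apply1 a C (m, k, q) = fls_nth (a (C (k, q))) m"
  by (simp add: apply1_def)

text \<open>\<open>a(y\<^sub>1) b(y\<^sub>2) c(x) w\<close>\<close>

abbreviation triple where "triple a b c w \<equiv> apply1 a (op_prod b c w)"

lemma linear_apply1:
  assumes "a \<in> E_space scale" shows "linear_series_map scale scale UNIV (apply1 a)"
  by unfold_locales (auto simp: fun_eq_iff E_space_nth[OF assms])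

lemma rel_apply1:
  assumes "a \<in> E_space scale"
  shows "carries UNIV (apply1 a) (mon (1, 0)) Y2"
    "carries UNIV (apply1 a) (mon (0, 1)) Y3"
proof -
  interpret L: linear_series_map scale scale UNIV "apply1 a" by (rule linear_apply1[OF assms])
  show "L.rel (mon (1, 0)) Y2" "L.rel (mon (0, 1)) Y3"
    by (rule L.rel_mon; simp add: fun_eq_iff split_paired_All)+
qed

lemma apply1_poly:
  assumes "a \<in> E_space scale" shows "ev f Y2 Y3 \<bullet> apply1 a C = apply1 a (poly12 f \<bullet> C)"
proof -
  interpret L: linear_series_map scale scale UNIV "apply1 a" by (rule linear_apply1[OF assms])
  show ?thesis by (rule L.relD[OF L.rel_ev[OF rel_apply1[OF assms]], symmetric]) simp
qed

text \<open>Operators commute with substitutions in the series to which they are applied.\<close>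

lemma apply1_subst2:
  assumes a: "a \<in> E_space scale" and C: "C \<in> laurent2"
  shows "apply1 a (subst2 1 C) = S23 (apply1 a C)"
proof -
  have "fls_nth (a (subst2 1 C (k, q))) m = S23 (apply1 a C) (m, k, q)" for m k q
  proof -
    have fin: "finite {j. scale (zchoose (k + j) k) (C (k + j, q - j)) \<noteq> 0}"
      using finite_alongD[of C dir2 "(k, q)"] C laurent2_finite_along
      by (intro finite_support_scale) auto
    have "subst2 1 C (k, q) = (\<Sum>j. scale (zchoose (k + j) k) (C (k + j, q - j)))"
      by (simp add: expand_shift_def)
    also have "fls_nth (a \<dots>) m = (\<Sum>j. fls_nth (a (scale (zchoose (k + j) k) (C (k + j, q - j)))) m)"
      by (rule Sum_any_additive[OF _ _ fin]) (simp_all add: E_space_nth[OF a])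
    also have "\<dots> = S23 (apply1 a C) (m, k, q)"
      by (simp add: S23_eq E_space_nth[OF a])
    finally show ?thesis .
  qed
  then show ?thesis by (simp add: fun_eq_iff split_paired_All)
qed

lemma apply1_bounded:
  assumes "a \<in> E_space scale"
  shows "C \<in> bounded_along fst \<Longrightarrow> apply1 a C \<in> bounded_along slot2"
    "C \<in> bounded_along snd \<Longrightarrow> apply1 a C \<in> bounded_along (\<lambda>e. snd (snd e))"
proof -
  have "apply1 a C \<in> bounded_along (\<lambda>e. \<pi> (snd e))" if C: "C \<in> bounded_along \<pi>" for \<pi> :: "exp2 \<Rightarrow> int"
  proof -
    obtain N where "\<forall>e. \<pi> e < N \<longrightarrow> C e = 0" using C unfolding bounded_along_def by blast
    then have "\<forall>e. \<pi> (snd e) < N \<longrightarrow> apply1 a C e = 0" by (auto simp: E_space_nth[OF assms])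
    then show ?thesis unfolding bounded_along_def by blast
  qed
  from this[of fst] this[of snd] show "C \<in> bounded_along fst \<Longrightarrow> apply1 a C \<in> bounded_along slot2"
    "C \<in> bounded_along snd \<Longrightarrow> apply1 a C \<in> bounded_along (\<lambda>e. snd (snd e))"
    by (simp_all add: case_prod_unfold)
qed

lemma swap12_bounded: "C \<in> bounded_along slot2 \<Longrightarrow> swap12 C \<in> bounded_along slot1"
  unfolding bounded_along_def by force

lemma swap12_poly:
  "swap12 (ev f Y1 Y2 \<bullet> C) = ev f Y2 Y1 \<bullet> swap12 C" "swap12 (ev f Y1 Y3 \<bullet> C) = ev f Y2 Y3 \<bullet> swap12 C"
  "swap12 (ev f Y2 Y3 \<bullet> C) = ev f Y1 Y3 \<bullet> swap12 C"
proof -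
  interpret L: linear_series_map scale scale UNIV swap12 by (rule linear_swap12)
  show "swap12 (ev f Y1 Y2 \<bullet> C) = ev f Y2 Y1 \<bullet> swap12 C" "swap12 (ev f Y1 Y3 \<bullet> C) = ev f Y2 Y3 \<bullet> swap12 C"
    "swap12 (ev f Y2 Y3 \<bullet> C) = ev f Y1 Y3 \<bullet> swap12 C"
    by (rule L.relD[OF L.rel_ev]; simp add: rel_swap12)+
qed

lemma slice2_poly: "slice2 k (ev f Y1 Y3 \<bullet> C) = poly12 f \<bullet> slice2 k C"
proof -
  interpret L: linear_series_map scale scale UNIV "slice2 k" by (rule linear_slice2)
  show ?thesis by (rule L.relD[OF L.rel_ev[OF rel_slice2]]) simp
qed

lemma slice3_poly: "slice3 k (ev f Y1 Y2 \<bullet> C) = poly12 f \<bullet> slice3 k C"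
  and slice3_shift_poly: "slice3 k (ev f (Y1 + cnst \<alpha> * Y2) Y2 \<bullet> C) = shift_poly \<alpha> f \<bullet> slice3 k C"
proof -
  interpret L: linear_series_map scale scale UNIV "slice3 k" by (rule linear_slice3)
  show "slice3 k (ev f Y1 Y2 \<bullet> C) = poly12 f \<bullet> slice3 k C"
    by (rule L.relD[OF L.rel_ev[OF rel_slice3]]) simp
  show "slice3 k (ev f (Y1 + cnst \<alpha> * Y2) Y2 \<bullet> C) = shift_poly \<alpha> f \<bullet> slice3 k C"
    by (rule L.relD) (intro L.rel_ev L.rel_add L.rel_mult L.rel_cnst rel_slice3, simp)
qed

text \<open>
  The relation defining \<open>\<Y>\<^sub>\<alpha>(a(y\<^sub>2), x\<^sub>0) b(y\<^sub>2)\<close>, applied to the coefficients of \<open>c(x) w\<close>: in terms of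
  \<open>a(y\<^sub>1) b(y\<^sub>2) c(x) w\<close> it is the substitution \<open>y\<^sub>1 = \<alpha>y\<^sub>2 + x\<^sub>0\<close>.
\<close>

lemma triple_expand:
  assumes f: "compat a b f" and \<alpha>: "\<alpha> \<noteq> 0"
  shows "ev f Y1 Y2 \<bullet> triple a b c w \<in> finite_along dir12"
    and "ev f (Y1 + cnst \<alpha> * Y2) Y2 \<bullet> (\<lambda>(p, k, r). yprod \<alpha> a b (fls_nth (c w) r) (p, k)) =
      expand_shift scale \<alpha> slot1 dir12 (ev f Y1 Y2 \<bullet> triple a b c w)"
proof -
  have slice: "slice3 r (triple a b c w) = op_prod a b (fls_nth (c w) r)" for r
    by (auto simp: fun_eq_iff op_prod_def)
  have "finite {j. (ev f Y1 Y2 \<bullet> triple a b c w) ((p, k, r) + (j, - j, 0)) \<noteq> 0}" for p k r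
  proof -
    have "slice3 r (ev f Y1 Y2 \<bullet> triple a b c w) \<in> finite_along dir2"
      unfolding slice3_poly slice using f laurent2_finite_along by (auto simp: compat_iff)
    from finite_alongD[OF this, of "(p, k)"] show ?thesis by simp
  qed
  then show "ev f Y1 Y2 \<bullet> triple a b c w \<in> finite_along dir12"
    by (simp add: finite_along_def split_paired_All)
  show "ev f (Y1 + cnst \<alpha> * Y2) Y2 \<bullet> (\<lambda>(p, k, r). yprod \<alpha> a b (fls_nth (c w) r) (p, k)) =
      expand_shift scale \<alpha> slot1 dir12 (ev f Y1 Y2 \<bullet> triple a b c w)" (is "_ \<bullet> ?Z = _")
  proof (rule slice3_eqI)
    fix r
    have "slice3 r ?Z = yprod \<alpha> a b (fls_nth (c w) r)" by (auto simp: fun_eq_iff)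
    moreover have "slice3 r (expand_shift scale \<alpha> slot1 dir12 C) = subst2 \<alpha> (slice3 r C)" for C
      by (auto simp: fun_eq_iff expand_shift_def)
    ultimately show "slice3 r (ev f (Y1 + cnst \<alpha> * Y2) Y2 \<bullet> ?Z) =
        slice3 r (expand_shift scale \<alpha> slot1 dir12 (ev f Y1 Y2 \<bullet> triple a b c w))"
      by (simp only: slice3_shift_poly slice3_poly slice yprod_char[OF f \<alpha>])
  qed
qed

text \<open>A family of products that vanish for small \<open>k\<close> lies in \<open>W((x))((x\<^sub>1))((y))\<close>, where \<open>y\<close> records \<open>k\<close>.\<close>

lemma family_yprod_trunc:
  fixes a b :: "int \<Rightarrow> 'w \<Rightarrow> 'w fls"
  assumes compat: "\<And>k. \<exists>f. compat (a k) (b k) f" and zero: "\<And>k w'. k < N \<Longrightarrow> op_prod (a k) (b k) w' = 0"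
  shows "(\<lambda>(k, p, q). yprod 1 (a k) (b k) w (p, q)) \<in> iter_laurent3"
proof -
  have it: "yprod 1 (a k) (b k) w \<in> iter_laurent2" for k
    using compat[of k] yprod_iter_laurent2(1) one_neq_zero by blast
  obtain M where M: "\<And>k p q. p < M k \<Longrightarrow> yprod 1 (a k) (b k) w (p, q) = 0"
    using iter_laurent2D(1)[OF it] by metis
  obtain K where K: "\<And>k p q. q < K k p \<Longrightarrow> yprod 1 (a k) (b k) w (p, q) = 0"
    using iter_laurent2D(2)[OF it] by metis
  have "yprod 1 (a k) (b k) w = 0" if "k < N" for k
    by (rule yprod_zero(1)[OF one_neq_zero zero[OF that]])
  then show ?thesis by (intro iter_laurent3I[of N _ M K]) (simp_all add: M K)
qed

text \<open>The coefficients of \<open>\<Y>(a, x\<^sub>0) b\<close>.\<close>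

abbreviation ycoeff :: "('w \<Rightarrow> 'w fls) \<Rightarrow> ('w \<Rightarrow> 'w fls) \<Rightarrow> int \<Rightarrow> 'w \<Rightarrow> 'w fls"
  where "ycoeff a b k \<equiv> fls_nth (Y_alpha scale 1 a b) k"

end

text \<open>
  Three pairwise quasi local elements of \<open>\<E>(W)\<close>, with polynomials that express it, such that
  the products occurring in the Jacobi identity are defined.
\<close>

locale quasi_local_triple = complex_vector_space scale
  for scale :: "complex \<Rightarrow> 'w::ab_group_add \<Rightarrow> 'w" +
  fixes u v c :: "'w \<Rightarrow> 'w fls" and fuv fuc fvc :: "complex poly poly"
  assumes in_E: "u \<in> E_space scale" "v \<in> E_space scale" "c \<in> E_space scale"
    and nonzero: "fuv \<noteq> 0" "fuc \<noteq> 0" "fvc \<noteq> 0"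
    and ql_uv: "poly12 fuv \<bullet> op_prod u v w = poly12 fuv \<bullet> op_prod_rev u v w"
    and ql_uc: "poly12 fuc \<bullet> op_prod u c w = poly12 fuc \<bullet> op_prod_rev u c w"
    and ql_vc: "poly12 fvc \<bullet> op_prod v c w = poly12 fvc \<bullet> op_prod_rev v c w"
    and compat_iter: "\<exists>f. compat u (ycoeff v c k) f" "\<exists>f. compat v (ycoeff u c k) f"
      "\<exists>f. compat (ycoeff u v k) c f" "\<exists>f. compat (ycoeff v u k) c f"
begin

lemma compats: "compat u v fuv" "compat u c fuc" "compat v c fvc"
  by (rule compat_of_quasi_local; simp add: in_E nonzero ql_uv ql_uc ql_vc)+

text \<open>
  All expansions come from the single series \<open>H\<close>, which has finite order of pole in each variable.
\<close>

definition H :: "'w \<Rightarrow> exp3 \<Rightarrow> 'w"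
  where "H w = (ev fuv Y1 Y2 * (ev fuc Y1 Y3 * ev fvc Y2 Y3)) \<bullet> triple u v c w"

lemma triple_uv: "ev fuv Y1 Y2 \<bullet> triple u v c w = ev fuv Y1 Y2 \<bullet> swap12 (triple v u c w)"
proof (rule slice3_eqI)
  fix q
  have "slice3 q (triple u v c w) = op_prod u v (fls_nth (c w) q)"
    "slice3 q (swap12 (triple v u c w)) = op_prod_rev u v (fls_nth (c w) q)"
    by (auto simp: fun_eq_iff op_prod_def op_prod_rev_def)
  then show "slice3 q (ev fuv Y1 Y2 \<bullet> triple u v c w) = slice3 q (ev fuv Y1 Y2 \<bullet> swap12 (triple v u c w))"
    by (simp add: slice3_poly ql_uv)
qed

text \<open>
  The orders \<open>u v c\<close>, \<open>u c v\<close> and \<open>v c u\<close> bound the exponents of \<open>x\<close>, \<open>y\<^sub>2\<close> and \<open>y\<^sub>1\<close>, the variable of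
  the operator applied first.
\<close>

lemma H_laurent3: "H w \<in> laurent3"
proof (rule laurent3I)
  show "H w \<in> bounded_along (\<lambda>e. snd (snd e))"
    unfolding H_def
    by (intro bounded_along_act slot_diff apply1_bounded in_E op_prod_bounded)
  have "H w = (ev fuv Y1 Y2 * ev fuc Y1 Y3) \<bullet> apply1 u (poly12 fvc \<bullet> op_prod_rev v c w)"
    unfolding H_def mult.assoc[symmetric] act_mult[of _ "ev fvc Y2 Y3"] apply1_poly[OF in_E(1)] ql_vc ..
  also have "\<dots> \<in> bounded_along slot2"
    by (intro bounded_along_act slot_diff apply1_bounded in_E op_prod_rev_bounded)
  finally show "H w \<in> bounded_along slot2" .
  have "H w = (ev fuc Y1 Y3 * ev fvc Y2 Y3) \<bullet> (ev fuv Y1 Y2 \<bullet> triple u v c w)"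
    unfolding H_def act_mult[symmetric] by (simp only: ac_simps)
  also have "\<dots> = (ev fuv Y1 Y2 * ev fvc Y2 Y3) \<bullet> (ev fuc Y1 Y3 \<bullet> swap12 (triple v u c w))"
    unfolding triple_uv act_mult[symmetric] by (simp only: ac_simps)
  also have "ev fuc Y1 Y3 \<bullet> swap12 (triple v u c w) = swap12 (apply1 v (poly12 fuc \<bullet> op_prod_rev u c w))"
    unfolding swap12_poly(3)[symmetric] apply1_poly[OF in_E(2)] ql_uc ..
  finally have "H w = (ev fuv Y1 Y2 * ev fvc Y2 Y3) \<bullet> swap12 (apply1 v (poly12 fuc \<bullet> op_prod_rev u c w))" .
  also have "\<dots> \<in> bounded_along slot1"
    by (intro bounded_along_act slot_diff swap12_bounded apply1_bounded in_E op_prod_rev_bounded)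
  finally show "H w \<in> bounded_along slot1" .
qed

text \<open>
  \<open>\<Y>(u, x\<^sub>1) \<Y>(v, x\<^sub>2) c(x) w\<close> with exponents in the order \<open>(x\<^sub>1, x\<^sub>2, x)\<close>, and
  \<open>\<Y>(\<Y>(u, x\<^sub>0) v, x\<^sub>2) c(x) w\<close> with exponents in the order \<open>(x\<^sub>0, x\<^sub>2, x)\<close>.
\<close>

definition P1 :: "'w \<Rightarrow> exp3 \<Rightarrow> 'w"
  where "P1 w = (\<lambda>(p, k, q). yprod 1 u (ycoeff v c k) w (p, q))"

definition P3 :: "'w \<Rightarrow> exp3 \<Rightarrow> 'w"
  where "P3 w = (\<lambda>(p, k, q). yprod 1 (ycoeff u v p) c w (k, q))"

text \<open>
  \<open>f(x + x\<^sub>1, x + x\<^sub>2) f'(x + x\<^sub>1, x) f''(x + x\<^sub>2, x)\<close>, where \<open>f, f', f''\<close> are the polynomials of the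
  pairs \<open>(u, v), (u, c), (v, c)\<close>.
\<close>

definition R :: "exp3 \<Rightarrow>\<^sub>0 complex"
  where "R = ev fuv (Y1 + Y3) (Y2 + Y3) * (ev fuc (Y1 + Y3) Y3 * ev fvc (Y2 + Y3) Y3)"

lemma ycoeff_nth:
  "fls_nth (ycoeff v c k w) q = yprod 1 v c w (k, q)" "fls_nth (ycoeff u v k w) q = yprod 1 u v w (k, q)"
  by (simp_all add: Y_alpha_nth_nth[OF compats(3)] Y_alpha_nth_nth[OF compats(1)])

lemma S23_H_slice: "slice2 k (S23 (H w)) \<in> laurent2"
proof -
  obtain N where N: "\<And>p q r. p < N \<or> q < N \<or> r < N \<Longrightarrow> H w (p, q, r) = 0"
    using H_laurent3 unfolding laurent3_def by blast
  have "S23 (H w) (m, k, q) = 0" if "m < N \<or> q < N + N - k" for m q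
  proof -
    have "H w (m, k + j, q - j) = 0" for j using that by (intro N) linarith
    then show ?thesis by (simp add: S23_eq)
  qed
  then show ?thesis unfolding laurent2_def
    by (auto intro!: exI[of _ "min N (N + N - k)"])
qed

text \<open>
  Multiplied by \<open>R\<close>, the iterated product is \<open>H\<close> after \<open>y\<^sub>2 = x + x\<^sub>2\<close> and \<open>y\<^sub>1 = x + x\<^sub>1\<close>: the first
  substitution produces the coefficients of \<open>\<Y>(v, x\<^sub>2) c\<close>, and the second one their products with \<open>u\<close>.
\<close>

lemma P1_eq: "R \<bullet> P1 w = S13 (S23 (H w))"
proof -
  let ?A = "\<lambda>(m, k, q). op_prod u (ycoeff v c k) w (m, q)"
  let ?r = "ev fuv Y1 (Y2 + Y3) * (ev fuc Y1 Y3 * ev fvc (Y2 + Y3) Y3)"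
  interpret S1: linear_series_map scale scale "finite_along dir13" S13 by (rule linear_expand_shift)
  interpret S2: linear_series_map scale scale "finite_along dir23" S23 by (rule linear_expand_shift)
  interpret L: linear_series_map scale scale UNIV "apply1 u" by (rule linear_apply1[OF in_E(1)])
  have A: "?A = apply1 u (yprod 1 v c w)"
    by (auto simp: fun_eq_iff op_prod_def ycoeff_nth)
  have F: "poly12 fvc \<bullet> op_prod v c w \<in> laurent2" using compats(3) by (simp add: compat_iff)
  have fin: "ev fvc Y2 Y3 \<bullet> triple u v c w \<in> finite_along dir23"
  proof -
    have "finite {j. apply1 u (poly12 fvc \<bullet> op_prod v c w) ((m, k, q) + (0, j, - j)) \<noteq> 0}" for m k q
    proof -
      have "poly12 fvc \<bullet> op_prod v c w \<in> finite_along dir2" using F laurent2_finite_along by blast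
      from finite_alongD[OF this, of "(k, q)"] show ?thesis
        by (rule rev_finite_subset) (auto simp: E_space_nth[OF in_E(1)])
    qed
    then show ?thesis by (simp add: apply1_poly[OF in_E(1)] finite_along_def split_paired_All)
  qed
  have "ev fvc (Y2 + Y3) Y3 \<bullet> ?A = apply1 u (shift_poly 1 fvc \<bullet> yprod 1 v c w)"
  proof -
    have "L.rel (shift_poly 1 fvc) (ev fvc (Y2 + Y3) Y3)"
      unfolding single_one mult_1_left by (intro L.rel_ev L.rel_add rel_apply1 in_E)
    from L.relD[OF this] show ?thesis unfolding A by simp
  qed
  also have "\<dots> = S23 (ev fvc Y2 Y3 \<bullet> triple u v c w)"
    unfolding yprod_char[OF compats(3) one_neq_zero] apply1_subst2[OF in_E(1) F] apply1_poly[OF in_E(1)] ..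
  finally have 1: "ev fvc (Y2 + Y3) Y3 \<bullet> ?A = S23 (ev fvc Y2 Y3 \<bullet> triple u v c w)" .
  have 2: "S2.rel (ev fuv Y1 Y2 * ev fuc Y1 Y3) (ev fuv Y1 (Y2 + Y3) * ev fuc Y1 Y3)"
    by (intro S2.rel_mult S2.rel_ev rel_S23)
  have "?r \<bullet> ?A = (ev fuv Y1 (Y2 + Y3) * ev fuc Y1 Y3) \<bullet> S23 (ev fvc Y2 Y3 \<bullet> triple u v c w)"
    unfolding 1[symmetric] act_mult[symmetric] by (simp only: ac_simps)
  also have "\<dots> = S23 ((ev fuv Y1 Y2 * ev fuc Y1 Y3) \<bullet> (ev fvc Y2 Y3 \<bullet> triple u v c w))"
    by (rule S2.relD[OF 2 fin, symmetric])
  also have "\<dots> = S23 (H w)"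
    unfolding H_def act_mult[symmetric] by (simp only: ac_simps)
  finally have rA: "?r \<bullet> ?A = S23 (H w)" .
  have rel: "S1.rel ?r R"
    unfolding R_def by (intro S1.rel_mult S1.rel_ev S1.rel_add rel_S13)
  obtain N where N: "\<And>k. k < N \<Longrightarrow> ycoeff v c k = 0" using fls_eq0_below_subdegree by blast
  have "R \<bullet> P1 w = S13 (?r \<bullet> ?A)"
  proof (rule family_yprod[where N = N and a = "\<lambda>k. u" and b = "ycoeff v c" and w = w])
    show "op_prod u (ycoeff v c k) w' = 0" if "k < N" for k w'
      using N[OF that] by (auto simp: op_prod_def fun_eq_iff E_space_nth[OF in_E(1)])
    show "nonneg_exp slot2 ?r" "nonneg_exp slot2 R"
      unfolding R_def by (intro nonneg_exp_intros; simp)+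
    show "slice2 k (?r \<bullet> ?A) \<in> laurent2" for k unfolding rA by (rule S23_H_slice)
  qed (simp_all add: compat_iter P1_def rel)
  then show ?thesis unfolding rA .
qed

text \<open>
  Since the coefficients of \<open>\<Y>(v, x\<^sub>2) c\<close> vanish for small powers of \<open>x\<^sub>2\<close>, the iterated product lies in
  \<open>W((x))((x\<^sub>1))((x\<^sub>2))\<close>, with \<open>x\<^sub>2\<close> as the outermost variable.
\<close>

lemma P1_trunc: "swap12 (P1 w) \<in> iter_laurent3"
proof -
  have "op_prod u (ycoeff v c k) w' = 0" if "k < fls_subdegree (Y_alpha scale 1 v c)" for k w'
    using that by (auto simp: op_prod_def fun_eq_iff E_space_nth[OF in_E(1)])
  from family_yprod_trunc[of "\<lambda>k. u", OF compat_iter(1) this] show ?thesis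
    by (simp add: P1_def swap12_def)
qed

lemma P3_trunc: "P3 w \<in> iter_laurent3"
proof -
  have "op_prod (ycoeff u v k) c w' = 0" if "k < fls_subdegree (Y_alpha scale 1 u v)" for k w'
    using that by (auto simp: op_prod_def fun_eq_iff)
  from family_yprod_trunc[of "ycoeff u v" "\<lambda>k. c", OF compat_iter(3) this] show ?thesis
    by (simp add: P3_def)
qed

text \<open>
  Here \<open>y\<^sub>1 = y\<^sub>2 + x\<^sub>0\<close> produces the coefficients of \<open>\<Y>(u, x\<^sub>0) v\<close>, and \<open>y\<^sub>2 = x + x\<^sub>2\<close> their products with
  \<open>c\<close>; the composite is rewritten as the substitution of the previous lemmas followed by
  \<open>x\<^sub>1 = x\<^sub>2 + x\<^sub>0\<close>.
\<close>

lemma P3_eq: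
  "(ev fuv (Y1 + Y2 + Y3) (Y2 + Y3) * (ev fuc (Y1 + Y2 + Y3) Y3 * ev fvc (Y2 + Y3) Y3)) \<bullet> P3 w =
    S12 (S13 (S23 (H w)))"
proof -
  \<comment> \<open>The exponents of \<open>A\<close> are those of \<open>(y\<^sub>2, x\<^sub>0, x)\<close>, with the index \<open>k\<close> of the family in the second slot.\<close>
  let ?A = "\<lambda>(m, k, q). op_prod (ycoeff u v k) c w (m, q)"
  let ?r = "ev fuv (Y2 + Y1) Y1 * (ev fuc (Y2 + Y1) Y3 * ev fvc Y1 Y3)"
  let ?R = "ev fuv (Y2 + (Y1 + Y3)) (Y1 + Y3) * (ev fuc (Y2 + (Y1 + Y3)) Y3 * ev fvc (Y1 + Y3) Y3)"
  interpret S1: linear_series_map scale scale "finite_along dir13" S13 by (rule linear_expand_shift)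
  interpret S0: linear_series_map scale scale "finite_along dir12" S12 by (rule linear_expand_shift)
  interpret L: linear_series_map scale scale UNIV swap12 by (rule linear_swap12)
  note fin = triple_expand(1)[OF compats(1) one_neq_zero]
  have 1: "ev fuv (Y1 + Y2) Y2 \<bullet> swap12 ?A = S12 (ev fuv Y1 Y2 \<bullet> triple u v c w)"
  proof -
    have "swap12 ?A = (\<lambda>(p, k, r). yprod 1 u v (fls_nth (c w) r) (p, k))"
      by (auto simp: fun_eq_iff op_prod_def ycoeff_nth)
    then show ?thesis using triple_expand(2)[OF compats(1) one_neq_zero, of c w] by simp
  qed
  have 2: "S0.rel (ev fuc Y1 Y3 * ev fvc Y2 Y3) (ev fuc (Y1 + Y2) Y3 * ev fvc Y2 Y3)"
    by (intro S0.rel_mult S0.rel_ev rel_S12)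
  have "swap12 (?r \<bullet> ?A) = (ev fuv (Y1 + Y2) Y2 * (ev fuc (Y1 + Y2) Y3 * ev fvc Y2 Y3)) \<bullet> swap12 ?A"
    by (rule L.relD) (intro L.rel_mult L.rel_ev L.rel_add rel_swap12, simp)
  also have "\<dots> = (ev fuc (Y1 + Y2) Y3 * ev fvc Y2 Y3) \<bullet> S12 (ev fuv Y1 Y2 \<bullet> triple u v c w)"
    unfolding 1[symmetric] act_mult[symmetric] by (simp only: ac_simps)
  also have "\<dots> = S12 ((ev fuc Y1 Y3 * ev fvc Y2 Y3) \<bullet> (ev fuv Y1 Y2 \<bullet> triple u v c w))"
    by (rule S0.relD[OF 2 fin, symmetric])
  also have "\<dots> = S12 (H w)"
    unfolding H_def act_mult[symmetric] by (simp only: ac_simps)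
  finally have rA: "swap12 (?r \<bullet> ?A) = S12 (H w)" .
  from arg_cong[OF this, of swap12] have rA': "?r \<bullet> ?A = swap12 (S12 (H w))"
    by (simp only: swap12_swap12)
  have rel: "S1.rel ?r ?R"
    by (intro S1.rel_mult S1.rel_ev S1.rel_add rel_S13)
  obtain N where N: "\<And>k. k < N \<Longrightarrow> ycoeff u v k = 0" using fls_eq0_below_subdegree by blast
  have "?R \<bullet> swap12 (P3 w) = S13 (?r \<bullet> ?A)"
  proof (rule family_yprod[where N = N and a = "ycoeff u v" and b = "\<lambda>k. c" and w = w])
    show "op_prod (ycoeff u v k) c w' = 0" if "k < N" for k w'
      using N[OF that] by (auto simp: op_prod_def fun_eq_iff)
    show "nonneg_exp slot2 ?r" "nonneg_exp slot2 ?R"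
      by (intro nonneg_exp_intros; simp)+
    show "slice2 k (?r \<bullet> ?A) \<in> laurent2" for k
    proof -
      obtain N where N: "\<And>p q r. p < N \<or> q < N \<or> r < N \<Longrightarrow> H w (p, q, r) = 0"
        using H_laurent3 unfolding laurent3_def by blast
      have "S12 (H w) (k, m, q) = 0" if "m < N + N - k \<or> q < N" for m q
      proof -
        have "H w (k + j, m - j, q) = 0" for j using that by (intro N) linarith
        then show ?thesis by (simp add: S12_eq)
      qed
      then show ?thesis unfolding laurent2_def rA'
        by (auto intro!: exI[of _ "min N (N + N - k)"])
    qed
  qed (simp_all add: compat_iter P3_def rel fun_eq_iff)
  then have "swap12 (?R \<bullet> swap12 (P3 w)) = S23 (S12 (H w))"
    unfolding rA' by (simp add: swap12_S13)
  moreover have "swap12 (?R \<bullet> swap12 (P3 w)) =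
      (ev fuv (Y1 + (Y2 + Y3)) (Y2 + Y3) * (ev fuc (Y1 + (Y2 + Y3)) Y3 * ev fvc (Y2 + Y3) Y3)) \<bullet> swap12 (swap12 (P3 w))"
    by (rule L.relD) (intro L.rel_mult L.rel_ev L.rel_add rel_swap12, simp)
  ultimately show ?thesis
    by (simp add: S23_S12[OF H_laurent3] add.assoc)
qed

end

lemma mon_power: "Y1 ^ n = mon (int n, 0, 0)" "Y2 ^ n = mon (0, int n, 0)"
  by (induction n) (simp_all add: mult_single single_one[symmetric] zero_prod_def del: single_one)

context complex_vector_space
begin

text \<open>The interchange of two variables.\<close>

definition swap2 :: "(exp2 \<Rightarrow> 'w) \<Rightarrow> exp2 \<Rightarrow> 'w"
  where "swap2 C = (\<lambda>(m, n). C (n, m))"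

lemma swap2_poly: "swap2 (poly12 f \<bullet> C) = poly12 (swap_poly f) \<bullet> swap2 C"
proof -
  interpret L: linear_series_map scale scale UNIV swap2
    by unfold_locales (simp_all add: fun_eq_iff swap2_def)
  have "L.rel (mon (1, 0)) (mon (0, 1))" "L.rel (mon (0, 1)) (mon (1, 0))"
    by (rule L.rel_mon; simp add: fun_eq_iff swap2_def)+
  then have "L.rel (poly12 f) (poly12 (swap_poly f))" unfolding ev_swap_poly by (rule L.rel_ev)
  then show ?thesis by (rule L.relD) simp
qed

lemma quasi_local_swap:
  assumes "poly12 f \<bullet> op_prod a b w = poly12 f \<bullet> op_prod_rev a b w"
  shows "poly12 (swap_poly f) \<bullet> op_prod b a w = poly12 (swap_poly f) \<bullet> op_prod_rev b a w"
proof -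
  have "op_prod b a w = swap2 (op_prod_rev a b w)" "op_prod_rev b a w = swap2 (op_prod a b w)"
    by (simp_all add: fun_eq_iff swap2_def op_prod_def op_prod_rev_def)
  then show ?thesis by (simp only: swap2_poly[symmetric] assms)
qed

end

context quasi_local_triple
begin

lemma swapped: "quasi_local_triple scale v u c (swap_poly fuv) fvc fuc"
  by unfold_locales
    (simp_all only: in_E nonzero ql_uc ql_vc compat_iter swap_poly_nonzero not_False_eq_True
      quasi_local_swap[OF ql_uv])

text \<open>\<open>\<Y>(v, x\<^sub>2) \<Y>(u, x\<^sub>1) c(x) w\<close>, with exponents in the order \<open>(x\<^sub>1, x\<^sub>2, x)\<close>.\<close>

definition P2 :: "'w \<Rightarrow> exp3 \<Rightarrow> 'w"
  where "P2 w = (\<lambda>(k, p, q). yprod 1 v (ycoeff u c k) w (p, q))"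

lemma P2_swap: "P2 w = swap12 (quasi_local_triple.P1 scale v u c w)"
  by (simp add: P2_def quasi_local_triple.P1_def[OF swapped] fun_eq_iff)

lemma P2_trunc: "P2 w \<in> iter_laurent3"
  unfolding P2_swap by (rule quasi_local_triple.P1_trunc[OF swapped])

lemma P2_eq: "R \<bullet> P2 w = S13 (S23 (H w))"
proof -
  interpret sw: quasi_local_triple scale v u c "swap_poly fuv" fvc fuc by (rule swapped)
  interpret L: linear_series_map scale scale UNIV swap12 by (rule linear_swap12)
  have "swap12 (sw.R \<bullet> sw.P1 w) =
      (ev (swap_poly fuv) (Y2 + Y3) (Y1 + Y3) * (ev fvc (Y2 + Y3) Y3 * ev fuc (Y1 + Y3) Y3)) \<bullet> swap12 (sw.P1 w)"
    unfolding sw.R_def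
    by (rule L.relD) (intro L.rel_mult L.rel_ev L.rel_add rel_swap12, simp)
  also have "\<dots> = R \<bullet> P2 w"
    unfolding R_def P2_swap ev_swap_poly by (simp only: ac_simps)
  finally have 1: "R \<bullet> P2 w = swap12 (sw.R \<bullet> sw.P1 w)" by simp
  have "swap12 (sw.H w) =
      (ev (swap_poly fuv) Y2 Y1 * (ev fvc Y2 Y3 * ev fuc Y1 Y3)) \<bullet> swap12 (triple v u c w)"
    unfolding sw.H_def
    by (rule L.relD) (intro L.rel_mult L.rel_ev L.rel_add rel_swap12, simp)
  also have "\<dots> = (ev fuc Y1 Y3 * ev fvc Y2 Y3) \<bullet> (ev fuv Y1 Y2 \<bullet> swap12 (triple v u c w))"
    unfolding ev_swap_poly act_mult[symmetric] by (simp only: ac_simps)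
  also have "\<dots> = H w"
    unfolding triple_uv[symmetric] H_def act_mult[symmetric] by (simp only: ac_simps)
  finally have "swap12 (sw.H w) = H w" .
  then have "swap12 (S13 (S23 (sw.H w))) = S13 (S23 (H w))"
    by (simp only: swap12_S13 swap12_S23 S13_S23_commute[OF H_laurent3])
  then show ?thesis by (simp only: 1 sw.P1_eq)
qed

lemma substituted_H_zero: "p1 < 0 \<or> p2 < 0 \<Longrightarrow> S13 (S23 (H w)) (p1, p2, q) = 0"
  by (auto simp: S13_eq S23_eq)

text \<open>
  The three iterated products are expansions of one series with poles of bounded order, divided by
  a power of \<open>x\<^sub>1 - x\<^sub>2\<close>.
\<close>

theorem common_expansion:
  obtains k N where "\<And>w. (Y1 - Y2) ^ k \<bullet> P1 w = (Y1 - Y2) ^ k \<bullet> P2 w"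
    and "\<And>w p1 p2 q. p1 < N \<or> p2 < N \<Longrightarrow> ((Y1 - Y2) ^ k \<bullet> P1 w) (p1, p2, q) = 0"
    and "\<And>w. Y1 ^ k \<bullet> P3 w = S12 ((Y1 - Y2) ^ k \<bullet> P1 w)"
proof -
  obtain k g where g: "poly g [:0, 1:] \<noteq> 0" "\<And>s t :: exp3 \<Rightarrow>\<^sub>0 complex. ev fuv s t = (s - t) ^ k * ev g s t"
    using split_diagonal[OF nonzero(1), where 'e = exp3] by metis
  obtain k1 g1 where g1: "poly g1 [:0, 1:] \<noteq> 0" "\<And>s t :: exp3 \<Rightarrow>\<^sub>0 complex. ev fuc s t = (s - t) ^ k1 * ev g1 s t"
    using split_diagonal[OF nonzero(2), where 'e = exp3] by metis
  obtain k2 g2 where g2: "poly g2 [:0, 1:] \<noteq> 0" "\<And>s t :: exp3 \<Rightarrow>\<^sub>0 complex. ev fvc s t = (s - t) ^ k2 * ev g2 s t"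
    using split_diagonal[OF nonzero(3), where 'e = exp3] by metis
  interpret L: linear_series_map scale scale UNIV swap12 by (rule linear_swap12)
  interpret S: linear_series_map scale scale "finite_along dir12" S12 by (rule linear_expand_shift)
  \<comment> \<open>\<open>R = G Q\<close>, where \<open>G\<close> has the nonzero constant term \<open>G0\<close> as a polynomial in \<open>x\<^sub>1, x\<^sub>2\<close>, and \<open>Q\<close> is
    a product of powers of \<open>x\<^sub>1\<close>, \<open>x\<^sub>2\<close> and \<open>x\<^sub>1 - x\<^sub>2\<close>; \<open>Gs\<close> is \<open>G\<close> with \<open>x\<^sub>1, x\<^sub>2\<close> interchanged.\<close>
  define G where "G = ev g (Y1 + Y3) (Y2 + Y3) * (ev g1 (Y1 + Y3) Y3 * ev g2 (Y2 + Y3) Y3)"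
  define G' where "G' = ev g Y3 (Y2 + Y3) * (ev g1 Y3 Y3 * ev g2 (Y2 + Y3) Y3)"
  define Gs where "Gs = ev g (Y2 + Y3) (Y1 + Y3) * (ev g1 (Y2 + Y3) Y3 * ev g2 (Y1 + Y3) Y3)"
  define Gs' where "Gs' = ev g (Y2 + Y3) Y3 * (ev g1 (Y2 + Y3) Y3 * ev g2 Y3 Y3)"
  define G0 where "G0 = ev g Y3 Y3 * (ev g1 Y3 Y3 * ev g2 Y3 Y3)"
  have G: "cong_mod Y1 G G'" "cong_mod Y2 G' G0" and Gs: "cong_mod Y1 Gs Gs'" "cong_mod Y2 Gs' G0"
    unfolding G_def Gs_def G0_def G'_def Gs'_def
    by (intro cong_mod_mult cong_mod_ev cong_mod_self cong_mod_refl; simp add: nonneg12_variables nonneg_exp_add)+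
  have G0: "only3 G0" "G0 \<noteq> 0"
    unfolding G0_def
    by (intro only3_mult only3_ev, intro laurent_poly3_mult_nonzero ev_diagonal_nonzero g g1 g2)
  define Q where "Q = Y1 ^ k1 * (Y2 ^ k2 * (Y1 - Y2) ^ k)"
  have R: "R = G * Q"
    unfolding R_def G_def Q_def g(2) g1(2) g2(2)
    by (simp only: add_diff_cancel_right add_diff_cancel ac_simps)
  have GF: "G \<bullet> (Q \<bullet> P1 w) = S13 (S23 (H w))" "G \<bullet> (Q \<bullet> P2 w) = S13 (S23 (H w))" for w
    using P1_eq[of w] P2_eq[of w] by (simp_all only: R act_mult)
  \<comment> \<open>The first product has \<open>x\<^sub>2\<close> as the outermost variable, so that the division by \<open>G\<close> takes place with
    the two variables interchanged.\<close>
  have F1_trunc: "swap12 (Q \<bullet> P1 w) \<in> iter_laurent3" for w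
  proof -
    have "swap12 (Q \<bullet> P1 w) = (Y2 ^ k1 * (Y1 ^ k2 * (Y2 + cnst (-1) * Y1) ^ k)) \<bullet> swap12 (P1 w)"
      unfolding Q_def mon_diff_eq
      by (rule L.relD) (intro L.rel_mult L.rel_power L.rel_add L.rel_cnst rel_swap12, simp)
    then show ?thesis by (simp only: iter_laurent3_act[OF P1_trunc])
  qed
  have F1_zero: "(Q \<bullet> P1 w) (p1, p2, q) = 0" if "p1 < 0 \<or> p2 < 0" for w p1 p2 q
  proof -
    have "Gs \<bullet> swap12 (Q \<bullet> P1 w) = swap12 (G \<bullet> (Q \<bullet> P1 w))"
      unfolding Gs_def G_def
      by (rule L.relD[symmetric]) (intro L.rel_mult L.rel_ev L.rel_add rel_swap12, simp)
    then have "(Gs \<bullet> swap12 (Q \<bullet> P1 w)) (p2, p1, q) = 0" if "p1 < 0 \<or> p2 < 0" for p1 p2 q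
      using substituted_H_zero[OF that] by (simp only: GF swap12_apply)
    then have "swap12 (Q \<bullet> P1 w) (p2, p1, q) = 0"
      using that
      by (intro division_no_poles[OF Gs G0 F1_trunc, where bad = "\<lambda>a b. a < 0 \<or> b < 0"]) auto
    then show ?thesis by simp
  qed
  have F2_trunc: "Q \<bullet> P2 w \<in> iter_laurent3" for w by (rule iter_laurent3_act[OF P2_trunc])
  have F2_zero: "(Q \<bullet> P2 w) (p1, p2, q) = 0" if "p1 < 0 \<or> p2 < 0" for w p1 p2 q
    using that substituted_H_zero
    by (intro division_no_poles[OF G G0 F2_trunc, where bad = "\<lambda>a b. a < 0 \<or> b < 0"]) (auto simp only: GF)
  have F1_trunc': "Q \<bullet> P1 w \<in> iter_laurent3" for w
  proof -
    obtain K where "\<And>p q r. r < K p q \<Longrightarrow> swap12 (Q \<bullet> P1 w) (p, q, r) = 0"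
      using F1_trunc[of w] by (rule iter_laurent3E) auto
    then show ?thesis
      by (intro iter_laurent3I[of 0 _ "\<lambda>_. 0" "\<lambda>p q. K q p"]) (simp_all add: F1_zero)
  qed
  \<comment> \<open>Both are now in the same space, where the quotient by \<open>G\<close> is unique; \<open>x\<^sub>1\<close> and \<open>x\<^sub>2\<close> are invertible.\<close>
  have QP: "Q \<bullet> P1 w = Q \<bullet> P2 w" for w
  proof -
    have "G \<bullet> (Q \<bullet> P1 w - Q \<bullet> P2 w) = 0" by (simp only: act.scale_right_diff_distrib GF diff_self)
    then have "(Q \<bullet> P1 w - Q \<bullet> P2 w) (p1, p2, q) = 0" for p1 p2 q
      by (intro division_no_poles[OF G G0 iter_laurent3_diff[OF F1_trunc' F2_trunc], where bad = "\<lambda>a b. True"])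
        (simp_all del: minus_apply)
    then have "Q \<bullet> P1 w - Q \<bullet> P2 w = 0" by (simp add: fun_eq_iff split_paired_All)
    then show ?thesis by simp
  qed
  have F12: "(Y1 - Y2) ^ k \<bullet> P1 w = (Y1 - Y2) ^ k \<bullet> P2 w" for w
    using QP[of w] unfolding Q_def act_mult by (blast dest: act_mon_power_cancel)
  define F where "F w = (Y1 - Y2) ^ k \<bullet> P1 w" for w
  have FQ: "F w (p1, p2, q) = (Q \<bullet> P1 w) (p1 + int k1, p2 + int k2, q)" for w p1 p2 q
    unfolding Q_def act_mult mon_power F_def act_mon by simp
  define N where "N = - int k1 - int k2"
  have F_zero: "F w (p1, p2, q) = 0" if "p1 < N \<or> p2 < N" for w p1 p2 q
    unfolding FQ by (rule F1_zero) (use that in \<open>auto simp: N_def\<close>)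
  \<comment> \<open>The substitution \<open>x\<^sub>1 = x\<^sub>2 + x\<^sub>0\<close> turns \<open>x\<^sub>1 - x\<^sub>2\<close> into \<open>x\<^sub>0\<close> and the remaining factor \<open>M0\<close> of \<open>R\<close> into
    a nonzero polynomial \<open>M\<close>, which is cancelled.\<close>
  have F3: "Y1 ^ k \<bullet> P3 w = S12 (F w)" for w
  proof -
    define M where "M = ev g (Y1 + Y2 + Y3) (Y2 + Y3) * (ev fuc (Y1 + Y2 + Y3) Y3 * ev fvc (Y2 + Y3) Y3)"
    define M0 where "M0 = ev g (Y1 + Y3) (Y2 + Y3) * (ev fuc (Y1 + Y3) Y3 * ev fvc (Y2 + Y3) Y3)"
    have "g \<noteq> 0" using g(1) by auto
    then have M: "M \<noteq> 0"
      unfolding M_def by (intro laurent_poly3_mult_nonzero ev_shift3_nonzero nonzero)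
    have "finite {j. F w ((p, q, r) + (j, - j, 0)) \<noteq> 0}" for p q r
      by (rule finite_support_int[of "N - p" _ "q - N"]) (auto intro!: F_zero)
    then have F_fin: "F w \<in> finite_along dir12" by (simp add: finite_along_def split_paired_All)
    have rel: "S.rel M0 M"
    proof -
      have "S.rel M0 (ev g (Y1 + Y2 + Y3) (Y2 + Y3) * (ev fuc (Y1 + Y2 + Y3) Y3 * ev fvc (Y2 + Y3) Y3))"
        unfolding M0_def by (intro S.rel_mult S.rel_ev S.rel_add rel_S12)
      then show ?thesis by (simp only: M_def)
    qed
    have "R \<bullet> P1 w = M0 \<bullet> F w"
      unfolding F_def R_def M0_def act_mult[symmetric] g(2)
      by (simp only: add_diff_cancel_right ac_simps)
    then have "M \<bullet> S12 (F w) = S12 (S13 (S23 (H w)))"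
      using S.relD[OF rel F_fin] by (simp only: P1_eq)
    also have "\<dots> = M \<bullet> (Y1 ^ k \<bullet> P3 w)"
    proof -
      have e: "Y1 + Y2 + Y3 - (Y2 + Y3) = Y1" by simp
      show ?thesis
        unfolding P3_eq[symmetric] M_def act_mult[symmetric] g(2) e by (simp only: ac_simps)
    qed
    finally have eq: "M \<bullet> (Y1 ^ k \<bullet> P3 w) = M \<bullet> S12 (F w)" by simp
    obtain K where K: "\<And>p q r. r < K p q \<Longrightarrow> (Q \<bullet> P1 w) (p, q, r) = 0"
      using F1_trunc'[of w] by (rule iter_laurent3E) auto
    \<comment> \<open>Only finitely many \<open>j\<close> contribute to a coefficient, so that the bounds for the powers of \<open>x\<close> have a minimum.\<close>
    define K' where "K' p q = Min ((\<lambda>j. K (p + j + int k1) (q - j + int k2)) ` {N - p..q - N} \<union> {0})" for p q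
    have "S12 (F w) \<in> iter_laurent3"
    proof (rule iter_laurent3I[of 0 _ "\<lambda>p. N + N - p" K'])
      show "S12 (F w) (p, q, r) = 0" if "p < 0" for p q r using that by (simp add: S12_eq)
      show "S12 (F w) (p, q, r) = 0" if "q < N + N - p" for p q r
      proof -
        have "F w (p + j, q - j, r) = 0" for j using that by (intro F_zero) linarith
        then show ?thesis by (simp add: S12_eq)
      qed
      show "S12 (F w) (p, q, r) = 0" if r: "r < K' p q" for p q r
      proof -
        have "F w (p + j, q - j, r) = 0" for j
        proof (cases "j \<in> {N - p..q - N}")
          case True
          then have "K' p q \<le> K (p + j + int k1) (q - j + int k2)"
            unfolding K'_def by (intro Min_le) auto
          then show ?thesis unfolding FQ using r by (intro K) linarith
        next
          case False
          then show ?thesis by (intro F_zero) auto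
        qed
        then show ?thesis by (simp add: S12_eq)
      qed
    qed
    then show ?thesis
      by (intro cancel3[OF M _ _ eq] iter_laurent3_act P3_trunc)
  qed
  show thesis
    by (rule that[OF F12, of N]) (use F_zero F3 in \<open>simp_all only: F_def\<close>)
qed

end

context complex_vector_space
begin

lemma Y_alpha_zero:
  "a \<in> E_space scale \<Longrightarrow> Y_alpha scale 1 a 0 = 0" "Y_alpha scale 1 0 b = 0"
proof -
  have *: "Y_alpha scale 1 a b = 0" if z: "\<And>w. op_prod a b w = 0" for a b
    by (intro fls_eqI E_eqI)
      (simp add: Y_alpha_nth_nth[OF yprod_zero(2)[OF one_neq_zero z]] yprod_zero(1)[OF one_neq_zero z])
  show "a \<in> E_space scale \<Longrightarrow> Y_alpha scale 1 a 0 = 0"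
    by (rule *) (auto simp: op_prod_def fun_eq_iff E_space_nth)
  show "Y_alpha scale 1 0 b = 0"
    by (rule *) (auto simp: op_prod_def fun_eq_iff)
qed

end

section \<open>The Jacobi identity on \<open>\<E>(W)\<close>\<close>

context quasi_local_triple
begin

text \<open>
  The coefficients of the products in \<open>\<E>(W)\<close> are read off by applying them to each \<open>w\<close>, which turns
  a series in two variables over \<open>\<E>(W)\<close> into one in three variables over \<open>W\<close>.  The bounds of
  \<open>common_expansion\<close> are uniform in \<open>w\<close>, and so hold over \<open>\<E>(W)\<close>.
\<close>

theorem jacobi_on_E:
  "jacobi_times (E_scale scale) (Y_alpha scale 1) (Y_alpha scale 1) 1 u v c"
proof -
  interpret E: complex_vector_space "E_scale scale" by (rule complex_vector_space_E)
  let ?Y = "Y_alpha scale 1"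
  define A where "A = op_prod (?Y u) (?Y v) c"
  define B where "B = op_prod_rev (?Y u) (?Y v) c"
  define G where "G = (\<lambda>(p, n). fls_nth (?Y (fls_nth (?Y u v) p) c) n)"
  define coef :: "'w \<Rightarrow> (exp2 \<Rightarrow> 'w \<Rightarrow> 'w fls) \<Rightarrow> exp3 \<Rightarrow> 'w"
    where "coef w C = (\<lambda>(m, n, q). fls_nth (C (m, n) w) q)" for w C
  have coef_eqI: "C = C'" if "\<And>w. coef w C = coef w C'" for C C'
  proof -
    have "fls_nth (C (m, n) w) q = fls_nth (C' (m, n) w) q" for m n w q
      using fun_cong[OF that[of w], of "(m, n, q)"] by (simp add: coef_def)
    then show ?thesis by (intro ext E_eqI) (auto simp: split_paired_All)
  qed
  have coef_A: "coef w A = P1 w" for w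
  proof -
    have "fls_nth (fls_nth (?Y u (ycoeff v c k)) p w) q = yprod 1 u (ycoeff v c k) w (p, q)" for p k q
      using compat_iter(1)[of k] by (auto simp: Y_alpha_nth_nth)
    then show ?thesis by (simp add: coef_def A_def P1_def op_prod_def fun_eq_iff)
  qed
  have coef_B: "coef w B = P2 w" for w
  proof -
    have "fls_nth (fls_nth (?Y v (ycoeff u c k)) p w) q = yprod 1 v (ycoeff u c k) w (p, q)" for p k q
      using compat_iter(2)[of k] by (auto simp: Y_alpha_nth_nth)
    then show ?thesis by (simp add: coef_def B_def P2_def op_prod_rev_def fun_eq_iff)
  qed
  have coef_G: "coef w G = P3 w" for w
  proof -
    have "fls_nth (fls_nth (?Y (ycoeff u v k) c) p w) q = yprod 1 (ycoeff u v k) c w (p, q)" for p k q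
      using compat_iter(3)[of k] by (auto simp: Y_alpha_nth_nth)
    then show ?thesis by (simp add: coef_def G_def P3_def fun_eq_iff)
  qed
  have lin: "linear_series_map (E_scale scale) scale UNIV (coef w)" for w
    by unfold_locales (simp_all add: coef_def fun_eq_iff)
  have rel: "intertwiner.rel (act (E_scale scale)) (act scale) UNIV (coef w) (mon (1, 0)) Y1"
    "intertwiner.rel (act (E_scale scale)) (act scale) UNIV (coef w) (mon (0, 1)) Y2" for w
  proof -
    interpret L: linear_series_map "E_scale scale" scale UNIV "coef w" by (rule lin)
    show "L.rel (mon (1, 0)) Y1" "L.rel (mon (0, 1)) Y2"
      by (rule L.rel_mon; simp add: coef_def fun_eq_iff)+
  qed
  obtain k N where k: "\<And>w. (Y1 - Y2) ^ k \<bullet> P1 w = (Y1 - Y2) ^ k \<bullet> P2 w"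
    "\<And>w p1 p2 q. p1 < N \<or> p2 < N \<Longrightarrow> ((Y1 - Y2) ^ k \<bullet> P1 w) (p1, p2, q) = 0"
    "\<And>w. Y1 ^ k \<bullet> P3 w = S12 ((Y1 - Y2) ^ k \<bullet> P1 w)"
    by (rule common_expansion) blast
  let ?d = "(mon (1, 0) - mon (0, 1)) ^ k :: exp2 \<Rightarrow>\<^sub>0 complex"
  define F where "F = act (E_scale scale) ?d A"
  have coef_d: "coef w (act (E_scale scale) ?d C) = (Y1 - Y2) ^ k \<bullet> coef w C" for w C
  proof -
    interpret L: linear_series_map "E_scale scale" scale UNIV "coef w" by (rule lin)
    show ?thesis unfolding mon_diff_eq
      by (rule L.relD) (intro L.rel_power L.rel_add L.rel_mult L.rel_cnst rel, simp)
  qed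
  have coef_1: "coef w (act (E_scale scale) (mon (1, 0) ^ k) C) = Y1 ^ k \<bullet> coef w C" for w C
  proof -
    interpret L: linear_series_map "E_scale scale" scale UNIV "coef w" by (rule lin)
    show ?thesis by (rule L.relD) (intro L.rel_power rel, simp)
  qed
  have coef_F: "coef w F = (Y1 - Y2) ^ k \<bullet> P1 w" for w by (simp only: F_def coef_d coef_A)
  have B: "act (E_scale scale) ?d B = F"
    by (rule coef_eqI) (simp only: coef_d coef_B coef_F k)
  have "F (m, n) = 0" if "m < N \<or> n < N" for m n
  proof (rule E_eqI)
    fix w q
    show "fls_nth (F (m, n) w) q = fls_nth (0 w) q"
      using k(2)[OF that, of w q] unfolding coef_F[symmetric] by (simp add: coef_def)
  qed
  then have F: "F \<in> laurent2" unfolding laurent2_def by blast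
  have coef_S: "coef w (expand_shift (E_scale scale) 1 fst dir2 F) = S12 (coef w F)" for w
  proof -
    have "fls_nth (expand_shift (E_scale scale) 1 fst dir2 F (p, q) w) r = S12 (coef w F) (p, q, r)" for p q r
    proof -
      have fin: "finite {j. E_scale scale (1 powi j * zchoose (fst (p, q) + j) (fst (p, q))) (F ((p, q) + (j, - j))) \<noteq> 0}"
        using F laurent2_finite_along by (intro E.finite_support_scale finite_alongD) blast
      show ?thesis
        unfolding expand_shift_def
        by (subst Sum_any_additive[of "\<lambda>a. fls_nth (a w) r", OF _ _ fin]) (simp_all add: coef_def)
    qed
    then show ?thesis by (simp add: coef_def fun_eq_iff)
  qed
  have G1: "act (E_scale scale) (mon (1, 0) ^ k) G = expand_shift (E_scale scale) 1 fst dir2 F"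
    by (rule coef_eqI) (simp only: coef_1 coef_G coef_S coef_F k)
  have "A \<in> E.bounded_along snd"
    by (auto simp: E.bounded_along_def A_def op_prod_def Y_alpha_zero in_E intro!: exI[of _ "fls_subdegree (?Y v c)"])
  moreover have "B \<in> E.bounded_along fst"
    by (auto simp: E.bounded_along_def B_def op_prod_rev_def Y_alpha_zero in_E intro!: exI[of _ "fls_subdegree (?Y u c)"])
  moreover have "G \<in> E.bounded_along fst"
    by (auto simp: E.bounded_along_def G_def Y_alpha_zero intro!: exI[of _ "fls_subdegree (?Y u v)"])
  ultimately have "series_mult (E_scale scale) delta_12 (series_in_12 A) e
      - series_mult (E_scale scale) delta_21 (series_in_12 B) e
      = series_mult (E_scale scale) delta_10 (series_in_02 G) e" for e
    using E.jacobi_of_expansions[OF F_def[symmetric] B _ _ F _ G1] by blast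
  then show ?thesis
    unfolding jacobi_times_def series_mult_poly_series series_in_12_poly_series
      act_def[symmetric, of "E_scale scale"] ev_one E.act.scale_one A_def B_def G_def by blast
qed

end


section \<open>Quasi locality of products\<close>

lemma ev_scale_nonzero:
  assumes "f \<noteq> 0" "\<alpha> \<noteq> 0"
  shows "ev f (mon (1, 0) * cnst \<alpha>) (mon (0, 1) :: exp2 \<Rightarrow>\<^sub>0 complex) \<noteq> 0"
proof -
  obtain s t where st: "t \<notin> {0}" "s \<notin> {0}" "eval2 id f s t \<noteq> 0"
    by (rule exists_nonroot[OF assms(1), of "{0}" "\<lambda>t. {0}"]) auto
  let ?A = "character2 (s / \<alpha>) t"
  have 1: "eigen ?A (mon (1, 0)) (s / \<alpha>)" "eigen ?A (mon (0, 1)) t"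
    using st assms(2) by (auto intro!: eigen_character2)
  have "eigen ?A (mon (1, 0) * cnst \<alpha>) (s / \<alpha> * \<alpha>)"
    by (intro eigen_mult eigen_cnst 1)
  from eigen_ev[OF this 1(2), of f] show ?thesis
    using st(3) assms(2) by (auto dest: eigen_character2_nonzero)
qed

text \<open>\<open>f(\<alpha>x\<^sub>1, x\<^sub>2)\<close>\<close>

definition scale_poly :: "complex \<Rightarrow> complex poly poly \<Rightarrow> complex poly poly"
  where "scale_poly \<alpha> f = eval2 const_poly2 f [:0, [:\<alpha>:]:] [:[:0, 1:]:]"

lemma ev_scale_poly [simp]: "ev (scale_poly \<alpha> f) s t = ev f (s * cnst \<alpha>) t"
proof -
  have "ev [:0, [:\<alpha>:]:] s t = s * cnst \<alpha>" by (simp add: eval2_def map_poly_pCons)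
  then show ?thesis by (simp add: scale_poly_def ev_subst)
qed

lemma scale_poly_nonzero: "f \<noteq> 0 \<Longrightarrow> \<alpha> \<noteq> 0 \<Longrightarrow> scale_poly \<alpha> f \<noteq> 0"
  by (metis ev_scale_nonzero ev_scale_poly eval2_0)

text \<open>The coefficient of the \<open>k\<close>th power of the first variable.\<close>

definition slice1 :: "int \<Rightarrow> (exp3 \<Rightarrow> 'w) \<Rightarrow> exp2 \<Rightarrow> 'w"
  where "slice1 k C = (\<lambda>(m, q). C (k, m, q))"

context complex_vector_space
begin

lemma slice1_poly: "slice1 k (ev f Y2 Y3 \<bullet> C) = poly12 f \<bullet> slice1 k C"
proof -
  interpret L: linear_series_map scale scale UNIV "slice1 k"
    by unfold_locales (simp_all add: fun_eq_iff slice1_def)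
  have "L.rel Y2 (mon (1, 0))" "L.rel Y3 (mon (0, 1))"
    by (rule L.rel_mon; simp add: fun_eq_iff slice1_def)+
  from L.relD[OF L.rel_ev[OF this]] show ?thesis by simp
qed

text \<open>A series in two variables, with \<open>c(y)\<close> applied to it.\<close>

definition apply3 :: "('w \<Rightarrow> 'w fls) \<Rightarrow> (exp2 \<Rightarrow> 'w) \<Rightarrow> exp3 \<Rightarrow> 'w"
  where "apply3 c C = (\<lambda>(m, k, q). fls_nth (c (C (m, k))) q)"

lemma linear_apply3:
  assumes "c \<in> E_space scale" shows "linear_series_map scale scale UNIV (apply3 c)"
  by unfold_locales (auto simp: apply3_def fun_eq_iff E_space_nth[OF assms])

lemma rel_apply3:
  assumes "c \<in> E_space scale"
  shows "carries UNIV (apply3 c) (mon (1, 0)) Y1"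
    "carries UNIV (apply3 c) (mon (0, 1)) Y2"
proof -
  interpret L: linear_series_map scale scale UNIV "apply3 c" by (rule linear_apply3[OF assms])
  show "L.rel (mon (1, 0)) Y1" "L.rel (mon (0, 1)) Y2"
    by (rule L.rel_mon; simp add: apply3_def fun_eq_iff split_paired_All)+
qed

lemma apply3_poly:
  assumes "c \<in> E_space scale"
  shows "apply3 c (poly12 f \<bullet> C) = ev f Y1 Y2 \<bullet> apply3 c C"
    "apply3 c (shift_poly \<alpha> f \<bullet> C) = ev f (Y1 + cnst \<alpha> * Y2) Y2 \<bullet> apply3 c C"
proof -
  interpret L: linear_series_map scale scale UNIV "apply3 c" by (rule linear_apply3[OF assms])
  show "apply3 c (poly12 f \<bullet> C) = ev f Y1 Y2 \<bullet> apply3 c C"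
    by (rule L.relD[OF L.rel_ev[OF rel_apply3[OF assms]]]) simp
  show "apply3 c (shift_poly \<alpha> f \<bullet> C) = ev f (Y1 + cnst \<alpha> * Y2) Y2 \<bullet> apply3 c C"
    by (rule L.relD) (intro L.rel_ev L.rel_add L.rel_mult L.rel_cnst rel_apply3 assms, simp)
qed

lemma apply3_subst2:
  assumes c: "c \<in> E_space scale" and C: "C \<in> laurent2"
  shows "apply3 c (subst2 \<alpha> C) = expand_shift scale \<alpha> slot1 dir12 (apply3 c C)"
    and "apply3 c C \<in> finite_along dir12"
proof -
  have Cf: "C \<in> finite_along dir2" using C laurent2_finite_along by blast
  have "fls_nth (c (subst2 \<alpha> C (p, q))) r = expand_shift scale \<alpha> slot1 dir12 (apply3 c C) (p, q, r)" for p q r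
  proof -
    have fin: "finite {j. scale (\<alpha> powi j * zchoose (fst (p, q) + j) (fst (p, q))) (C ((p, q) + (j, - j))) \<noteq> 0}"
      by (rule finite_support_scale[OF finite_alongD[OF Cf]])
    show ?thesis
      unfolding expand_shift_def
      by (subst Sum_any_additive[of "\<lambda>x. fls_nth (c x) r", OF _ _ fin])
        (simp_all add: E_space_nth[OF c] apply3_def)
  qed
  then show "apply3 c (subst2 \<alpha> C) = expand_shift scale \<alpha> slot1 dir12 (apply3 c C)"
    by (simp add: apply3_def fun_eq_iff)
  have "finite {j. apply3 c C ((p, q, r) + (j, - j, 0)) \<noteq> 0}" for p q r
    using finite_alongD[OF Cf, of "(p, q)"]
    by (rule rev_finite_subset) (auto simp: apply3_def E_space_nth[OF c])
  then show "apply3 c C \<in> finite_along dir12" by (simp add: finite_along_def split_paired_All)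
qed

lemma slices_iter_laurent2_act:
  assumes "\<And>r. slice3 r C \<in> iter_laurent2"
  shows "slice3 r (p \<bullet> C) \<in> iter_laurent2"
proof -
  let ?D = "{C :: exp3 \<Rightarrow> 'w. \<forall>r. slice3 r C \<in> iter_laurent2}"
  have "p \<bullet> C \<in> ?D"
  proof (rule act_closed)
    show "C \<in> ?D" using assms by blast
    show "0 \<in> ?D" by (auto simp: iter_laurent2_def slice3_def)
    fix C C' :: "exp3 \<Rightarrow> 'w" and k and d :: exp3 assume C: "C \<in> ?D"
    obtain d1 d2 d3 where d: "d = (d1, d2, d3)" by (cases d)
    have "slice3 r (\<lambda>e. scale k (C (e - d))) = (\<lambda>e. scale k (slice3 (r - d3) C (e - (d1, d2))))" for r
      by (auto simp: fun_eq_iff d)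
    moreover have "(\<lambda>e. scale k (slice3 (r - d3) C (e - (d1, d2)))) \<in> iter_laurent2" for r
      by (rule iter_laurent2_image[OF iter_laurent2_shift, of _ "scale k"]) (use C in simp_all)
    ultimately show "(\<lambda>e. scale k (C (e - d))) \<in> ?D" by simp
    assume C': "C' \<in> ?D"
    have "slice3 r (\<lambda>e. C e + C' e) = (\<lambda>e. slice3 r C e + slice3 r C' e)" for r
      by (auto simp: fun_eq_iff)
    then show "(\<lambda>e. C e + C' e) \<in> ?D" using C C' by (simp add: iter_laurent2_add)
  qed
  then show ?thesis by blast
qed

text \<open>The nonzero polynomial \<open>f\<close> expresses the quasi locality of \<open>a\<close> and \<open>b\<close>.\<close>

definition ql_poly :: "('w \<Rightarrow> 'w fls) \<Rightarrow> ('w \<Rightarrow> 'w fls) \<Rightarrow> complex poly poly \<Rightarrow> bool"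
  where "ql_poly a b f \<longleftrightarrow> f \<noteq> 0 \<and> (\<forall>w. poly12 f \<bullet> op_prod a b w = poly12 f \<bullet> op_prod_rev a b w)"

lemma mutually_quasi_local_iff: "mutually_quasi_local scale a b \<longleftrightarrow> (\<exists>f. ql_poly a b f)"
  by (simp add: mutually_quasi_local_def ql_poly_def series_mult_poly_series)

lemma ql_poly_compat: "a \<in> E_space scale \<Longrightarrow> b \<in> E_space scale \<Longrightarrow> ql_poly a b f \<Longrightarrow> compat a b f"
  by (rule compat_of_quasi_local) (simp_all add: ql_poly_def)

lemma ql_poly_swap: "ql_poly a b f \<Longrightarrow> ql_poly b a (swap_poly f)"
  using quasi_local_swap swap_poly_nonzero unfolding ql_poly_def by blast

text \<open>
  The series \<open>\<Y>\<^sub>\<alpha>(a(y), x\<^sub>0) b(y) c(x) w\<close> and \<open>c(x) \<Y>\<^sub>\<alpha>(a(y), x\<^sub>0) b(y) w\<close> become equal after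
  multiplication by \<open>f(\<alpha>y + x\<^sub>0, x) g(y, x)\<close>, where \<open>f\<close> and \<open>g\<close> move \<open>c\<close> past \<open>a\<close> and \<open>b\<close>.
\<close>

lemma yprod_quasi_local:
  assumes E: "a \<in> E_space scale" "b \<in> E_space scale" "c \<in> E_space scale" and \<alpha>: "\<alpha> \<noteq> 0"
    and ab: "ql_poly a b fab" and ac: "ql_poly a c fac" and bc: "ql_poly b c fbc"
  shows "(ev fac (Y1 + cnst \<alpha> * Y2) Y3 * ev fbc Y2 Y3) \<bullet> (\<lambda>(p, k, r). yprod \<alpha> a b (fls_nth (c w) r) (p, k)) =
    (ev fac (Y1 + cnst \<alpha> * Y2) Y3 * ev fbc Y2 Y3) \<bullet> apply3 c (yprod \<alpha> a b w)" (is "?T' \<bullet> ?Z1 = ?T' \<bullet> ?Z2")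
proof -
  let ?S = "expand_shift scale \<alpha> slot1 dir12"
  let ?T = "ev fac Y1 Y3 * ev fbc Y2 Y3"
  let ?f = "ev fab Y1 Y2" and ?f' = "ev fab (Y1 + cnst \<alpha> * Y2) Y2"
  let ?cab = "apply3 c (op_prod a b w)"
  interpret S: linear_series_map scale scale "finite_along dir12" ?S by (rule linear_expand_shift)
  have comp: "compat a b fab" by (rule ql_poly_compat[OF E(1,2) ab])
  have f0: "fab \<noteq> 0" and F: "poly12 fab \<bullet> op_prod a b w' \<in> laurent2" for w' using comp by (auto simp: compat_iff)
  note fin1 = triple_expand(1)[OF comp \<alpha>]
  have fin2: "?f \<bullet> ?cab \<in> finite_along dir12"
    unfolding apply3_poly(1)[OF E(3), symmetric] by (rule apply3_subst2(2)[OF E(3) F])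
  note Z1 = triple_expand(2)[OF comp \<alpha>]
  have Z2: "?f' \<bullet> ?Z2 = ?S (?f \<bullet> ?cab)"
    by (simp only: apply3_poly[OF E(3), symmetric] yprod_char[OF comp \<alpha>] apply3_subst2(1)[OF E(3) F])
  have TT: "?T \<bullet> triple a b c w = ?T \<bullet> ?cab"
  proof -
    have 1: "ev fbc Y2 Y3 \<bullet> triple a b c w = ev fbc Y2 Y3 \<bullet> apply1 a (op_prod_rev b c w)"
      using bc by (simp add: apply1_poly[OF E(1)] ql_poly_def)
    have 2: "ev fac Y1 Y3 \<bullet> apply1 a (op_prod_rev b c w) = ev fac Y1 Y3 \<bullet> ?cab"
    proof (rule slice2_eqI)
      fix k
      have "slice2 k (apply1 a (op_prod_rev b c w)) = op_prod a c (fls_nth (b w) k)"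
        "slice2 k ?cab = op_prod_rev a c (fls_nth (b w) k)"
        by (auto simp: fun_eq_iff op_prod_def op_prod_rev_def apply3_def)
      then show "slice2 k (ev fac Y1 Y3 \<bullet> apply1 a (op_prod_rev b c w)) = slice2 k (ev fac Y1 Y3 \<bullet> ?cab)"
        using ac by (simp add: slice2_poly ql_poly_def)
    qed
    have "?T \<bullet> triple a b c w = ev fbc Y2 Y3 \<bullet> (ev fac Y1 Y3 \<bullet> apply1 a (op_prod_rev b c w))"
      unfolding act_mult 1 unfolding act_mult[symmetric] by (simp only: mult.commute)
    also have "\<dots> = ?T \<bullet> ?cab" unfolding 2 act_mult[symmetric] by (simp only: mult.commute)
    finally show ?thesis .
  qed
  have rel: "S.rel ?T ?T'"
    by (intro S.rel_mult S.rel_ev rel_expand_shift(1)[OF shift_direction_dir(2) \<alpha>]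
        rel_expand_shift(2)[OF shift_direction_dir(2) \<alpha>]) simp_all
  have comm: "p \<bullet> (q \<bullet> C) = q \<bullet> (p \<bullet> C)" for p q :: "exp3 \<Rightarrow>\<^sub>0 complex" and C :: "exp3 \<Rightarrow> 'w"
    unfolding act_mult[symmetric] by (simp only: mult.commute)
  have eq: "?f' \<bullet> (?T' \<bullet> ?Z1) = ?f' \<bullet> (?T' \<bullet> ?Z2)"
  proof -
    have "?f' \<bullet> (?T' \<bullet> ?Z1) = ?S (?T \<bullet> (?f \<bullet> triple a b c w))"
      by (simp only: comm[of ?f'] Z1 S.relD[OF rel fin1])
    also have "?T \<bullet> (?f \<bullet> triple a b c w) = ?T \<bullet> (?f \<bullet> ?cab)"
      by (simp only: comm[of ?T] TT)
    also have "?S \<dots> = ?f' \<bullet> (?T' \<bullet> ?Z2)"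
      by (simp only: comm[of ?f'] Z2 S.relD[OF rel fin2])
    finally show ?thesis .
  qed
  show ?thesis
  proof (rule slice3_eqI)
    fix r
    have it: "yprod \<alpha> a b w' \<in> iter_laurent2" for w' by (rule yprod_iter_laurent2(1)[OF comp \<alpha>])
    have it1: "slice3 r ?Z1 \<in> iter_laurent2" for r
    proof -
      have "slice3 r ?Z1 = yprod \<alpha> a b (fls_nth (c w) r)" by (auto simp: fun_eq_iff)
      then show ?thesis by (simp only: it)
    qed
    have it2: "slice3 r ?Z2 \<in> iter_laurent2" for r
    proof -
      have "slice3 r ?Z2 = (\<lambda>e. fls_nth (c (yprod \<alpha> a b w e)) r)" by (auto simp: fun_eq_iff apply3_def)
      then show ?thesis
        using iter_laurent2_image[OF it, of "\<lambda>x. fls_nth (c x) r"] by (simp add: E_space_nth[OF E(3)])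
    qed
    have "shift_poly \<alpha> fab \<bullet> slice3 r (?T' \<bullet> ?Z1) = shift_poly \<alpha> fab \<bullet> slice3 r (?T' \<bullet> ?Z2)"
      unfolding slice3_shift_poly[symmetric] eq ..
    then show "slice3 r (?T' \<bullet> ?Z1) = slice3 r (?T' \<bullet> ?Z2)"
      by (rule shift_poly_cancel[OF f0 slices_iter_laurent2_act[OF it1] slices_iter_laurent2_act[OF it2]])
  qed
qed

text \<open>
  If a polynomial that is nonzero at \<open>x\<^sub>0 = 0\<close> annihilates a series with lowest power \<open>x\<^sub>0\<^sup>N\<close>, then the
  coefficient of \<open>x\<^sub>0\<^sup>N\<^sup>+\<^sup>j\<close> is annihilated by the \<open>j + 1\<close>st power of the value at \<open>x\<^sub>0 = 0\<close>.
\<close>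

lemma annihilate_coefficients:
  assumes T: "cong_mod Y1 T T0" "T \<bullet> Z = 0" and Z: "\<And>p k r. p < N \<Longrightarrow> Z (p, k, r) = 0"
  shows "p < N + int j \<Longrightarrow> (T0 ^ j \<bullet> Z) (p, k, r) = 0"
proof (induction j arbitrary: p k r)
  case 0
  then show ?case using Z by simp
next
  case (Suc j)
  obtain R where R: "nonneg12 R" "T = T0 + Y1 * R" using T(1) unfolding cong_mod_def by blast
  let ?X = "T0 ^ j \<bullet> Z"
  have "T \<bullet> ?X = T0 ^ j \<bullet> (T \<bullet> Z)" unfolding act_mult[symmetric] by (simp only: mult.commute)
  then have "T0 \<bullet> ?X + Y1 \<bullet> (R \<bullet> ?X) = 0"
    unfolding R(2) T(2)[unfolded R(2)] by (simp only: act_add_left act_mult act.scale_zero_right)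
  from fun_cong[OF this, of "(p, k, r)"] have "(T0 \<bullet> ?X) (p, k, r) + (R \<bullet> ?X) (p - 1, k, r) = 0"
    by (simp only: plus_fun_apply act_mon diff_Pair diff_zero zero_fun_apply)
  moreover have "(R \<bullet> ?X) (p - 1, k, r) = (R \<bullet> 0) (p - 1, k, r)"
  proof (rule act_agree[where \<pi> = slot1 and n = "N + int j - 1"])
    show "slot1 e \<le> N + int j - 1 \<Longrightarrow> ?X e = 0 e" for e
      using Suc.IH by (cases e) simp
    show "slot1 (p - 1, k, r) \<le> N + int j - 1" using Suc.prems by simp
  qed (use R(1) slot_diff(3) in blast)+
  ultimately have "(T0 \<bullet> ?X) (p, k, r) = 0" by simp
  then show ?case by (simp only: power_Suc act_mult)
qed

text \<open>
  Quasi locality passes to products, as in Dong's lemma for local fields.  The polynomial of the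
  previous lemma involves \<open>x\<^sub>0\<close>; a power of its value \<open>f(\<alpha>y, x) g(y, x)\<close> at \<open>x\<^sub>0 = 0\<close> works for a
  single coefficient.
\<close>

theorem ql_poly_nth_prod:
  assumes E: "a \<in> E_space scale" "b \<in> E_space scale" "c \<in> E_space scale" and \<alpha>: "\<alpha> \<noteq> 0"
    and ab: "ql_poly a b fab" and ac: "ql_poly a c fac" and bc: "ql_poly b c fbc"
  shows "\<exists>f. ql_poly (nth_prod scale \<alpha> n a b) c f"
proof -
  have comp: "compat a b fab" by (rule ql_poly_compat[OF E(1,2) ab])
  define T where "T = ev fac (Y1 + cnst \<alpha> * Y2) Y3 * ev fbc Y2 Y3"
  define T0 where "T0 = ev fac (cnst \<alpha> * Y2) Y3 * ev fbc Y2 Y3"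
  define g where "g = scale_poly \<alpha> fac * fbc"
  have g: "g \<noteq> 0" using ac bc \<alpha> by (simp add: g_def ql_poly_def scale_poly_nonzero)
  have T0: "T0 = ev g Y2 Y3" by (simp add: T0_def g_def ev_mult mult.commute)
  have nn: "nonneg12 (cnst \<alpha> * Y2)" by (intro conjI nonneg_exp_mult slot_add) (simp_all add: nonneg12_variables)
  have T: "cong_mod Y1 T T0"
    unfolding T_def T0_def
    by (intro cong_mod_mult cong_mod_ev cong_mod_self cong_mod_refl nn nonneg12_variables)
  obtain N where N: "\<And>w p q. p < N \<Longrightarrow> yprod \<alpha> a b w (p, q) = 0"
    using yprod_iter_laurent2(2)[OF comp \<alpha>] by blast
  let ?d = "nth_prod scale \<alpha> n a b"
  \<comment> \<open>The product is the coefficient of \<open>x\<^sub>0\<^sup>-\<^sup>n\<^sup>-\<^sup>1\<close>, and the lowest power is at least \<open>x\<^sub>0\<^sup>N\<close>.\<close>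
  define j where "j = nat (- n - N)"
  have j: "- n - 1 < N + int j" unfolding j_def by linarith
  have "poly12 (g ^ j) \<bullet> op_prod ?d c w = poly12 (g ^ j) \<bullet> op_prod_rev ?d c w" for w
  proof -
    define Z1 where "Z1 = (\<lambda>(p, k, r). yprod \<alpha> a b (fls_nth (c w) r) (p, k))"
    define Z2 where "Z2 = apply3 c (yprod \<alpha> a b w)"
    have "T \<bullet> Z1 = T \<bullet> Z2" unfolding T_def Z1_def Z2_def by (rule yprod_quasi_local[OF assms])
    then have "T \<bullet> (Z1 - Z2) = 0" by (simp only: act.scale_right_diff_distrib diff_self)
    moreover have "(Z1 - Z2) (p, k, r) = 0" if "p < N" for p k r
      by (simp add: Z1_def Z2_def apply3_def N[OF that] E_space_nth[OF E(3)])
    ultimately have "(T0 ^ j \<bullet> (Z1 - Z2)) (- n - 1, k, r) = 0" for k r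
      by (rule annihilate_coefficients[OF T, where N = N]) (assumption, rule j)
    then have "slice1 (- n - 1) (T0 ^ j \<bullet> (Z1 - Z2)) = 0" by (simp add: slice1_def fun_eq_iff)
    then have "poly12 (g ^ j) \<bullet> slice1 (- n - 1) (Z1 - Z2) = 0"
      by (simp only: T0 ev_power[symmetric] slice1_poly)
    moreover have "slice1 (- n - 1) (Z1 - Z2) = op_prod ?d c w - op_prod_rev ?d c w"
      by (simp add: slice1_def Z1_def Z2_def apply3_def op_prod_def op_prod_rev_def fun_eq_iff nth_prod_nth[OF comp \<alpha>])
    ultimately show ?thesis by (simp only: act.scale_right_diff_distrib right_minus_eq)
  qed
  then show ?thesis using g by (auto simp: ql_poly_def intro!: exI[of _ "g ^ j"])
qed


section \<open>The generated subspace\<close>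

text \<open>Mutual quasi locality.\<close>

abbreviation mql :: "('w \<Rightarrow> 'w fls) \<Rightarrow> ('w \<Rightarrow> 'w fls) \<Rightarrow> bool"
  where "mql \<equiv> mutually_quasi_local scale"

lemma mql_swap: "mql a b \<Longrightarrow> mql b a"
  using ql_poly_swap unfolding mutually_quasi_local_iff by blast

lemma mql_add: "mql a x \<Longrightarrow> mql b x \<Longrightarrow> x \<in> E_space scale \<Longrightarrow> mql (a + b) x"
proof -
  assume "mql a x" "mql b x" and x: "x \<in> E_space scale"
  then obtain f g where f: "ql_poly a x f" and g: "ql_poly b x g" unfolding mutually_quasi_local_iff by blast
  have 1: "poly12 (f * g) \<bullet> op_prod a x w = poly12 (f * g) \<bullet> op_prod_rev a x w"
    "poly12 (f * g) \<bullet> op_prod b x w = poly12 (f * g) \<bullet> op_prod_rev b x w" for w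
    using f g unfolding ev_mult mult.commute[of "poly12 f"] by (simp_all only: act_mult ql_poly_def)
      (simp_all only: act_mult[symmetric] mult.commute, simp_all only: act_mult ql_poly_def)
  have "op_prod (a + b) x w = op_prod a x w + op_prod b x w"
    "op_prod_rev (a + b) x w = op_prod_rev a x w + op_prod_rev b x w" for w
    by (auto simp: op_prod_def op_prod_rev_def fun_eq_iff E_space_nth[OF x])
  then have "ql_poly (a + b) x (f * g)"
    using f g by (simp add: ql_poly_def act_add_right 1)
  then show ?thesis unfolding mutually_quasi_local_iff by blast
qed

lemma mql_scale: "mql a x \<Longrightarrow> x \<in> E_space scale \<Longrightarrow> mql (E_scale scale k a) x"
proof -
  assume "mql a x" and x: "x \<in> E_space scale"
  then obtain f where f: "ql_poly a x f" unfolding mutually_quasi_local_iff by blast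
  have "op_prod (E_scale scale k a) x w = (\<lambda>e. scale k (op_prod a x w e))"
    "op_prod_rev (E_scale scale k a) x w = (\<lambda>e. scale k (op_prod_rev a x w e))" for w
    by (auto simp: op_prod_def op_prod_rev_def fun_eq_iff E_space_nth[OF x])
  then have "ql_poly (E_scale scale k a) x f"
    using f by (simp add: ql_poly_def act_scale_right)
  then show ?thesis unfolding mutually_quasi_local_iff by blast
qed

lemma mql_vacuum: "x \<in> E_space scale \<Longrightarrow> mql fls_const x"
  unfolding mutually_quasi_local_iff ql_poly_def
  by (intro exI[of _ 1]) (auto simp: op_prod_def op_prod_rev_def fun_eq_iff E_space_nth)

lemma mql_nth_prod:
  assumes "a \<in> E_space scale" "b \<in> E_space scale" "x \<in> E_space scale" "\<alpha> \<noteq> 0" "mql a b" "mql a x" "mql b x"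
  shows "mql (nth_prod scale \<alpha> n a b) x"
  using assms ql_poly_nth_prod unfolding mutually_quasi_local_iff by metis

lemma E_space_closed:
  assumes "a \<in> E_space scale" shows "b \<in> E_space scale \<Longrightarrow> a + b \<in> E_space scale"
    "E_scale scale k a \<in> E_space scale"
  by (rule E_spaceI; simp add: E_space_nth[OF assms] E_space_nth[of b] scale_right_distrib mult.commute)+

lemma quasi_local_subset: "quasi_local scale M \<Longrightarrow> X \<subseteq> M \<Longrightarrow> quasi_local scale X"
  unfolding quasi_local_def by blast

lemma quasi_local_pairwise_compatible: "quasi_local scale U \<Longrightarrow> pairwise_compatible scale U"
  unfolding quasi_local_def pairwise_compatible_def mutually_quasi_local_iff
  using ql_poly_compat by (meson subsetD)

text \<open>
  A maximal quasi local set is a subspace and closed under all products, since an element that is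
  quasi local with everything in it, and with itself, belongs to it.
\<close>

lemma exists_closed_quasi_local:
  assumes S: "quasi_local scale S" and \<Gamma>: "0 \<notin> \<Gamma>"
  obtains M where "Y_closed scale \<Gamma> M" "quasi_local scale M" "S \<subseteq> M" "fls_const \<in> M"
proof -
  interpret E: complex_vector_space "E_scale scale" by (rule complex_vector_space_E)
  let ?A = "{X. quasi_local scale X \<and> S \<subseteq> X \<and> fls_const \<in> X}"
  have SE: "S \<subseteq> E_space scale" using S by (simp add: quasi_local_def)
  have vac: "mql fls_const x" "mql x fls_const" if "x \<in> insert fls_const S" for x
    using that SE mql_vacuum mql_swap fls_const_in_E by blast+
  have "quasi_local scale (insert fls_const S)"
    using S SE vac fls_const_in_E unfolding quasi_local_def by blast
  then have ne: "?A \<noteq> {}" by blast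
  have chain: "\<Union>C \<in> ?A" if C: "C \<noteq> {}" "subset.chain ?A C" for C
  proof -
    have CA: "\<And>X. X \<in> C \<Longrightarrow> X \<in> ?A" and lin: "\<And>X Y. X \<in> C \<Longrightarrow> Y \<in> C \<Longrightarrow> X \<subseteq> Y \<or> Y \<subseteq> X"
      using C(2) unfolding subset_chain_def by blast+
    have "mql a b" if ab: "a \<in> \<Union>C" "b \<in> \<Union>C" for a b
    proof -
      obtain X Y where "X \<in> C" "Y \<in> C" "a \<in> X" "b \<in> Y" using ab by blast
      then obtain Z where "Z \<in> C" "a \<in> Z" "b \<in> Z" using lin by blast
      then show ?thesis using CA[of Z] by (simp add: quasi_local_def)
    qed
    moreover have "\<Union>C \<subseteq> E_space scale" using CA unfolding quasi_local_def by blast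
    moreover have "S \<subseteq> \<Union>C" "fls_const \<in> \<Union>C" using C(1) CA by blast+
    ultimately show ?thesis by (simp add: quasi_local_def)
  qed
  obtain M where "M \<in> ?A" and max: "\<forall>X\<in>?A. M \<subseteq> X \<longrightarrow> X = M"
    using subset_Zorn_nonempty[OF ne chain] by auto
  then have M: "quasi_local scale M" "S \<subseteq> M" "fls_const \<in> M" by auto
  then have ME: "\<And>a. a \<in> M \<Longrightarrow> a \<in> E_space scale" and Mql: "\<And>a b. a \<in> M \<Longrightarrow> b \<in> M \<Longrightarrow> mql a b"
    unfolding quasi_local_def by auto
  \<comment> \<open>Maximality: \<open>d\<close> belongs to \<open>M\<close> if it is quasi local with everything that is quasi local with two
    elements \<open>a, b\<close> of \<open>M\<close>; applied twice, this makes \<open>d\<close> quasi local with itself.\<close>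
  have mem: "d \<in> M" if d: "d \<in> E_space scale" "\<And>x. x \<in> E_space scale \<Longrightarrow> mql a x \<Longrightarrow> mql b x \<Longrightarrow> mql d x"
    and ab: "a \<in> M" "b \<in> M" for d a b
  proof -
    have 1: "mql d x" "mql x d" if "x \<in> M" for x
      using d(2)[of x] that ab ME Mql mql_swap by blast+
    then have "mql d d" using d ab by blast
    with 1 Mql have "\<forall>x\<in>insert d M. \<forall>y\<in>insert d M. mql x y" by blast
    moreover have "insert d M \<subseteq> E_space scale" using d(1) ME by blast
    ultimately have "quasi_local scale (insert d M)" unfolding quasi_local_def by (rule conjI[rotated])
    moreover have "S \<subseteq> insert d M" "fls_const \<in> insert d M" using M(2,3) by blast+
    ultimately have "insert d M \<in> ?A" by simp
    from bspec[OF max this] have "insert d M = M" by blast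
    then show ?thesis by blast
  qed
  have scaled: "E_scale scale k a \<in> M" if a: "a \<in> M" for k a
    by (rule mem[OF E_space_closed(2)[OF ME[OF a]] _ a a]) (rule mql_scale)
  have "E.subspace M"
  proof (rule E.subspaceI)
    show "0 \<in> M" using scaled[OF M(3), of 0] by simp
    show "a + b \<in> M" if ab: "a \<in> M" "b \<in> M" for a b
      by (rule mem[OF E_space_closed(1)[OF ME[OF ab(1)] ME[OF ab(2)]] _ ab]) (rule mql_add)
  qed (rule scaled)
  moreover have "nth_prod scale \<alpha> n a b \<in> M" if ab: "a \<in> M" "b \<in> M" and "\<alpha> \<in> \<Gamma>" for a b \<alpha> n
  proof -
    have \<alpha>: "\<alpha> \<noteq> 0" using that \<Gamma> by auto
    obtain f where f: "compat a b f"
      using quasi_local_pairwise_compatible[OF M(1)] ab unfolding pairwise_compatible_def by blast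
    show ?thesis
    proof (rule mem[OF _ _ ab])
      show "nth_prod scale \<alpha> n a b \<in> E_space scale" by (rule nth_prod_in_E[OF ME[OF ab(1)] ME[OF ab(2)] f \<alpha>])
      show "mql (nth_prod scale \<alpha> n a b) x" if "x \<in> E_space scale" "mql a x" "mql b x" for x
        by (rule mql_nth_prod) (use that ab ME Mql \<alpha> in auto)
    qed
  qed
  ultimately have "Y_closed scale \<Gamma> M"
    using ME quasi_local_pairwise_compatible[OF M(1)] by (auto simp: Y_closed_def)
  then show thesis using that M by blast
qed

text \<open>
  The closed quasi local subspaces containing \<open>S\<close> and \<open>1\<^sub>W\<close> are closed under nonempty
  intersections, so that there is a least one.
\<close>

lemma generated_props:
  assumes S: "quasi_local scale S" and \<Gamma>: "0 \<notin> \<Gamma>"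
  shows "Y_closed scale \<Gamma> (generated scale \<Gamma> S)" "quasi_local scale (generated scale \<Gamma> S)"
    "fls_const \<in> generated scale \<Gamma> S"
proof -
  interpret E: complex_vector_space "E_scale scale" by (rule complex_vector_space_E)
  define P where "P U \<longleftrightarrow> Y_closed scale \<Gamma> U \<and> quasi_local scale U \<and> S \<subseteq> U \<and> fls_const \<in> U" for U
  let ?I = "\<Inter>(Collect P)"
  obtain M where M: "P M" using exists_closed_quasi_local[OF S \<Gamma>] unfolding P_def by blast
  then have sub: "?I \<subseteq> M" by blast
  have ql: "quasi_local scale ?I" using quasi_local_subset[OF _ sub] M by (simp add: P_def)
  have "E.subspace U" if "P U" for U using that by (simp add: P_def Y_closed_def)
  then have "E.subspace ?I" by (intro E.subspace_Inter) simp
  moreover have "?I \<subseteq> E_space scale" using ql by (simp add: quasi_local_def)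
  moreover have "nth_prod scale \<alpha> n a b \<in> ?I" if ab: "a \<in> ?I" "b \<in> ?I" "\<alpha> \<in> \<Gamma>" for a b \<alpha> n
  proof
    fix U assume "U \<in> Collect P"
    then have "a \<in> U" "b \<in> U" "Y_closed scale \<Gamma> U" using ab(1,2) by (auto simp: P_def)
    then show "nth_prod scale \<alpha> n a b \<in> U" using ab(3) by (simp add: Y_closed_def)
  qed
  ultimately have "Y_closed scale \<Gamma> ?I"
    using quasi_local_pairwise_compatible[OF ql] unfolding Y_closed_def by blast
  moreover have "S \<subseteq> ?I" "fls_const \<in> ?I" by (auto simp: P_def)
  ultimately have "P ?I" using ql by (simp add: P_def)
  moreover have "generated scale \<Gamma> S = ?I"
    unfolding generated_def P_def[symmetric] by (rule Least_equality) (use \<open>P ?I\<close> in auto)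
  ultimately show "Y_closed scale \<Gamma> (generated scale \<Gamma> S)" "quasi_local scale (generated scale \<Gamma> S)"
    "fls_const \<in> generated scale \<Gamma> S"
    by (simp_all only: P_def)
qed


section \<open>The vertex algebra and its quasi module\<close>

text \<open>
  The axioms of a vertex algebra other than the Jacobi identity are statements about two fields;
  quasi locality provides the polynomials for three.
\<close>

theorem quasi_module_of_closed:
  assumes closed: "Y_closed scale \<Gamma> U" and ql: "quasi_local scale U" and vac: "fls_const \<in> U" and one: "1 \<in> \<Gamma>"
  shows "quasi_module (E_scale scale) U (Y_alpha scale 1) fls_const scale (\<lambda>a. a)"
proof -
  interpret E: complex_vector_space "E_scale scale" by (rule complex_vector_space_E)
  let ?Y = "Y_alpha scale 1"
  have UE: "\<And>a. a \<in> U \<Longrightarrow> a \<in> E_space scale" and sub: "E.subspace U"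
    using closed by (auto simp: Y_closed_def)
  have comp: "\<exists>f. compat a b f" if "a \<in> U" "b \<in> U" for a b
    using closed that unfolding Y_closed_def pairwise_compatible_def by blast
  have qlp: "\<exists>f. ql_poly a b f" if "a \<in> U" "b \<in> U" for a b
    using ql that unfolding quasi_local_def mutually_quasi_local_iff by blast
  have Y_in: "fls_nth (?Y a b) k \<in> U" if ab: "a \<in> U" "b \<in> U" for a b k
  proof -
    obtain f where "compat a b f" using comp[OF ab] by blast
    then have "fls_nth (?Y a b) k = nth_prod scale 1 (- k - 1) a b" by (rule Y_alpha_nth) simp
    then show ?thesis using closed ab one unfolding Y_closed_def by simp
  qed
  have va: "vertex_algebra (E_scale scale) U ?Y fls_const"
  proof (intro vertex_algebra.intro vertex_algebra_axioms.intro E.vector_space_axioms)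
    show "E.subspace U" by (rule sub)
    show "fls_const \<in> U" by (rule vac)
    fix u u' v v' :: "'w \<Rightarrow> 'w fls" and k n
    assume u: "u \<in> U"
    show "?Y fls_const u = fls_const u" by (rule Y_alpha_vacuum_left)
    show "fls_nth (?Y u fls_const) 0 = u" by (rule Y_alpha_vacuum_right(2)[OF UE[OF u]])
    show "n < 0 \<Longrightarrow> fls_nth (?Y u fls_const) n = 0" by (rule Y_alpha_vacuum_right(1)[OF UE[OF u]])
    assume v: "v \<in> U"
    obtain f where f: "compat u v f" using comp[OF u v] by blast
    show "fls_nth (?Y u v) n \<in> U" by (rule Y_in[OF u v])
    show "?Y (E_scale scale k u) v = fls_scale (E_scale scale) k (?Y u v)"
      by (rule Y_alpha_scaled[OF f]) (simp_all add: op_prod_linear(2)[OF UE[OF u]])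
    show "?Y u (E_scale scale k v) = fls_scale (E_scale scale) k (?Y u v)"
      by (rule Y_alpha_scaled[OF f]) (simp_all add: op_prod_linear(4)[OF UE[OF u]])
    show "?Y u (v + v') = ?Y u v + ?Y u v'" if v': "v' \<in> U"
    proof -
      obtain f' where "compat u v' f'" using comp[OF u v'] by blast
      from Y_alpha_sum[OF f this] show ?thesis by (simp add: op_prod_linear(3)[OF UE[OF u]])
    qed
    show "jacobi_times (E_scale scale) ?Y ?Y 1 u v v'" if v': "v' \<in> U"
    proof -
      obtain f1 f2 f3 where "ql_poly u v f1" "ql_poly u v' f2" "ql_poly v v' f3"
        using qlp u v v' by metis
      then have "quasi_local_triple scale u v v' f1 f2 f3"
        using u v v' UE comp Y_in by unfold_locales (auto simp: ql_poly_def)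
      then show ?thesis by (rule quasi_local_triple.jacobi_on_E)
    qed
    show "?Y (u + u') v = ?Y u v + ?Y u' v" if u': "u' \<in> U"
    proof -
      obtain f' where "compat u' v f'" using comp[OF u' v] by blast
      from Y_alpha_sum[OF f this] show ?thesis by (simp add: op_prod_linear(1)[OF UE[OF u]])
    qed
  qed
  show ?thesis
  proof (intro quasi_module.intro quasi_module_axioms.intro va vector_space_axioms)
    show "v \<in> U \<Longrightarrow> v \<in> E_space scale" for v by (rule UE)
    fix u v assume u: "u \<in> U" and v: "v \<in> U"
    obtain f where f: "ql_poly u v f" using qlp[OF u v] by blast
    have comp: "compat u v f" by (rule ql_poly_compat[OF UE[OF u] UE[OF v] f])
    have "jacobi_times scale ?Y (\<lambda>a. a) f u v w" for w
    proof -
      \<comment> \<open>The relation characterising \<open>\<Y>(u, x\<^sub>0) v w\<close> is the hypothesis of the delta function argument.\<close>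
      define G where "G = (\<lambda>(p, n). fls_nth (fls_nth (?Y u v) p w) n)"
      have G: "G = yprod 1 u v w"
        by (auto simp: G_def fun_eq_iff Y_alpha_nth_nth[OF comp])
      have "G \<in> bounded_along fst"
        using yprod_iter_laurent2(2)[OF comp one_neq_zero] unfolding G bounded_along_def by auto
      moreover have "ev f (mon (1, 0) + mon (0, 1)) (mon (0, 1)) \<bullet> G = subst2 1 (poly12 f \<bullet> op_prod u v w)"
        using yprod_char[OF comp one_neq_zero, of w] by (simp add: G)
      moreover have "poly12 f \<bullet> op_prod_rev u v w = poly12 f \<bullet> op_prod u v w"
        using f by (simp add: ql_poly_def)
      moreover have "poly12 f \<bullet> op_prod u v w \<in> laurent2" using comp by (simp add: compat_iff)
      ultimately show ?thesis
        unfolding jacobi_times_def G_def[symmetric]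
        by (intro allI quasi_jacobi_of_expansions[OF refl])
    qed
    then show "\<exists>f. f \<noteq> 0 \<and> (\<forall>w. jacobi_times scale ?Y (\<lambda>a. a) f u v w)"
      using f unfolding ql_poly_def by blast
  qed simp_all
qed

end

theorem theorem5p4:
  fixes scale :: "complex \<Rightarrow> 'w::ab_group_add \<Rightarrow> 'w" and \<Gamma> :: "complex set"
  assumes "vector_space scale"
    and "subgroup \<Gamma> complex_units"
  shows "(\<forall>U. Y_closed scale \<Gamma> U \<and> quasi_local scale U \<and> E_one \<in> U \<longrightarrow>
            quasi_module (E_scale scale) U (Y_alpha scale 1) E_one scale (\<lambda>a. a)) \<and>
         (\<forall>S. quasi_local scale S \<longrightarrow>
            quasi_module (E_scale scale) (generated scale \<Gamma> S) (Y_alpha scale 1) E_one scale (\<lambda>a. a))"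
proof -
  interpret complex_vector_space scale
    using assms(1) by (simp add: complex_vector_space_def)
  have one: "1 \<in> \<Gamma>" using subgroup.one_closed[OF assms(2)] by (simp add: complex_units_def)
  have zero: "0 \<notin> \<Gamma>" using subgroup.subset[OF assms(2)] by (auto simp: complex_units_def)
  show ?thesis
    using quasi_module_of_closed[OF _ _ _ one] generated_props[OF _ zero] by blast
qed

end
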